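(* Let $(R,\mathfrak m,k)$ be a noetherian local ring (or a standard graded $k$-algebra). Let $0\to M\xrightarrow{\phi} P\xrightarrow{\lambda} N\to 0$ be a short exact sequence of non-zero finitely generated $R$-modules (graded, with degree-preserving maps, in the graded case). Define the (possibly infinite) numbers \begin{align*} d_M&=\inf\{m\ge 0: \text{the connecting map } \operatorname{Tor}^R_{i+1}(k,N)\to \operatorname{Tor}^R_i(k,M) \text{ is zero for all } i\ge m\},\\ d_P&=\inf\{m\ge 0: \text{the map } \operatorname{Tor}^R_i(k,\phi):\operatorname{Tor}^R_i(k,M)\to \operatorname{Tor}^R_i(k,P) \text{ is zero for all } i\ge m\},\\ d_N&=\inf\{m\ge 0: \text{the map } \operatorname{Tor}^R_i(k,\lambda):\operatorname{Tor}^R_i(k,P)\to \operatorname{Tor}^R_i(k,N) \text{ is zero for all } i\ge m\}. \end{align*} Then: (i) $\operatorname{ld}_R N\le \max\{\min\{d_P,d_M+1\},\ \operatorname{ld}_R P,\ \operatorname{ld}_R M+1\}$; (ii) $\operatorname{ld}_R P\le \max\{\min\{d_M,d_N\},\ \operatorname{ld}_R M,\ \operatorname{ld}_R N\}$; (iii) $\operatorname{ld}_R M\le \max\{\min\{d_N-1,d_P\},\ \operatorname{ld}_R N-1,\ \operatorname{ld}_R P\}$.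
   Context: $(R,\mathfrak m,k)$ denotes a commutative noetherian local ring with maximal ideal $\mathfrak m$ and residue field $k=R/\mathfrak m$; statements are also meant to cover, with the obvious changes, the graded situation where $R$ is a standard graded $k$-algebra with graded maximal ideal $\mathfrak m$ and modules are graded. The infimum of the empty set is $\infty$. Linearity defect: for a finitely generated $R$-module $M$ with minimal free resolution $F$, filter $F$ by the subcomplexes $\mathcal G^nF$ with $(\mathcal G^nF)_i=\mathfrak m^{n-i}F_i$ (where $\mathfrak m^j=R$ for $j\le 0$), with differential induced by that of $F$. The associated graded complex of this filtration is the linear part $\operatorname{lin}^R F$. The linearity defect is $\operatorname{ld}_R M=\sup\{i: H_i(\operatorname{lin}^R F)\ne 0\}\in\{0,1,\dots\}\cup\{\infty\}$ for $M\neq 0$, and $\operatorname{ld}_R 0=0$. *)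

theory Defs
  imports
    Complex_Main
    "HOL-Library.Extended_Real"
    "HOL-Library.Function_Algebras"
    "HOL-Algebra.Coset"
begin

text \<open>
  The ring is a type of class \<open>comm_ring_1\<close> and modules over it are types with a scalar
  multiplication satisfying the locale \<open>module\<close> of \<open>HOL.Modules\<close>. Quotients and homology
  are formed as quotient groups (\<open>Mod\<close>) of the underlying additive groups: only the vanishing
  of homology and of maps between homology modules is needed.
\<close>

definition additive_group :: "'a::ab_group_add set \<Rightarrow> 'a monoid" where
  "additive_group Z = \<lparr>carrier = Z, mult = (+), one = 0\<rparr>"

text \<open>The map \<open>A Mod H \<rightarrow> B Mod K\<close> induced by a map \<open>f\<close> from \<open>A\<close> to \<open>B\<close> with
  \<open>f ` H \<subseteq> K\<close>: for a coset \<open>S\<close> of \<open>H\<close>, the set below is the coset of \<open>K\<close> containing \<open>f ` S\<close>.\<close>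
definition coset_map :: "'b monoid \<Rightarrow> 'b set \<Rightarrow> ('a \<Rightarrow> 'b) \<Rightarrow> 'a set \<Rightarrow> 'b set" where
  "coset_map B K f S = K <#>\<^bsub>B\<^esub> (f ` S)"

definition zero_map :: "'a monoid \<Rightarrow> 'b monoid \<Rightarrow> ('a \<Rightarrow> 'b) \<Rightarrow> bool" where
  "zero_map A B h \<longleftrightarrow> (\<forall>x\<in>carrier A. h x = \<one>\<^bsub>B\<^esub>)"


section \<open>Complexes and homology\<close>

text \<open>Complexes are concentrated in nonnegative degrees; \<open>d i\<close> goes from degree \<open>Suc i\<close> to
  degree \<open>i\<close>.\<close>

definition chain_cycles ::
    "(nat \<Rightarrow> 'a monoid) \<Rightarrow> (nat \<Rightarrow> 'a \<Rightarrow> 'a) \<Rightarrow> nat \<Rightarrow> 'a set" where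
  "chain_cycles C d i =
    (case i of 0 \<Rightarrow> carrier (C 0) | Suc j \<Rightarrow> kernel (C (Suc j)) (C j) (d j))"

definition chain_boundaries ::
    "(nat \<Rightarrow> 'a monoid) \<Rightarrow> (nat \<Rightarrow> 'a \<Rightarrow> 'a) \<Rightarrow> nat \<Rightarrow> 'a set" where
  "chain_boundaries C d i = d i ` carrier (C (Suc i))"

definition homology ::
    "(nat \<Rightarrow> 'a monoid) \<Rightarrow> (nat \<Rightarrow> 'a \<Rightarrow> 'a) \<Rightarrow> nat \<Rightarrow> 'a set monoid" where
  "homology C d i = ((C i)\<lparr>carrier := chain_cycles C d i\<rparr>) Mod chain_boundaries C d i"

text \<open>The connecting map \<open>H\<^sub>i\<^sub>+\<^sub>1(C) \<rightarrow> H\<^sub>i(A)\<close> of a short exact sequence of complexes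
  \<open>0 \<rightarrow> A \<rightarrow> B \<rightarrow> C \<rightarrow> 0\<close> with maps \<open>f\<close> and \<open>g\<close>: a class \<open>S\<close> is lifted to a chain \<open>y\<close> of \<open>B\<close>,
  and \<open>d y\<close> is pulled back along \<open>f\<close>. Over all choices of a representative of \<open>S\<close> and
  of its lift \<open>y\<close>, the cycles so obtained form exactly one homology class of \<open>A\<close>.\<close>
definition connecting_map ::
    "(nat \<Rightarrow> 'a monoid) \<Rightarrow> (nat \<Rightarrow> 'a \<Rightarrow> 'a) \<Rightarrow> (nat \<Rightarrow> 'b monoid) \<Rightarrow> (nat \<Rightarrow> 'b \<Rightarrow> 'b) \<Rightarrow>
     ('a \<Rightarrow> 'b) \<Rightarrow> ('b \<Rightarrow> 'c) \<Rightarrow> nat \<Rightarrow> 'c set \<Rightarrow> 'a set" where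
  "connecting_map A dA B dB f g i S =
    {z \<in> chain_cycles A dA i. \<exists>y\<in>carrier (B (Suc i)). g y \<in> S \<and> dB i y = f z}"


section \<open>Ideals, modules and noetherian local rings\<close>

definition is_ideal :: "'r::comm_ring_1 set \<Rightarrow> bool" where
  "is_ideal I \<longleftrightarrow> module.subspace (*) I"

definition is_maximal_ideal :: "'r::comm_ring_1 set \<Rightarrow> bool" where
  "is_maximal_ideal I \<longleftrightarrow>
    is_ideal I \<and> I \<noteq> UNIV \<and> (\<forall>J. is_ideal J \<longrightarrow> I \<subseteq> J \<longrightarrow> J = I \<or> J = UNIV)"

definition noetherian_local :: "'r::comm_ring_1 set \<Rightarrow> bool" where
  "noetherian_local m \<longleftrightarrow>
    (\<forall>I::'r set. is_ideal I \<longrightarrow> (\<exists>A. finite A \<and> I = module.span (*) A)) \<and>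
    is_maximal_ideal m \<and> (\<forall>I. is_maximal_ideal I \<longrightarrow> I = m)"

definition finitely_generated :: "('r::comm_ring_1 \<Rightarrow> 'm::ab_group_add \<Rightarrow> 'm) \<Rightarrow> bool" where
  "finitely_generated s \<longleftrightarrow> (\<exists>A. finite A \<and> module.span s A = UNIV)"

definition short_exact ::
    "('r::comm_ring_1 \<Rightarrow> 'm::ab_group_add \<Rightarrow> 'm) \<Rightarrow> ('r \<Rightarrow> 'p::ab_group_add \<Rightarrow> 'p) \<Rightarrow>
     ('r \<Rightarrow> 'n::ab_group_add \<Rightarrow> 'n) \<Rightarrow> ('m \<Rightarrow> 'p) \<Rightarrow> ('p \<Rightarrow> 'n) \<Rightarrow> bool" where
  "short_exact sM sP sN f g \<longleftrightarrow>
    module_hom sM sP f \<and> module_hom sP sN g \<and> inj f \<and> range f = {x. g x = 0} \<and> surj g"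

text \<open>The submodule \<open>I N\<close> for a submodule \<open>N\<close>.\<close>
definition ideal_smult ::
    "('r::comm_ring_1 \<Rightarrow> 'm::ab_group_add \<Rightarrow> 'm) \<Rightarrow> 'r set \<Rightarrow> 'm set \<Rightarrow> 'm set" where
  "ideal_smult s I N = module.span s {s a x | a x. a \<in> I \<and> x \<in> N}"

primrec ideal_power :: "'r::comm_ring_1 set \<Rightarrow> nat \<Rightarrow> 'r set" where
  "ideal_power I 0 = UNIV"
| "ideal_power I (Suc n) = ideal_smult (*) I (ideal_power I n)"


section \<open>Free complexes and resolutions\<close>

text \<open>A complex of finitely generated free modules with chosen bases: in degree \<open>i\<close> the module
  is \<open>R\<close> to the power \<open>free_rank F i\<close>, and \<open>diff_mat F i\<close> is the matrix of the differential
  from degree \<open>Suc i\<close> to degree \<open>i\<close> (row index first; entries outside the ranks are ignored).\<close>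
record 'r free_complex =
  free_rank :: "nat \<Rightarrow> nat"
  diff_mat :: "nat \<Rightarrow> nat \<Rightarrow> nat \<Rightarrow> 'r"

text \<open>The complex \<open>F \<otimes> M\<close>, with \<open>R\<^sup>b \<otimes> M\<close> identified with \<open>M\<^sup>b\<close>; elements of \<open>M\<^sup>b\<close> are
  functions on \<open>nat\<close> vanishing from \<open>b\<close> on.\<close>

definition tensor_chain :: "'r free_complex \<Rightarrow> nat \<Rightarrow> (nat \<Rightarrow> 'm::ab_group_add) monoid" where
  "tensor_chain F i = additive_group {x. \<forall>j\<ge>free_rank F i. x j = 0}"

definition tensor_diff ::
    "('r \<Rightarrow> 'm::ab_group_add \<Rightarrow> 'm) \<Rightarrow> 'r free_complex \<Rightarrow> nat \<Rightarrow> (nat \<Rightarrow> 'm) \<Rightarrow> nat \<Rightarrow> 'm" where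
  "tensor_diff s F i x =
    (\<lambda>j. if j < free_rank F i
         then \<Sum>l<free_rank F (Suc i). s (diff_mat F i j l) (x l) else 0)"

abbreviation free_chain :: "'r::comm_ring_1 free_complex \<Rightarrow> nat \<Rightarrow> (nat \<Rightarrow> 'r) monoid" where
  "free_chain F \<equiv> tensor_chain F"

abbreviation free_diff ::
    "'r::comm_ring_1 free_complex \<Rightarrow> nat \<Rightarrow> (nat \<Rightarrow> 'r) \<Rightarrow> nat \<Rightarrow> 'r" where
  "free_diff F \<equiv> tensor_diff (*) F"

definition vec_scale :: "'r::comm_ring_1 \<Rightarrow> (nat \<Rightarrow> 'r) \<Rightarrow> nat \<Rightarrow> 'r" where
  "vec_scale a v = (\<lambda>j. a * v j)"

text \<open>\<open>F\<close> with augmentation \<open>e\<close> is a free resolution of the module with underlying additive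
  group \<open>Q\<close> and scalar multiplication \<open>act\<close>.\<close>
definition free_resolution ::
    "'q monoid \<Rightarrow> ('r::comm_ring_1 \<Rightarrow> 'q \<Rightarrow> 'q) \<Rightarrow> 'r free_complex \<Rightarrow>
     ((nat \<Rightarrow> 'r) \<Rightarrow> 'q) \<Rightarrow> bool" where
  "free_resolution Q act F e \<longleftrightarrow>
    e \<in> hom (free_chain F 0) Q \<and>
    (\<forall>a. \<forall>v\<in>carrier (free_chain F 0). e (vec_scale a v) = act a (e v)) \<and>
    e ` carrier (free_chain F 0) = carrier Q \<and>
    kernel (free_chain F 0) Q e = chain_boundaries (free_chain F) (free_diff F) 0 \<and>
    (\<forall>i. chain_cycles (free_chain F) (free_diff F) (Suc i) =
         chain_boundaries (free_chain F) (free_diff F) (Suc i))"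

definition minimal_complex :: "'r::comm_ring_1 set \<Rightarrow> 'r free_complex \<Rightarrow> bool" where
  "minimal_complex m F \<longleftrightarrow>
    (\<forall>i. chain_boundaries (free_chain F) (free_diff F) i
         \<subseteq> ideal_smult vec_scale m (carrier (free_chain F i)))"


section \<open>Linear part and linearity defect\<close>

text \<open>The submodule of \<open>F\<^sub>i\<close> in filtration degree \<open>n\<close>. Subtraction of natural numbers is
  truncated, which accounts for the convention that nonpositive powers of \<open>m\<close> are \<open>R\<close>.\<close>
definition lin_filtration ::
    "'r::comm_ring_1 set \<Rightarrow> 'r free_complex \<Rightarrow> nat \<Rightarrow> nat \<Rightarrow> (nat \<Rightarrow> 'r) set" where
  "lin_filtration m F n i =
    ideal_smult vec_scale (ideal_power m (n - i)) (carrier (free_chain F i))"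

text \<open>The linear part is the direct sum over \<open>n\<close> of the complexes with terms
  \<open>lin_chain m F n i\<close> and differentials \<open>lin_diff m F n i\<close> (for negative \<open>n\<close> the quotients
  are zero), so its homology in degree \<open>i\<close> is the direct sum of the groups
  \<open>lin_homology m F n i\<close>.\<close>

definition lin_chain ::
    "'r::comm_ring_1 set \<Rightarrow> 'r free_complex \<Rightarrow> nat \<Rightarrow> nat \<Rightarrow> (nat \<Rightarrow> 'r) set monoid" where
  "lin_chain m F n i = additive_group (lin_filtration m F n i) Mod lin_filtration m F (Suc n) i"

definition lin_diff ::
    "'r::comm_ring_1 set \<Rightarrow> 'r free_complex \<Rightarrow> nat \<Rightarrow> nat \<Rightarrow>
     (nat \<Rightarrow> 'r) set \<Rightarrow> (nat \<Rightarrow> 'r) set" where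
  "lin_diff m F n i =
    coset_map (additive_group (lin_filtration m F n i)) (lin_filtration m F (Suc n) i)
      (free_diff F i)"

definition lin_homology ::
    "'r::comm_ring_1 set \<Rightarrow> 'r free_complex \<Rightarrow> nat \<Rightarrow> nat \<Rightarrow>
     (nat \<Rightarrow> 'r) set set monoid" where
  "lin_homology m F n i = homology (lin_chain m F n) (lin_diff m F n) i"

text \<open>In \<open>enat\<close> the supremum of the empty set is \<open>0\<close>, which is the value for the zero module.\<close>
definition lin_sup :: "'r::comm_ring_1 set \<Rightarrow> 'r free_complex \<Rightarrow> enat" where
  "lin_sup m F =
    Sup (enat ` {i. \<exists>n. carrier (lin_homology m F n i) \<noteq> {\<one>\<^bsub>lin_homology m F n i\<^esub>}})"

definition linearity_defect ::
    "'r::comm_ring_1 set \<Rightarrow> ('r \<Rightarrow> 'm::ab_group_add \<Rightarrow> 'm) \<Rightarrow> enat" where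
  "linearity_defect m s =
    lin_sup m (SOME F. minimal_complex m F \<and> (\<exists>e. free_resolution (additive_group UNIV) s F e))"


section \<open>Tor with coefficients in the residue field\<close>

definition residue_group :: "'r::comm_ring_1 set \<Rightarrow> 'r set monoid" where
  "residue_group m = additive_group UNIV Mod m"

definition residue_act :: "'r::comm_ring_1 set \<Rightarrow> 'r \<Rightarrow> 'r set \<Rightarrow> 'r set" where
  "residue_act m a = coset_map (additive_group UNIV) m ((*) a)"

definition residue_resolution :: "'r::comm_ring_1 set \<Rightarrow> 'r free_complex" where
  "residue_resolution m =
    (SOME F. \<exists>e. free_resolution (residue_group m) (residue_act m) F e)"

text \<open>\<open>Tor_k m s i\<close> is \<open>Tor\<^sub>i(R/m, M)\<close>, computed from a free resolution of the first
  argument; the induced maps and the connecting maps are then those of the complexes obtained by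
  tensoring this resolution with the modules.\<close>

definition Tor_k ::
    "'r::comm_ring_1 set \<Rightarrow> ('r \<Rightarrow> 'm::ab_group_add \<Rightarrow> 'm) \<Rightarrow> nat \<Rightarrow> (nat \<Rightarrow> 'm) set monoid" where
  "Tor_k m s i =
    homology (tensor_chain (residue_resolution m)) (tensor_diff s (residue_resolution m)) i"

text \<open>The argument \<open>s\<close> is the scalar multiplication of the target of \<open>f\<close>.\<close>
definition Tor_k_map ::
    "'r::comm_ring_1 set \<Rightarrow> ('r \<Rightarrow> 'p::ab_group_add \<Rightarrow> 'p) \<Rightarrow> ('m::ab_group_add \<Rightarrow> 'p) \<Rightarrow> nat \<Rightarrow>
     (nat \<Rightarrow> 'm) set \<Rightarrow> (nat \<Rightarrow> 'p) set" where
  "Tor_k_map m s f i =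
    coset_map (tensor_chain (residue_resolution m) i)
      (chain_boundaries (tensor_chain (residue_resolution m))
        (tensor_diff s (residue_resolution m)) i)
      (\<lambda>x. f \<circ> x)"

definition Tor_k_connecting ::
    "'r::comm_ring_1 set \<Rightarrow> ('r \<Rightarrow> 'm::ab_group_add \<Rightarrow> 'm) \<Rightarrow> ('r \<Rightarrow> 'p::ab_group_add \<Rightarrow> 'p) \<Rightarrow>
     ('m \<Rightarrow> 'p) \<Rightarrow> ('p \<Rightarrow> 'n::ab_group_add) \<Rightarrow> nat \<Rightarrow> (nat \<Rightarrow> 'n) set \<Rightarrow> (nat \<Rightarrow> 'm) set" where
  "Tor_k_connecting m sM sP f g i =
    connecting_map
      (tensor_chain (residue_resolution m)) (tensor_diff sM (residue_resolution m))
      (tensor_chain (residue_resolution m)) (tensor_diff sP (residue_resolution m))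
      (\<lambda>x. f \<circ> x) (\<lambda>y. g \<circ> y) i"

text \<open>In \<open>enat\<close> the infimum of the empty set is \<open>\<infinity>\<close>.\<close>
definition inf_from :: "(nat \<Rightarrow> bool) \<Rightarrow> enat" where
  "inf_from Z = Inf (enat ` {n. \<forall>i\<ge>n. Z i})"


section \<open>The graded situation\<close>

definition internal_direct_sum :: "('i \<Rightarrow> 'a::ab_group_add set) \<Rightarrow> bool" where
  "internal_direct_sum A \<longleftrightarrow>
    (\<forall>i. 0 \<in> A i \<and> (\<forall>x\<in>A i. \<forall>y\<in>A i. x + y \<in> A i) \<and> (\<forall>x\<in>A i. - x \<in> A i)) \<and>
    (\<forall>x. \<exists>!f. (\<forall>i. f i \<in> A i) \<and> finite {i. f i \<noteq> 0} \<and> x = (\<Sum>i\<in>{i. f i \<noteq> 0}. f i))"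

text \<open>The ground field \<open>k\<close> is the degree zero component. The last condition says that the ring
  is generated, as an algebra over it, by finitely many elements of degree one.\<close>
definition standard_graded :: "(int \<Rightarrow> 'r::comm_ring_1 set) \<Rightarrow> bool" where
  "standard_graded Rg \<longleftrightarrow>
    internal_direct_sum Rg \<and> (\<forall>n<0. Rg n = {0}) \<and> 1 \<in> Rg 0 \<and>
    (\<forall>a b. \<forall>x\<in>Rg a. \<forall>y\<in>Rg b. x * y \<in> Rg (a + b)) \<and>
    (\<forall>x\<in>Rg 0. x \<noteq> 0 \<longrightarrow> (\<exists>y\<in>Rg 0. x * y = 1)) \<and>
    (\<exists>X. finite X \<and> X \<subseteq> Rg 1 \<and>
      (\<forall>S. Rg 0 \<union> X \<subseteq> S \<longrightarrow> (\<forall>x\<in>S. \<forall>y\<in>S. x + y \<in> S \<and> x * y \<in> S) \<longrightarrow> S = UNIV))"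

definition graded_maximal_ideal :: "(int \<Rightarrow> 'r::comm_ring_1 set) \<Rightarrow> 'r set" where
  "graded_maximal_ideal Rg = module.span (*) (\<Union>n\<in>{1..}. Rg n)"

definition graded_module ::
    "(int \<Rightarrow> 'r::comm_ring_1 set) \<Rightarrow> ('r \<Rightarrow> 'm::ab_group_add \<Rightarrow> 'm) \<Rightarrow> (int \<Rightarrow> 'm set) \<Rightarrow> bool" where
  "graded_module Rg s Mg \<longleftrightarrow>
    module s \<and> internal_direct_sum Mg \<and>
    (\<forall>a b. \<forall>x\<in>Rg a. \<forall>y\<in>Mg b. s x y \<in> Mg (a + b))"

text \<open>The component of degree \<open>t\<close> of \<open>F\<^sub>i\<close> when the \<open>j\<close>-th basis vector of \<open>F\<^sub>i\<close> has degree
  \<open>deg i j\<close>.\<close>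
definition graded_free_piece ::
    "(int \<Rightarrow> 'r::comm_ring_1 set) \<Rightarrow> 'r free_complex \<Rightarrow> (nat \<Rightarrow> nat \<Rightarrow> int) \<Rightarrow> nat \<Rightarrow> int \<Rightarrow>
     (nat \<Rightarrow> 'r) set" where
  "graded_free_piece Rg F deg i t =
    {v \<in> carrier (free_chain F i). \<forall>j<free_rank F i. v j \<in> Rg (t - deg i j)}"

definition graded_resolution ::
    "(int \<Rightarrow> 'r::comm_ring_1 set) \<Rightarrow> ('r \<Rightarrow> 'm::ab_group_add \<Rightarrow> 'm) \<Rightarrow> (int \<Rightarrow> 'm set) \<Rightarrow>
     'r free_complex \<Rightarrow> bool" where
  "graded_resolution Rg s Mg F \<longleftrightarrow>
    (\<exists>e deg. free_resolution (additive_group UNIV) s F e \<and>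
      (\<forall>t. e ` graded_free_piece Rg F deg 0 t \<subseteq> Mg t) \<and>
      (\<forall>i t. free_diff F i ` graded_free_piece Rg F deg (Suc i) t
             \<subseteq> graded_free_piece Rg F deg i t))"

definition graded_linearity_defect ::
    "(int \<Rightarrow> 'r::comm_ring_1 set) \<Rightarrow> ('r \<Rightarrow> 'm::ab_group_add \<Rightarrow> 'm) \<Rightarrow> (int \<Rightarrow> 'm set) \<Rightarrow> enat" where
  "graded_linearity_defect Rg s Mg =
    lin_sup (graded_maximal_ideal Rg)
      (SOME F. minimal_complex (graded_maximal_ideal Rg) F \<and> graded_resolution Rg s Mg F)"

end

theory Submission
  imports Defs "HOL-Computational_Algebra.Polynomial"
begin

text \<open>
  The linearity defect is read off from maps on Tor, as observed by Sega: \<open>ld M \<le> d\<close> holds exactly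
  when \<open>Tor\<^sub>j\<^sub>+\<^sub>1(R/m\<^sup>n\<^sup>+\<^sup>1, M) \<rightarrow> Tor\<^sub>j\<^sub>+\<^sub>1(R/m\<^sup>n, M)\<close> is zero for all \<open>j \<ge> d\<close> and all \<open>n\<close>. On a
  minimal resolution \<open>F\<close> this says that an element of \<open>F\<^sub>j\<^sub>+\<^sub>1\<close> whose differential lies in
  \<open>m\<^sup>n\<^sup>+\<^sup>1 F\<^sub>j\<close> is a boundary modulo \<open>m\<^sup>n F\<^sub>j\<^sub>+\<^sub>1\<close> (\<open>tor_shift_zero\<close>). The equivalence with the exactness
  of the linear part is \<open>lin_exact_imp_shift\<close> and \<open>shift_imp_lin_exact\<close>. The condition does not
  depend on the choice of the free resolution (\<open>tor_shift_zero_independent\<close>).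

  Let \<open>u\<close> be a chain map between minimal resolutions of \<open>M\<close> and \<open>P\<close> that lifts \<open>\<phi>\<close>. Its mapping cone
  resolves \<open>N\<close> (\<open>cone_resolution\<close>), so that all three defects are conditions on \<open>u\<close> and the two
  resolutions. By minimality \<open>Tor\<^sub>i(k, \<phi>)\<close> is \<open>u\<^sub>i\<close> modulo \<open>m\<close>. Hence, in degree \<open>i\<close>, the vanishing of the
  connecting map, of \<open>Tor\<^sub>i(k, \<phi>)\<close> and of \<open>Tor\<^sub>i(k, lam)\<close> means that \<open>u\<^sub>i\<close> modulo \<open>m\<close> is injective,
  zero and surjective, respectively. In each of the three estimates the required vanishing holds
  for two of the modules, and one of these properties of \<open>u\<close> transfers it to the third
  (\<open>middle_shift\<close>, \<open>right_shift\<close>, \<open>left_shift\<close>). What makes this work is that \<open>u\<close> stays injective,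
  zero or surjective after tensoring with the \<open>R/m\<close>-vector space \<open>m\<^sup>n/m\<^sup>n\<^sup>+\<^sup>1\<close>, and that minimal
  differentials raise the power of \<open>m\<close> by one.

  The maps on Tor are given through a resolution \<open>K\<close> of the residue field tensored with the modules.
  They are compared with \<open>u\<close> modulo \<open>m\<close> through the double complexes \<open>K \<otimes> F\<close>, by chasing zigzags
  (\<open>staircase\<close>, \<open>represents_boundary_iff\<close>).

  Finally, the resolutions have to exist. Over a local ring a generating set without redundant
  elements has all its relations in \<open>m\<close> (\<open>minimal_resolution_local\<close>). Over a standard graded algebra
  the same holds for homogeneous generating sets (\<open>minimal_resolution_graded\<close>), and the finite
  generation of syzygies is Hilbert's basis theorem (\<open>noetherian_adjoin\<close>).
\<close>

section \<open>Vectors with entries in an ideal\<close>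

text \<open>The operation \<open>vec_scale\<close> for an arbitrary index type: the bases of a mapping cone are
  indexed by a sum type.\<close>
definition vscale :: "'r::comm_ring_1 \<Rightarrow> ('i \<Rightarrow> 'r) \<Rightarrow> 'i \<Rightarrow> 'r" where
  "vscale a v = (\<lambda>j. a * v j)"

lemma vec_scale_eq: "vec_scale = vscale"
  by (intro ext) (simp add: vec_scale_def vscale_def)

lemma vscale_apply [simp]: "vscale a v j = a * v j"
  by (simp add: vscale_def)

lemma sum_fun_apply: "(\<Sum>l\<in>L. f l) j = (\<Sum>l\<in>L. f l j)"
  by (induction L rule: infinite_finite_induct) auto

lemma module_mult: "module ((*) :: 'r::comm_ring_1 \<Rightarrow> 'r \<Rightarrow> 'r)"
  by unfold_locales (auto simp: algebra_simps)

interpretation vec: module "vscale :: 'r::comm_ring_1 \<Rightarrow> ('i \<Rightarrow> 'r) \<Rightarrow> 'i \<Rightarrow> 'r"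
  by unfold_locales (auto simp: fun_eq_iff algebra_simps)

abbreviation linear_map :: "(('i \<Rightarrow> 'r::comm_ring_1) \<Rightarrow> 'j \<Rightarrow> 'r) \<Rightarrow> bool" where
  "linear_map \<equiv> module_hom vscale vscale"

lemma module_homI:
  assumes "module s" "module t" "\<And>x y. f (x + y) = f x + f y" "\<And>a x. f (s a x) = t a (f x)"
  shows "module_hom s t f"
  using assms by (simp add: module_hom_iff)

lemma hom_add: "module_hom s t f \<Longrightarrow> f (x + y) = f x + f y"
  and hom_scale: "module_hom s t f \<Longrightarrow> f (s a x) = t a (f x)"
  and hom_zero: "module_hom s t f \<Longrightarrow> f 0 = 0"
  and hom_diff: "module_hom s t f \<Longrightarrow> f (x - y) = f x - f y"
  and hom_neg: "module_hom s t f \<Longrightarrow> f (- x) = - f x"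
  and hom_sum: "module_hom s t f \<Longrightarrow> f (sum g S) = (\<Sum>i\<in>S. f (g i))"
  by (simp_all add: module_hom.add module_hom.scale module_hom.zero module_hom.diff
      module_hom.neg module_hom.sum)

lemma ideal_zero: "is_ideal A \<Longrightarrow> 0 \<in> A"
  and ideal_add: "is_ideal A \<Longrightarrow> a \<in> A \<Longrightarrow> b \<in> A \<Longrightarrow> a + b \<in> A"
  and ideal_diff: "is_ideal A \<Longrightarrow> a \<in> A \<Longrightarrow> b \<in> A \<Longrightarrow> a - b \<in> A"
  and ideal_neg: "is_ideal A \<Longrightarrow> a \<in> A \<Longrightarrow> - a \<in> A"
  and ideal_mult: "is_ideal A \<Longrightarrow> a \<in> A \<Longrightarrow> r * a \<in> A"
  and ideal_sum: "is_ideal A \<Longrightarrow> (\<And>i. i \<in> S \<Longrightarrow> f i \<in> A) \<Longrightarrow> sum f S \<in> A"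
  unfolding is_ideal_def
  by (simp_all add: module.subspace_0[OF module_mult] module.subspace_add[OF module_mult]
    module.subspace_diff[OF module_mult] module.subspace_neg[OF module_mult]
    module.subspace_scale[OF module_mult] module.subspace_sum[OF module_mult])

lemma ideal_mult_right: "is_ideal A \<Longrightarrow> a \<in> A \<Longrightarrow> a * r \<in> A"
  by (subst mult.commute) (rule ideal_mult)

lemma ideal_UNIV [simp]: "is_ideal UNIV"
  by (simp add: is_ideal_def module.subspace_UNIV[OF module_mult])

lemma is_idealI:
  assumes "0 \<in> A" "\<And>a b. a \<in> A \<Longrightarrow> b \<in> A \<Longrightarrow> a + b \<in> A" "\<And>r a. a \<in> A \<Longrightarrow> r * a \<in> A"
  shows "is_ideal A"
  unfolding is_ideal_def by (rule module.subspaceI[OF module_mult]) (use assms in auto)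

lemma ideal_prod [simp]: "is_ideal (ideal_smult (*) A B)"
  by (simp add: is_ideal_def ideal_smult_def module.subspace_span[OF module_mult])

lemma ideal_prodI: "a \<in> A \<Longrightarrow> b \<in> B \<Longrightarrow> a * b \<in> ideal_smult (*) A B"
  unfolding ideal_smult_def by (rule module.span_base[OF module_mult]) auto

lemma ideal_prod_least:
  assumes "is_ideal C" "\<And>a b. a \<in> A \<Longrightarrow> b \<in> B \<Longrightarrow> a * b \<in> C"
  shows "ideal_smult (*) A B \<subseteq> C"
  unfolding ideal_smult_def
  by (rule module.span_minimal[OF module_mult]) (use assms in \<open>auto simp: is_ideal_def\<close>)

lemma ideal_power_ideal [simp]: "is_ideal (ideal_power m n)"
  by (cases n) auto

lemma ideal_power_mult: "a \<in> m \<Longrightarrow> b \<in> ideal_power m n \<Longrightarrow> a * b \<in> ideal_power m (Suc n)"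
  by (simp add: ideal_prodI)

lemma ideal_power_Suc_subset:
  "is_ideal m \<Longrightarrow> ideal_power m (Suc n) \<subseteq> ideal_power m n"
  by (simp, rule ideal_prod_least) (auto simp: ideal_mult)

lemma ideal_power_antimono:
  assumes "is_ideal m" "i \<le> j" shows "ideal_power m j \<subseteq> ideal_power m i"
  using lift_Suc_antimono_le[of "ideal_power m" i j] ideal_power_Suc_subset[OF assms(1)] assms(2)
  by blast

definition vecs :: "'r::zero set \<Rightarrow> 'i set \<Rightarrow> ('i \<Rightarrow> 'r) set" where
  "vecs A I = {x. \<forall>j. if j \<in> I then x j \<in> A else x j = 0}"

abbreviation free_vecs :: "'i set \<Rightarrow> ('i \<Rightarrow> 'r::zero) set" where
  "free_vecs I \<equiv> vecs UNIV I"

abbreviation basis :: "'r free_complex \<Rightarrow> nat \<Rightarrow> nat set" where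
  "basis F i \<equiv> {..<free_rank F i}"

abbreviation fchain :: "'r::zero free_complex \<Rightarrow> nat \<Rightarrow> (nat \<Rightarrow> 'r) set" where
  "fchain F i \<equiv> free_vecs (basis F i)"

lemma vecs_subspace: "is_ideal A \<Longrightarrow> vec.subspace (vecs A I)"
  by (rule vec.subspaceI) (auto simp: vecs_def ideal_zero ideal_add ideal_mult)

lemma vecs_zero: "is_ideal A \<Longrightarrow> 0 \<in> vecs A I"
  and vecs_add: "is_ideal A \<Longrightarrow> x \<in> vecs A I \<Longrightarrow> y \<in> vecs A I \<Longrightarrow> x + y \<in> vecs A I"
  and vecs_diff: "is_ideal A \<Longrightarrow> x \<in> vecs A I \<Longrightarrow> y \<in> vecs A I \<Longrightarrow> x - y \<in> vecs A I"
  and vecs_neg: "is_ideal A \<Longrightarrow> x \<in> vecs A I \<Longrightarrow> - x \<in> vecs A I"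
  and vecs_scale: "is_ideal A \<Longrightarrow> x \<in> vecs A I \<Longrightarrow> vscale a x \<in> vecs A I"
  and vecs_sum: "is_ideal A \<Longrightarrow> (\<And>l. l \<in> L \<Longrightarrow> f l \<in> vecs A I) \<Longrightarrow> sum f L \<in> vecs A I"
  using vecs_subspace vec.subspace_0 vec.subspace_add vec.subspace_diff vec.subspace_neg
    vec.subspace_scale vec.subspace_sum by metis+

lemma vecs_mono: "A \<subseteq> B \<Longrightarrow> x \<in> vecs A I \<Longrightarrow> x \<in> vecs B I"
  unfolding vecs_def by (auto split: if_splits)

lemma vecs_free: "x \<in> vecs A I \<Longrightarrow> x \<in> free_vecs I"
  by (erule vecs_mono[rotated]) simp

lemma vecs_antimono_power:
  "is_ideal m \<Longrightarrow> i \<le> j \<Longrightarrow> x \<in> vecs (ideal_power m j) I \<Longrightarrow> x \<in> vecs (ideal_power m i) I"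
  using vecs_mono[OF ideal_power_antimono] by blast

definition unit_vec :: "'i \<Rightarrow> 'i \<Rightarrow> 'r::comm_ring_1" where
  "unit_vec l = (\<lambda>j. if j = l then 1 else 0)"

lemma unit_vec_free: "l \<in> I \<Longrightarrow> unit_vec l \<in> free_vecs I"
  by (auto simp: vecs_def unit_vec_def)

lemma vec_expansion:
  assumes "finite I" "x \<in> free_vecs I"
  shows "x = (\<Sum>l\<in>I. vscale (x l) (unit_vec l))"
proof
  fix j
  show "x j = (\<Sum>l\<in>I. vscale (x l) (unit_vec l)) j"
    using assms by (auto simp: sum_fun_apply unit_vec_def vecs_def if_distrib cong: if_cong)
qed

lemma hom_expansion:
  assumes "module_hom vscale s u" "finite I" "x \<in> free_vecs I"
  shows "u x = (\<Sum>l\<in>I. s (x l) (u (unit_vec l)))"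
  by (subst vec_expansion[OF assms(2,3)]) (simp add: hom_sum[OF assms(1)] hom_scale[OF assms(1)])

text \<open>Coordinates of \<open>u x\<close> are combinations of the coordinates of \<open>x\<close> with coefficients taken from
  the images of the basis vectors.\<close>
lemma linear_map_vecs_prod:
  assumes u: "linear_map u" and I: "finite I"
    and into: "\<And>x. x \<in> free_vecs I \<Longrightarrow> u x \<in> vecs B J" and x: "x \<in> vecs A I"
  shows "u x \<in> vecs (ideal_smult (*) A B) J"
proof -
  have "vscale (x l) (u (unit_vec l)) \<in> vecs (ideal_smult (*) A B) J" if "l \<in> I" for l
  proof -
    have "x l \<in> A" using x that by (auto simp: vecs_def split: if_splits)
    then show ?thesis
      using into[OF unit_vec_free[OF that]] by (auto simp: vecs_def ideal_prodI split: if_splits)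
  qed
  then show ?thesis
    unfolding hom_expansion[OF u I vecs_free[OF x]] by (intro vecs_sum) auto
qed

lemma linear_map_vecs:
  assumes "linear_map u" "finite I" "\<And>x. x \<in> free_vecs I \<Longrightarrow> u x \<in> free_vecs J"
    and A: "is_ideal A" and "x \<in> vecs A I"
  shows "u x \<in> vecs A J"
proof -
  have "ideal_smult (*) A UNIV \<subseteq> A"
    by (rule ideal_prod_least) (auto intro: ideal_mult_right A)
  with linear_map_vecs_prod[OF assms(1-3,5)] show ?thesis
    by (rule vecs_mono[rotated])
qed

lemma linear_map_vecs_Suc:
  assumes "linear_map u" "finite I" "\<And>x. x \<in> free_vecs I \<Longrightarrow> u x \<in> vecs m J"
    and "x \<in> vecs (ideal_power m n) I"
  shows "u x \<in> vecs (ideal_power m (Suc n)) J"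
proof -
  have "ideal_smult (*) (ideal_power m n) m \<subseteq> ideal_power m (Suc n)"
    by (rule ideal_prod_least[OF ideal_power_ideal])
      (metis ideal_power_mult mult.commute)
  with linear_map_vecs_prod[OF assms] show ?thesis
    by (rule vecs_mono[rotated])
qed

lemma carrier_free_chain: "carrier (free_chain F i) = fchain F i"
  by (auto simp: tensor_chain_def additive_group_def vecs_def)

lemma ideal_smult_free:
  assumes "is_ideal A" "finite I"
  shows "ideal_smult vec_scale A (free_vecs I) = vecs A I"
proof
  show "ideal_smult vec_scale A (free_vecs I) \<subseteq> vecs A I"
    unfolding ideal_smult_def vec_scale_eq
    by (rule vec.span_minimal[OF _ vecs_subspace[OF assms(1)]])
      (use assms in \<open>auto simp: vecs_def ideal_mult_right\<close>)
  show "vecs A I \<subseteq> ideal_smult vec_scale A (free_vecs I)"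
  proof
    fix x assume x: "x \<in> vecs A I"
    have "vscale (x l) (unit_vec l) \<in> {vscale a v |a v. a \<in> A \<and> v \<in> free_vecs I}" if "l \<in> I" for l
      using x that unit_vec_free[OF that] by (auto simp: vecs_def split: if_splits)
    then have "(\<Sum>l\<in>I. vscale (x l) (unit_vec l)) \<in> ideal_smult vec_scale A (free_vecs I)"
      unfolding ideal_smult_def vec_scale_eq by (intro vec.span_sum vec.span_base)
    then show "x \<in> ideal_smult vec_scale A (free_vecs I)"
      using vec_expansion[OF assms(2) vecs_free[OF x]] by simp
  qed
qed

text \<open>Free modules are projective: a map from one lifts pointwise, hence linearly, through
  another linear map, since it is enough to lift the images of the basis vectors.\<close>
lemma free_lift:
  assumes I: "finite I" and g: "module_hom vscale s g" and d: "module_hom vscale s d"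
    and ex: "\<And>x. x \<in> free_vecs I \<Longrightarrow> \<exists>y\<in>free_vecs J. d y = g x"
  obtains u where "linear_map u" "\<And>x. x \<in> free_vecs I \<Longrightarrow> u x \<in> free_vecs J"
    "\<And>x. x \<in> free_vecs I \<Longrightarrow> d (u x) = g x"
proof -
  have "\<forall>l\<in>I. \<exists>y\<in>free_vecs J. d y = g (unit_vec l)"
    by (intro ballI ex unit_vec_free)
  then obtain y where y: "\<And>l. l \<in> I \<Longrightarrow> y l \<in> free_vecs J"
    and dy: "\<And>l. l \<in> I \<Longrightarrow> d (y l) = g (unit_vec l)"
    unfolding Bex_def bchoice_iff by blast
  define u where "u x = (\<Sum>l\<in>I. vscale (x l) (y l))" for x
  have "linear_map u"
    by (rule module_homI) (auto simp: u_def vec.scale_left_distrib sum.distrib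
        vec.scale_sum_right vec.module_axioms)
  moreover have "u x \<in> free_vecs J" if "x \<in> free_vecs I" for x
    unfolding u_def by (intro vecs_sum vecs_scale y) auto
  moreover have "d (u x) = g x" if "x \<in> free_vecs I" for x
    by (simp add: u_def hom_sum[OF d] hom_scale[OF d] hom_expansion[OF g I that] dy)
  ultimately show thesis by (rule that)
qed

section \<open>Free resolutions and their comparison\<close>

locale resolution =
  fixes s :: "'r::comm_ring_1 \<Rightarrow> 'm::ab_group_add \<Rightarrow> 'm" and I :: "nat \<Rightarrow> 'i set"
    and d :: "nat \<Rightarrow> ('i \<Rightarrow> 'r) \<Rightarrow> 'i \<Rightarrow> 'r" and e :: "('i \<Rightarrow> 'r) \<Rightarrow> 'm"
  assumes fin: "\<And>i. finite (I i)"
    and lin: "\<And>i. linear_map (d i)"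
    and maps: "\<And>i x. x \<in> free_vecs (I (Suc i)) \<Longrightarrow> d i x \<in> free_vecs (I i)"
    and dd: "\<And>i x. x \<in> free_vecs (I (Suc (Suc i))) \<Longrightarrow> d i (d (Suc i) x) = 0"
    and exact: "\<And>i x. x \<in> free_vecs (I (Suc i)) \<Longrightarrow> d i x = 0 \<Longrightarrow>
      \<exists>y\<in>free_vecs (I (Suc (Suc i))). d (Suc i) y = x"
    and aug: "module_hom vscale s e"
    and aug_d: "\<And>x. x \<in> free_vecs (I (Suc 0)) \<Longrightarrow> e (d 0 x) = 0"
    and aug_exact: "\<And>x. x \<in> free_vecs (I 0) \<Longrightarrow> e x = 0 \<Longrightarrow> \<exists>y\<in>free_vecs (I (Suc 0)). d 0 y = x"
    and aug_onto: "\<And>q. \<exists>x\<in>free_vecs (I 0). e x = q"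

lemma hom_compose:
  "module_hom s t f \<Longrightarrow> module_hom t r g \<Longrightarrow> module_hom s r (\<lambda>x. g (f x))"
  using module_hom_compose[of s t f r g] by (simp add: comp_def)

text \<open>The comparison theorem. The invariant \<open>good\<close> of the recursive choice contains, besides
  linearity, what the next lift requires: the images of boundaries are boundaries.\<close>
lemma comparison_map:
  assumes "resolution s I d e" and "resolution s' I' d' e'" and f: "module_hom s s' f"
  obtains u where "\<And>i. linear_map (u i)"
    "\<And>i x. x \<in> free_vecs (I i) \<Longrightarrow> u i x \<in> free_vecs (I' i)"
    "\<And>x. x \<in> free_vecs (I 0) \<Longrightarrow> e' (u 0 x) = f (e x)"
    "\<And>i x. x \<in> free_vecs (I (Suc i)) \<Longrightarrow> d' i (u (Suc i) x) = u i (d i x)"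
proof -
  interpret A: resolution s I d e by fact
  interpret B: resolution s' I' d' e' by fact
  define good where "good i v \<longleftrightarrow> linear_map v \<and> (\<forall>x\<in>free_vecs (I i). v x \<in> free_vecs (I' i)) \<and>
    (\<forall>x\<in>free_vecs (I (Suc i)). \<exists>y\<in>free_vecs (I' (Suc i)). d' i y = v (d i x)) \<and>
    (i = 0 \<longrightarrow> (\<forall>x\<in>free_vecs (I 0). e' (v x) = f (e x)))" for i v
  define step where "step i v w \<longleftrightarrow> (\<forall>x\<in>free_vecs (I (Suc i)). d' i (w x) = v (d i x))" for i v w
  have "\<exists>v. good 0 v"
  proof -
    obtain v where v: "linear_map v" "\<And>x. x \<in> free_vecs (I 0) \<Longrightarrow> v x \<in> free_vecs (I' 0)"
      "\<And>x. x \<in> free_vecs (I 0) \<Longrightarrow> e' (v x) = f (e x)"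
      using free_lift[OF A.fin hom_compose[OF A.aug f] B.aug B.aug_onto] by blast
    have "\<exists>y\<in>free_vecs (I' (Suc 0)). d' 0 y = v (d 0 x)" if "x \<in> free_vecs (I (Suc 0))" for x
      using that by (intro B.aug_exact) (simp_all add: v A.maps A.aug_d hom_zero[OF f])
    with v show ?thesis unfolding good_def by blast
  qed
  moreover have "\<exists>w. good (Suc i) w \<and> step i v w" if v: "good i v" for i v
  proof -
    have lv: "linear_map v" and ex: "\<And>x. x \<in> free_vecs (I (Suc i)) \<Longrightarrow>
      \<exists>y\<in>free_vecs (I' (Suc i)). d' i y = v (d i x)"
      using v by (auto simp: good_def)
    obtain w where w: "linear_map w"
      "\<And>x. x \<in> free_vecs (I (Suc i)) \<Longrightarrow> w x \<in> free_vecs (I' (Suc i))"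
      "\<And>x. x \<in> free_vecs (I (Suc i)) \<Longrightarrow> d' i (w x) = v (d i x)"
      using free_lift[OF A.fin hom_compose[OF A.lin lv] B.lin ex] by blast
    have "\<exists>y\<in>free_vecs (I' (Suc (Suc i))). d' (Suc i) y = w (d (Suc i) x)"
      if "x \<in> free_vecs (I (Suc (Suc i)))" for x
      using that by (intro B.exact) (simp_all add: w A.maps A.dd hom_zero[OF lv])
    with w show ?thesis unfolding good_def step_def by blast
  qed
  ultimately obtain u where u: "\<And>i. good i (u i)" "\<And>i. step i (u i) (u (Suc i))"
    using dependent_nat_choice[of good step] by blast
  show thesis
    by (rule that[of u]) (use u in \<open>auto simp: good_def step_def\<close>)
qed

text \<open>A chain map inducing zero on the resolved module is homotopic to zero. Each \<open>h (Suc i)\<close> lifts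
  \<open>w (Suc i) - h i \<circ> d i\<close>, which takes values in the cycles by the choice of \<open>h i\<close>.\<close>
lemma null_homotopy:
  assumes "resolution s I d e"
    and w: "\<And>i. linear_map (w i)" "\<And>i x. x \<in> free_vecs (I i) \<Longrightarrow> w i x \<in> free_vecs (I i)"
      "\<And>x. x \<in> free_vecs (I 0) \<Longrightarrow> e (w 0 x) = 0"
      "\<And>i x. x \<in> free_vecs (I (Suc i)) \<Longrightarrow> d i (w (Suc i) x) = w i (d i x)"
  obtains h where "\<And>i. linear_map (h i)"
    "\<And>i x. x \<in> free_vecs (I i) \<Longrightarrow> h i x \<in> free_vecs (I (Suc i))"
    "\<And>i x. x \<in> free_vecs (I (Suc i)) \<Longrightarrow> w (Suc i) x = d (Suc i) (h (Suc i) x) + h i (d i x)"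
proof -
  interpret resolution s I d e by fact
  define good where "good i h \<longleftrightarrow> linear_map h \<and>
    (\<forall>x\<in>free_vecs (I i). h x \<in> free_vecs (I (Suc i))) \<and>
    (\<forall>x\<in>free_vecs (I (Suc i)). d i (h (d i x)) = w i (d i x))" for i h
  define step where "step i h h' \<longleftrightarrow>
    (\<forall>x\<in>free_vecs (I (Suc i)). d (Suc i) (h' x) = w (Suc i) x - h (d i x))" for i h h'
  have "\<exists>h. good 0 h"
  proof -
    obtain h where "linear_map h" "\<And>x. x \<in> free_vecs (I 0) \<Longrightarrow> h x \<in> free_vecs (I (Suc 0))"
      "\<And>x. x \<in> free_vecs (I 0) \<Longrightarrow> d 0 (h x) = w 0 x"
      using free_lift[OF fin w(1) lin aug_exact[OF w(2,3)]] by blast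
    then show ?thesis unfolding good_def using maps by blast
  qed
  moreover have "\<exists>h'. good (Suc i) h' \<and> step i h h'" if h: "good i h" for i h
  proof -
    have lh: "linear_map h" and mh: "\<And>x. x \<in> free_vecs (I i) \<Longrightarrow> h x \<in> free_vecs (I (Suc i))"
      and hd: "\<And>x. x \<in> free_vecs (I (Suc i)) \<Longrightarrow> d i (h (d i x)) = w i (d i x)"
      using h by (auto simp: good_def)
    have "linear_map (\<lambda>x. w (Suc i) x - h (d i x))"
      by (intro module_pair.module_hom_sub w hom_compose[OF lin lh])
        (simp add: module_pair_def vec.module_axioms)
    moreover have "\<exists>y\<in>free_vecs (I (Suc (Suc i))). d (Suc i) y = w (Suc i) x - h (d i x)"
      if "x \<in> free_vecs (I (Suc i))" for x
      using that by (intro exact) (simp_all add: vecs_diff w maps mh hom_diff[OF lin] hd)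
    ultimately obtain h' where h': "linear_map h'"
      "\<And>x. x \<in> free_vecs (I (Suc i)) \<Longrightarrow> h' x \<in> free_vecs (I (Suc (Suc i)))"
      "\<And>x. x \<in> free_vecs (I (Suc i)) \<Longrightarrow> d (Suc i) (h' x) = w (Suc i) x - h (d i x)"
      using free_lift[OF fin _ lin, of "\<lambda>x. w (Suc i) x - h (d i x)" "Suc i" "I (Suc (Suc i))" "Suc i"]
      by blast
    have "d (Suc i) (h' (d (Suc i) x)) = w (Suc i) (d (Suc i) x)"
      if "x \<in> free_vecs (I (Suc (Suc i)))" for x
      using that by (simp add: h' maps dd hom_zero[OF lh])
    with h' show ?thesis unfolding good_def step_def by blast
  qed
  ultimately obtain h where h: "\<And>i. good i (h i)" "\<And>i. step i (h i) (h (Suc i))"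
    using dependent_nat_choice[of good step] by blast
  show thesis
    by (rule that[of h]) (use h in \<open>auto simp: good_def step_def\<close>)
qed

text \<open>For a free resolution of \<open>M\<close> this says that \<open>Tor\<^sub>j\<^sub>+\<^sub>1(R/m\<^sup>n\<^sup>+\<^sup>1, M) \<rightarrow> Tor\<^sub>j\<^sub>+\<^sub>1(R/m\<^sup>n, M)\<close>
  is zero for every \<open>n\<close>.\<close>
definition tor_shift_zero ::
    "'r::comm_ring_1 set \<Rightarrow> (nat \<Rightarrow> 'i set) \<Rightarrow> (nat \<Rightarrow> ('i \<Rightarrow> 'r) \<Rightarrow> 'i \<Rightarrow> 'r) \<Rightarrow> nat \<Rightarrow> bool" where
  "tor_shift_zero m I d j \<longleftrightarrow> (\<forall>n. \<forall>x\<in>free_vecs (I (Suc j)).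
     d j x \<in> vecs (ideal_power m (Suc n)) (I j) \<longrightarrow>
     (\<exists>y\<in>free_vecs (I (Suc (Suc j))). x - d (Suc j) y \<in> vecs (ideal_power m n) (I (Suc j))))"

lemma tor_shift_zeroD:
  assumes "tor_shift_zero m I d j" "x \<in> free_vecs (I (Suc j))"
    "d j x \<in> vecs (ideal_power m (Suc n)) (I j)"
  obtains y where "y \<in> free_vecs (I (Suc (Suc j)))"
    "x - d (Suc j) y \<in> vecs (ideal_power m n) (I (Suc j))"
  using assms unfolding tor_shift_zero_def by blast

text \<open>The condition is one on the module alone: comparison maps between two resolutions carry it
  over, because their composite differs from the identity by \<open>d h + h d\<close>, and \<open>h\<close> maps multiples
  of \<open>m\<^sup>n\<^sup>+\<^sup>1\<close> to such multiples.\<close>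
lemma tor_shift_zero_independent:
  fixes d :: "nat \<Rightarrow> ('i \<Rightarrow> 'r::comm_ring_1) \<Rightarrow> 'i \<Rightarrow> 'r"
  assumes "resolution s I d e" and "resolution s I' d' e'" and "is_ideal m"
    and shift: "tor_shift_zero m I' d' j"
  shows "tor_shift_zero m I d j"
  unfolding tor_shift_zero_def
proof (intro allI ballI impI)
  fix n x assume x: "x \<in> free_vecs (I (Suc j))"
    and dx: "d j x \<in> vecs (ideal_power m (Suc n)) (I j)"
  interpret A: resolution s I d e by fact
  interpret B: resolution s I' d' e' by fact
  have id: "module_hom s s (\<lambda>x. x)"
    using module.module_hom_ident A.aug by (auto simp: module_hom_iff)
  obtain u where u: "\<And>i. linear_map (u i)"
    "\<And>i x. x \<in> free_vecs (I i) \<Longrightarrow> u i x \<in> free_vecs (I' i)"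
    "\<And>x. x \<in> free_vecs (I 0) \<Longrightarrow> e' (u 0 x) = e x"
    "\<And>i x. x \<in> free_vecs (I (Suc i)) \<Longrightarrow> d' i (u (Suc i) x) = u i (d i x)"
    using comparison_map[OF assms(1,2) id] by blast
  obtain v where v: "\<And>i. linear_map (v i)"
    "\<And>i x. x \<in> free_vecs (I' i) \<Longrightarrow> v i x \<in> free_vecs (I i)"
    "\<And>x. x \<in> free_vecs (I' 0) \<Longrightarrow> e (v 0 x) = e' x"
    "\<And>i x. x \<in> free_vecs (I' (Suc i)) \<Longrightarrow> d i (v (Suc i) x) = v i (d' i x)"
    using comparison_map[OF assms(2,1) id] by blast
  define w where "w i x = x - v i (u i x)" for i x
  have lw: "linear_map (w i)" for i
    unfolding w_def
    by (intro module_pair.module_hom_sub hom_compose[OF u(1) v(1)] vec.module_hom_ident)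
      (simp add: module_pair_def vec.module_axioms)
  have w: "w i x \<in> free_vecs (I i)" if "x \<in> free_vecs (I i)" for i x
    unfolding w_def by (intro vecs_diff ideal_UNIV that v u)
  have ew: "e (w 0 x) = 0" if "x \<in> free_vecs (I 0)" for x
    using that by (simp add: w_def u v hom_diff[OF A.aug])
  have dw: "d i (w (Suc i) x) = w i (d i x)" if "x \<in> free_vecs (I (Suc i))" for i x
    using that by (simp add: w_def u v hom_diff[OF A.lin])
  obtain h where h: "\<And>i. linear_map (h i)"
    "\<And>i x. x \<in> free_vecs (I i) \<Longrightarrow> h i x \<in> free_vecs (I (Suc i))"
    "\<And>i x. x \<in> free_vecs (I (Suc i)) \<Longrightarrow> w (Suc i) x = d (Suc i) (h (Suc i) x) + h i (d i x)"
    using null_homotopy[OF assms(1) lw w ew dw] by blast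
  have "d' j (u (Suc j) x) \<in> vecs (ideal_power m (Suc n)) (I' j)"
    by (simp only: u(4)[OF x])
      (rule linear_map_vecs[OF u(1) A.fin u(2) ideal_power_ideal dx])
  with shift obtain y where y: "y \<in> free_vecs (I' (Suc (Suc j)))"
    and xy: "u (Suc j) x - d' (Suc j) y \<in> vecs (ideal_power m n) (I' (Suc j))"
    using u(2)[OF x] unfolding tor_shift_zero_def by blast
  let ?y = "v (Suc (Suc j)) y + h (Suc j) x"
  have "?y \<in> free_vecs (I (Suc (Suc j)))"
    by (intro vecs_add ideal_UNIV v y h x)
  moreover have "x - d (Suc j) ?y = v (Suc j) (u (Suc j) x - d' (Suc j) y) + h j (d j x)"
    using h(3)[OF x] by (simp add: w_def hom_add[OF A.lin] v(4)[OF y] hom_diff[OF v(1)] algebra_simps)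
  moreover have "v (Suc j) (u (Suc j) x - d' (Suc j) y) \<in> vecs (ideal_power m n) (I (Suc j))"
    by (rule linear_map_vecs[OF v(1) B.fin v(2) ideal_power_ideal xy])
  moreover have "h j (d j x) \<in> vecs (ideal_power m n) (I (Suc j))"
    by (rule vecs_antimono_power[OF \<open>is_ideal m\<close>, of n "Suc n"],
        simp, rule linear_map_vecs[OF h(1) A.fin h(2) ideal_power_ideal dx])
  ultimately show "\<exists>y\<in>free_vecs (I (Suc (Suc j))). x - d (Suc j) y \<in> vecs (ideal_power m n) (I (Suc j))"
    by (metis vecs_add ideal_power_ideal)
qed

section \<open>Injectivity and surjectivity modulo the maximal ideal\<close>

lemma vecs_scale_power:
  assumes "a \<in> ideal_power m n" "x \<in> vecs m I"
  shows "vscale a x \<in> vecs (ideal_power m (Suc n)) I"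
proof -
  have "a * b \<in> ideal_power m (Suc n)" if "b \<in> m" for b
    using ideal_power_mult[OF that assms(1)] by (simp only: mult.commute)
  with assms(2) show ?thesis by (auto simp: vecs_def)
qed

lemma vecs_scale_ideal: "is_ideal A \<Longrightarrow> a \<in> A \<Longrightarrow> x \<in> free_vecs I \<Longrightarrow> vscale a x \<in> vecs A I"
  by (auto simp: vecs_def ideal_mult_right)

text \<open>A map \<open>u\<close> that is injective modulo \<open>m\<close> stays injective after tensoring with
  \<open>m\<^sup>n/m\<^sup>n\<^sup>+\<^sup>1\<close>, a vector space over \<open>R/m\<close>. An element of the kernel is a sum of terms
  \<open>\<mu>\<^sub>t a\<^sub>t\<close>; if some \<open>u a\<^sub>t\<close> has an entry that is a unit modulo \<open>m\<close>, then that entry of the image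
  expresses \<open>\<mu>\<^sub>t\<close> through the other coefficients, and the sum gets shorter.\<close>
lemma injective_mod_sum:
  assumes u: "linear_map u" and maps: "\<And>x. x \<in> free_vecs I \<Longrightarrow> u x \<in> free_vecs J"
    and m: "is_ideal m" and unit: "\<And>c. c \<notin> m \<Longrightarrow> \<exists>v. v * c - 1 \<in> m"
    and inj: "\<And>x. x \<in> free_vecs I \<Longrightarrow> u x \<in> vecs m J \<Longrightarrow> x \<in> vecs m I"
    and "finite T" "\<And>t. t \<in> T \<Longrightarrow> \<mu> t \<in> ideal_power m n" "\<And>t. t \<in> T \<Longrightarrow> a t \<in> free_vecs I"
    and "u (\<Sum>t\<in>T. vscale (\<mu> t) (a t)) \<in> vecs (ideal_power m (Suc n)) J"
  shows "(\<Sum>t\<in>T. vscale (\<mu> t) (a t)) \<in> vecs (ideal_power m (Suc n)) I"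
  using assms(6-)
proof (induction "card T" arbitrary: T a)
  case 0
  then have "T = {}" by simp
  then show ?case by (intro vecs_sum ideal_power_ideal) simp
next
  case (Suc k)
  show ?case
  proof (cases "\<forall>t\<in>T. u (a t) \<in> vecs m J")
    case True
    then show ?thesis
      using Suc.prems inj by (intro vecs_sum vecs_scale_power ideal_power_ideal) auto
  next
    case False
    then obtain t0 where t0: "t0 \<in> T" "u (a t0) \<notin> vecs m J" by blast
    with maps[OF Suc.prems(3)[OF t0(1)]] obtain j where j: "j \<in> J" "u (a t0) j \<notin> m"
      by (auto simp: vecs_def split: if_splits)
    then obtain v where v: "v * u (a t0) j - 1 \<in> m" using unit by blast
    let ?T = "T - {t0}"
    define a' where "a' t = a t - vscale (v * u (a t) j) (a t0)" for t
    let ?x = "\<Sum>t\<in>T. vscale (\<mu> t) (a t)" and ?x' = "\<Sum>t\<in>?T. vscale (\<mu> t) (a' t)"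
    define \<kappa> where "\<kappa> = \<mu> t0 + (\<Sum>t\<in>?T. \<mu> t * (v * u (a t) j))"
    \<comment> \<open>\<open>\<kappa>\<close> is the coefficient of \<open>a t0\<close> after all other \<open>a t\<close> have been replaced by \<open>a' t\<close>, whose
      image has its entry at \<open>j\<close> in \<open>m\<close>.\<close>
    have split: "?x = ?x' + vscale \<kappa> (a t0)"
      by (simp add: sum.remove[OF Suc.prems(1) t0(1)] a'_def \<kappa>_def vec.scale_right_diff_distrib
          sum_subtractf vec.scale_left_distrib vec.scale_sum_left)
    have "u ?x j = \<mu> t0 * u (a t0) j + (\<Sum>t\<in>?T. \<mu> t * u (a t) j)"
      by (simp add: sum.remove[OF Suc.prems(1) t0(1)] hom_add[OF u] hom_sum[OF u] hom_scale[OF u]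
          sum_fun_apply)
    then have "v * u ?x j = v * u (a t0) j * \<mu> t0 + (\<Sum>t\<in>?T. \<mu> t * (v * u (a t) j))"
      by (simp add: distrib_left sum_distrib_left algebra_simps)
    then have "\<kappa> = v * u ?x j - (v * u (a t0) j - 1) * \<mu> t0"
      by (simp add: \<kappa>_def algebra_simps)
    moreover have "u ?x j \<in> ideal_power m (Suc n)"
      using Suc.prems(4) j(1) unfolding vecs_def by (auto split: if_splits)
    moreover have "(v * u (a t0) j - 1) * \<mu> t0 \<in> ideal_power m (Suc n)"
      by (rule ideal_power_mult[OF v Suc.prems(2)[OF t0(1)]])
    ultimately have \<kappa>: "\<kappa> \<in> ideal_power m (Suc n)"
      by (metis ideal_diff ideal_mult ideal_power_ideal)
    have a': "a' t \<in> free_vecs I" if "t \<in> T" for t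
      unfolding a'_def by (intro vecs_diff vecs_scale ideal_UNIV Suc.prems(3) that t0(1))
    have \<kappa>a: "vscale \<kappa> (a t0) \<in> vecs (ideal_power m (Suc n)) I"
      by (intro vecs_scale_ideal ideal_power_ideal \<kappa> Suc.prems(3) t0(1))
    have "u ?x' = u ?x - vscale \<kappa> (u (a t0))"
      by (simp add: split hom_add[OF u] hom_scale[OF u])
    moreover have "vscale \<kappa> (u (a t0)) \<in> vecs (ideal_power m (Suc n)) J"
      by (intro vecs_scale_ideal ideal_power_ideal \<kappa> maps Suc.prems(3) t0(1))
    ultimately have "u ?x' \<in> vecs (ideal_power m (Suc n)) J"
      using Suc.prems(4) by (simp only: vecs_diff ideal_power_ideal)
    then have "?x' \<in> vecs (ideal_power m (Suc n)) I"
      using Suc.hyps(2) Suc.prems t0(1) a' by (intro Suc.hyps(1)) auto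
    with \<kappa>a show ?thesis
      unfolding split by (intro vecs_add ideal_power_ideal)
  qed
qed

lemma injective_mod_power:
  assumes "linear_map u" "finite I" "\<And>x. x \<in> free_vecs I \<Longrightarrow> u x \<in> free_vecs J"
    and "is_ideal m" "\<And>c. c \<notin> m \<Longrightarrow> \<exists>v. v * c - 1 \<in> m"
    and "\<And>x. x \<in> free_vecs I \<Longrightarrow> u x \<in> vecs m J \<Longrightarrow> x \<in> vecs m I"
    and x: "x \<in> vecs (ideal_power m n) I" and ux: "u x \<in> vecs (ideal_power m (Suc n)) J"
  shows "x \<in> vecs (ideal_power m (Suc n)) I"
proof -
  note ex = vec_expansion[OF assms(2) vecs_free[OF x]]
  have "(\<Sum>l\<in>I. vscale (x l) (unit_vec l)) \<in> vecs (ideal_power m (Suc n)) I"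
    by (rule injective_mod_sum[OF assms(1,3-6,2)])
      (use x ux ex in \<open>auto simp: vecs_def unit_vec_def simp del: ideal_power.simps split: if_splits\<close>)
  then show ?thesis using ex by simp
qed

lemma surjective_mod_power:
  assumes u: "linear_map u" and "finite J" and m: "is_ideal m"
    and sur: "\<And>y. y \<in> free_vecs J \<Longrightarrow> \<exists>x\<in>free_vecs I. y - u x \<in> vecs m J"
    and y: "y \<in> vecs (ideal_power m n) J"
  obtains x where "x \<in> vecs (ideal_power m n) I" "y - u x \<in> vecs (ideal_power m (Suc n)) J"
proof -
  have "\<forall>l\<in>J. \<exists>x\<in>free_vecs I. unit_vec l - u x \<in> vecs m J"
    by (intro ballI sur unit_vec_free)
  then obtain b where b: "\<And>l. l \<in> J \<Longrightarrow> b l \<in> free_vecs I"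
    "\<And>l. l \<in> J \<Longrightarrow> unit_vec l - u (b l) \<in> vecs m J"
    unfolding Bex_def bchoice_iff by blast
  have yl: "y l \<in> ideal_power m n" if "l \<in> J" for l
    using y that by (auto simp: vecs_def split: if_splits)
  let ?x = "\<Sum>l\<in>J. vscale (y l) (b l)"
  have "y - u ?x = (\<Sum>l\<in>J. vscale (y l) (unit_vec l)) - u ?x"
    using vec_expansion[OF assms(2) vecs_free[OF y]] by simp
  also have "\<dots> = (\<Sum>l\<in>J. vscale (y l) (unit_vec l - u (b l)))"
    by (simp add: hom_sum[OF u] hom_scale[OF u] vec.scale_right_diff_distrib sum_subtractf)
  finally have eq: "y - u ?x = (\<Sum>l\<in>J. vscale (y l) (unit_vec l - u (b l)))" .
  show thesis
  proof (rule that)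
    show "?x \<in> vecs (ideal_power m n) I"
      by (intro vecs_sum vecs_scale_ideal ideal_power_ideal yl b)
    show "y - u ?x \<in> vecs (ideal_power m (Suc n)) J"
      unfolding eq by (intro vecs_sum vecs_scale_power ideal_power_ideal yl b)
  qed
qed

section \<open>The mapping cone\<close>

locale chain_map_of_minimal =
  A: resolution sM I dA eA + B: resolution sP J dB eB
  for sM :: "'r::comm_ring_1 \<Rightarrow> 'm::ab_group_add \<Rightarrow> 'm" and I :: "nat \<Rightarrow> 'i set" and dA eA
    and sP :: "'r \<Rightarrow> 'p::ab_group_add \<Rightarrow> 'p" and J :: "nat \<Rightarrow> 'j set" and dB eB +
  fixes m :: "'r set" and u :: "nat \<Rightarrow> ('i \<Rightarrow> 'r) \<Rightarrow> 'j \<Rightarrow> 'r"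
  assumes m: "is_ideal m"
    and minA: "\<And>i x. x \<in> free_vecs (I (Suc i)) \<Longrightarrow> dA i x \<in> vecs m (I i)"
    and minB: "\<And>i x. x \<in> free_vecs (J (Suc i)) \<Longrightarrow> dB i x \<in> vecs m (J i)"
    and u_lin: "\<And>i. linear_map (u i)"
    and u_maps: "\<And>i x. x \<in> free_vecs (I i) \<Longrightarrow> u i x \<in> free_vecs (J i)"
    and u_chain: "\<And>i x. x \<in> free_vecs (I (Suc i)) \<Longrightarrow> dB i (u (Suc i) x) = u i (dA i x)"
begin

abbreviation mpow :: "nat \<Rightarrow> 'k set \<Rightarrow> ('k \<Rightarrow> 'r) set" where
  "mpow n K \<equiv> vecs (ideal_power m n) K"

lemma dA_pow: "x \<in> mpow n (I (Suc i)) \<Longrightarrow> dA i x \<in> mpow (Suc n) (I i)"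
  by (rule linear_map_vecs_Suc[OF A.lin A.fin minA])

lemma dB_pow: "x \<in> mpow n (J (Suc i)) \<Longrightarrow> dB i x \<in> mpow (Suc n) (J i)"
  by (rule linear_map_vecs_Suc[OF B.lin B.fin minB])

lemma u_pow: "x \<in> mpow n (I i) \<Longrightarrow> u i x \<in> mpow n (J i)"
  by (rule linear_map_vecs[OF u_lin A.fin u_maps ideal_power_ideal])

lemma pow_Suc: "x \<in> mpow (Suc n) K \<Longrightarrow> x \<in> mpow n K"
  by (rule vecs_antimono_power[OF m, of n "Suc n"]) auto

lemma pow_add: "x \<in> mpow n K \<Longrightarrow> y \<in> mpow n K \<Longrightarrow> x + y \<in> mpow n K"
  and pow_diff: "x \<in> mpow n K \<Longrightarrow> y \<in> mpow n K \<Longrightarrow> x - y \<in> mpow n K"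
  and pow_neg: "x \<in> mpow n K \<Longrightarrow> - x \<in> mpow n K"
  by (simp_all add: vecs_add vecs_diff vecs_neg del: ideal_power.simps)

lemma free_add: "x \<in> free_vecs K \<Longrightarrow> y \<in> free_vecs K \<Longrightarrow> x + y \<in> free_vecs K"
  and free_diff': "x \<in> free_vecs K \<Longrightarrow> y \<in> free_vecs K \<Longrightarrow> x - y \<in> free_vecs K"
  and free_neg: "x \<in> free_vecs K \<Longrightarrow> - x \<in> free_vecs K"
  for x :: "'k \<Rightarrow> 'r"
  by (simp_all add: vecs_add vecs_diff vecs_neg)

text \<open>The term of degree \<open>i\<close> of the cone is the term of degree \<open>i\<close> of the target plus the term of
  degree \<open>i - 1\<close> of the source, so the second summand is missing for \<open>i = 0\<close>.\<close>
definition cone_basis :: "nat \<Rightarrow> ('j + 'i) set" where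
  "cone_basis i = (case i of 0 \<Rightarrow> Inl ` J 0 | Suc k \<Rightarrow> J (Suc k) <+> I k)"

definition cone_diff :: "nat \<Rightarrow> ('j + 'i \<Rightarrow> 'r) \<Rightarrow> 'j + 'i \<Rightarrow> 'r" where
  "cone_diff i x = case_sum (dB i (x \<circ> Inl) + u i (x \<circ> Inr))
     (case i of 0 \<Rightarrow> 0 | Suc k \<Rightarrow> - dA k (x \<circ> Inr))"

lemma cone_vecs_0: "x \<in> vecs A (cone_basis 0) \<longleftrightarrow> x \<circ> Inl \<in> vecs A (J 0) \<and> x \<circ> Inr = 0"
  by (auto simp: cone_basis_def vecs_def fun_eq_iff split_sum_all)

lemma cone_vecs_Suc:
  "x \<in> vecs A (cone_basis (Suc k)) \<longleftrightarrow> x \<circ> Inl \<in> vecs A (J (Suc k)) \<and> x \<circ> Inr \<in> vecs A (I k)"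
  by (auto simp: cone_basis_def vecs_def split_sum_all)

lemma sum_eq_iff: "x = y \<longleftrightarrow> x \<circ> Inl = y \<circ> Inl \<and> x \<circ> Inr = (y \<circ> Inr :: 'i \<Rightarrow> 'r)"
  by (auto simp: fun_eq_iff split_sum_all)

lemma comp_algebra [simp]:
  "(x + y) \<circ> f = (x \<circ> f) + (y \<circ> f)" "(x - y) \<circ> f = (x \<circ> f) - (y \<circ> f)" "(- x) \<circ> f = - (x \<circ> f)"
  "(0 :: 'b \<Rightarrow> 'c::ab_group_add) \<circ> f = 0" for x y :: "'b \<Rightarrow> 'c::ab_group_add"
  by auto

lemma comp_vscale [simp]: "vscale a x \<circ> f = vscale a (x \<circ> f)"
  by (auto simp: fun_eq_iff)

lemma case_sum_comp [simp]: "case_sum f g \<circ> Inl = f" "case_sum f g \<circ> Inr = g"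
  by auto

lemma cone_diff_linear: "linear_map (cone_diff i)"
  by (rule module_homI)
    (auto simp: sum_eq_iff cone_diff_def vec.module_axioms hom_add[OF A.lin] hom_add[OF B.lin]
      hom_add[OF u_lin] hom_scale[OF A.lin] hom_scale[OF B.lin] hom_scale[OF u_lin]
      vec.scale_right_distrib split: nat.split)

end

text \<open>In positive degrees exactness follows from that of the two resolutions. In degree one it also
  uses that \<open>\<phi>\<close> is injective: for a cycle \<open>(b, a)\<close> the element \<open>\<phi> (eA a) = - eB (dB 0 b)\<close> is zero.\<close>
lemma cone_resolution:
  assumes "chain_map_of_minimal sM I dA eA sP J dB eB m u"
    and se: "short_exact sM sP sN \<phi> lam"
    and u_aug: "\<And>x. x \<in> free_vecs (I 0) \<Longrightarrow> eB (u 0 x) = \<phi> (eA x)"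
  shows "resolution sN (chain_map_of_minimal.cone_basis I J)
    (chain_map_of_minimal.cone_diff dA dB u) (\<lambda>x. lam (eB (x \<circ> Inl)))"
proof -
  interpret chain_map_of_minimal sM I dA eA sP J dB eB m u by fact
  have \<phi>: "module_hom sM sP \<phi>" and lam: "module_hom sP sN lam" and inj: "inj \<phi>"
    and range: "range \<phi> = {x. lam x = 0}" and sur: "surj lam"
    using se by (auto simp: short_exact_def)
  have lam\<phi>: "lam (\<phi> x) = 0" for x using range by auto
  have \<phi>0: "\<phi> x = 0 \<Longrightarrow> x = 0" for x
    using inj hom_zero[OF \<phi>] by (metis injD)
  show ?thesis
  proof (rule resolution.intro)
    show "finite (cone_basis i)" for i
      by (cases i) (auto simp: cone_basis_def A.fin B.fin)
    show "linear_map (cone_diff i)" for i by (rule cone_diff_linear)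
    show "cone_diff i x \<in> free_vecs (cone_basis i)" if "x \<in> free_vecs (cone_basis (Suc i))" for i x
      using that
      by (cases i) (auto simp: cone_vecs_0 cone_vecs_Suc cone_diff_def
          intro!: free_add free_neg A.maps B.maps u_maps)
    show "cone_diff i (cone_diff (Suc i) x) = 0" if "x \<in> free_vecs (cone_basis (Suc (Suc i)))" for i x
      using that
      by (cases i) (auto simp: cone_vecs_Suc cone_diff_def sum_eq_iff hom_add[OF B.lin] hom_neg[OF A.lin]
          hom_neg[OF u_lin] u_chain A.dd B.dd)
    show "\<exists>y\<in>free_vecs (cone_basis (Suc (Suc i))). cone_diff (Suc i) y = x"
      if x: "x \<in> free_vecs (cone_basis (Suc i))" and dx: "cone_diff i x = 0" for i x
    proof -
      define b where "b = x \<circ> Inl"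
      define a where "a = x \<circ> Inr"
      have b: "b \<in> free_vecs (J (Suc i))" and a: "a \<in> free_vecs (I i)"
        using x by (auto simp: cone_vecs_Suc a_def b_def)
      have db: "dB i b + u i a = 0" and da: "\<And>k. i = Suc k \<Longrightarrow> dA k a = 0"
        using dx by (auto simp: cone_diff_def sum_eq_iff a_def b_def)
      have "\<exists>a'\<in>free_vecs (I (Suc i)). dA i a' = a"
      proof (cases i)
        case 0
        have "\<phi> (eA a) = eB (u 0 a)" using u_aug a 0 by simp
        also have "\<dots> = eB (dB 0 b + u 0 a)" using B.aug_d b 0 by (simp add: hom_add[OF B.aug])
        also have "\<dots> = 0" using db 0 by (simp add: hom_zero[OF B.aug])
        finally show ?thesis using A.aug_exact a 0 \<phi>0 by blast
      next
        case (Suc k)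
        then show ?thesis using A.exact a da by blast
      qed
      then obtain a' where a': "a' \<in> free_vecs (I (Suc i))" "dA i a' = a" by blast
      have "dB i (b + u (Suc i) a') = 0"
        using db a' by (simp add: hom_add[OF B.lin] u_chain)
      then obtain b' where b': "b' \<in> free_vecs (J (Suc (Suc i)))" "dB (Suc i) b' = b + u (Suc i) a'"
        using B.exact b a'(1) u_maps free_add by meson
      show ?thesis
      proof
        show "case_sum b' (- a') \<in> free_vecs (cone_basis (Suc (Suc i)))"
          using a' b' by (simp add: cone_vecs_Suc free_neg)
        show "cone_diff (Suc i) (case_sum b' (- a')) = x"
          using a' b' by (simp add: cone_diff_def sum_eq_iff hom_neg[OF u_lin] hom_neg[OF A.lin]
              flip: a_def b_def)
      qed
    qed
    show "module_hom vscale sN (\<lambda>x. lam (eB (x \<circ> Inl)))"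
      using lam B.aug by (auto simp: module_hom_iff vec.module_axioms)
    show "lam (eB (cone_diff 0 x \<circ> Inl)) = 0" if "x \<in> free_vecs (cone_basis (Suc 0))" for x
      using that by (simp add: cone_vecs_Suc cone_diff_def hom_add[OF B.aug] B.aug_d u_aug lam\<phi>)
    show "\<exists>y\<in>free_vecs (cone_basis (Suc 0)). cone_diff 0 y = x"
      if x: "x \<in> free_vecs (cone_basis 0)" and lx: "lam (eB (x \<circ> Inl)) = 0" for x
    proof -
      define b where "b = x \<circ> Inl"
      have b: "b \<in> free_vecs (J 0)" and x0: "x \<circ> Inr = 0"
        using x by (auto simp: cone_vecs_0 b_def)
      obtain q where q: "eB b = \<phi> q" using lx range by (auto simp: b_def)
      obtain a where a: "a \<in> free_vecs (I 0)" "eA a = q" using A.aug_onto by blast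
      have "eB (b - u 0 a) = 0" using a q by (simp add: hom_diff[OF B.aug] u_aug)
      then obtain b' where b': "b' \<in> free_vecs (J (Suc 0))" "dB 0 b' = b - u 0 a"
        using B.aug_exact b a(1) u_maps free_diff' by meson
      show ?thesis
      proof
        show "case_sum b' a \<in> free_vecs (cone_basis (Suc 0))"
          using a b' by (simp add: cone_vecs_Suc)
        show "cone_diff 0 (case_sum b' a) = x"
          using b' x0 by (simp add: cone_diff_def sum_eq_iff flip: b_def)
      qed
    qed
    show "\<exists>x\<in>free_vecs (cone_basis 0). lam (eB (x \<circ> Inl)) = q" for q
    proof -
      obtain p where "lam p = q" using sur by (metis surjD)
      moreover obtain b where b: "b \<in> free_vecs (J 0)" "eB b = p" using B.aug_onto by blast
      moreover have "case_sum b 0 \<in> free_vecs (cone_basis 0)" using b by (simp add: cone_vecs_0)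
      ultimately show ?thesis by (metis case_sum_comp(1))
    qed
  qed
qed

section \<open>The three estimates for a mapping cone\<close>

context chain_map_of_minimal
begin

lemma cone_shiftD:
  assumes "tor_shift_zero m cone_basis cone_diff i"
    and "b \<in> free_vecs (J (Suc i))" "a \<in> free_vecs (I i)"
    and "dB i b + u i a \<in> mpow (Suc n) (J i)" "\<And>k. i = Suc k \<Longrightarrow> dA k a \<in> mpow (Suc n) (I k)"
  obtains b' a' where "b' \<in> free_vecs (J (Suc (Suc i)))" "a' \<in> free_vecs (I (Suc i))"
    "b - (dB (Suc i) b' + u (Suc i) a') \<in> mpow n (J (Suc i))" "a + dA i a' \<in> mpow n (I i)"
proof -
  let ?x = "case_sum b a"
  have "?x \<in> free_vecs (cone_basis (Suc i))"
    using assms by (simp add: cone_vecs_Suc)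
  moreover have "cone_diff i ?x \<in> mpow (Suc n) (cone_basis i)"
    using assms(4,5)
    by (cases i) (simp_all add: cone_vecs_Suc cone_vecs_0 cone_diff_def pow_neg del: ideal_power.simps)
  ultimately obtain y where y: "y \<in> free_vecs (cone_basis (Suc (Suc i)))"
    "?x - cone_diff (Suc i) y \<in> mpow n (cone_basis (Suc i))"
    using assms(1) unfolding tor_shift_zero_def by blast
  show thesis
    by (rule that[of "y \<circ> Inl" "y \<circ> Inr"])
      (use y in \<open>simp_all add: cone_vecs_Suc cone_diff_def del: ideal_power.simps\<close>)
qed

text \<open>Properties of \<open>u\<close> after tensoring with \<open>R/m\<close>.\<close>

definition inj_mod :: "nat \<Rightarrow> bool" where
  "inj_mod i \<longleftrightarrow> (\<forall>x\<in>free_vecs (I i). u i x \<in> vecs m (J i) \<longrightarrow> x \<in> vecs m (I i))"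

definition zero_mod :: "nat \<Rightarrow> bool" where
  "zero_mod i \<longleftrightarrow> (\<forall>x\<in>free_vecs (I i). u i x \<in> vecs m (J i))"

definition surj_mod :: "nat \<Rightarrow> bool" where
  "surj_mod i \<longleftrightarrow> (\<forall>y\<in>free_vecs (J i). \<exists>x\<in>free_vecs (I i). y - u i x \<in> vecs m (J i))"

lemma inj_modD:
  assumes "inj_mod i" "\<And>c. c \<notin> m \<Longrightarrow> \<exists>v. v * c - 1 \<in> m"
    and "x \<in> mpow n (I i)" "u i x \<in> mpow (Suc n) (J i)"
  shows "x \<in> mpow (Suc n) (I i)"
  by (rule injective_mod_power[OF u_lin A.fin u_maps m assms(2) _ assms(3,4)])
    (use assms(1) in \<open>auto simp: inj_mod_def\<close>)

lemma zero_modD: "zero_mod i \<Longrightarrow> x \<in> mpow n (I i) \<Longrightarrow> u i x \<in> mpow (Suc n) (J i)"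
  by (rule linear_map_vecs_Suc[OF u_lin A.fin]) (auto simp: zero_mod_def)

lemma surj_modD:
  assumes "surj_mod i" "y \<in> mpow n (J i)"
  obtains x where "x \<in> mpow n (I i)" "y - u i x \<in> mpow (Suc n) (J i)"
  by (rule surjective_mod_power[OF u_lin B.fin m _ assms(2)])
    (use assms(1) in \<open>auto simp: surj_mod_def\<close>)

text \<open>An element \<open>x\<close> with \<open>d x\<close> in \<open>m\<^sup>n\<^sup>+\<^sup>1\<close> is regarded as an element of the cone. The cone makes it a
  boundary up to \<open>u a\<close> for some \<open>a\<close> in degree \<open>i + 1\<close> of the source, and the vanishing for the source
  disposes of \<open>u a\<close> once \<open>d a\<close> lies in \<open>m\<^sup>n\<^sup>+\<^sup>1\<close>. At first only \<open>m\<^sup>n\<close> is available: injectivity gains the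
  missing power because \<open>u (d a)\<close> lies in \<open>m\<^sup>n\<^sup>+\<^sup>1\<close>, surjectivity because \<open>x\<close> can be corrected to have its
  differential in \<open>m\<^sup>n\<^sup>+\<^sup>2\<close> before the cone is used.\<close>
lemma middle_shift:
  assumes unit: "\<And>c. c \<notin> m \<Longrightarrow> \<exists>v. v * c - 1 \<in> m"
    and SA: "tor_shift_zero m I dA i" and SC: "tor_shift_zero m cone_basis cone_diff i"
    and u: "inj_mod i \<or> surj_mod i"
  shows "tor_shift_zero m J dB i"
  unfolding tor_shift_zero_def
proof (intro allI ballI impI)
  fix n x assume x: "x \<in> free_vecs (J (Suc i))" and dx: "dB i x \<in> mpow (Suc n) (J i)"
  from u show "\<exists>y\<in>free_vecs (J (Suc (Suc i))). x - dB (Suc i) y \<in> mpow n (J (Suc i))"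
  proof
    assume inj: "inj_mod i"
    have zero: "0 \<in> mpow k K" for k and K :: "'k set" by (rule vecs_zero) simp
    obtain b a where b: "b \<in> free_vecs (J (Suc (Suc i)))" and a: "a \<in> free_vecs (I (Suc i))"
      and xb: "x - (dB (Suc i) b + u (Suc i) a) \<in> mpow n (J (Suc i))" and da: "0 + dA i a \<in> mpow n (I i)"
      by (rule cone_shiftD[OF SC x, of 0])
        (use dx zero in \<open>simp_all add: vecs_zero hom_zero[OF u_lin] hom_zero[OF A.lin] del: ideal_power.simps\<close>)
    have "u i (dA i a) = dB i x - dB i (x - (dB (Suc i) b + u (Suc i) a))"
      using a b by (simp add: u_chain hom_diff[OF B.lin] hom_add[OF B.lin] B.dd)
    then have "u i (dA i a) \<in> mpow (Suc n) (J i)"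
      using dx dB_pow[OF xb] by (simp only: pow_diff)
    then have "dA i a \<in> mpow (Suc n) (I i)"
      using inj_modD[OF inj unit] da by simp
    then obtain a' where a': "a' \<in> free_vecs (I (Suc (Suc i)))"
      "a - dA (Suc i) a' \<in> mpow n (I (Suc i))"
      using tor_shift_zeroD[OF SA a] by blast
    let ?y = "b + u (Suc (Suc i)) a'"
    have "x - dB (Suc i) ?y = (x - (dB (Suc i) b + u (Suc i) a)) + u (Suc i) (a - dA (Suc i) a')"
      using a' by (simp add: u_chain hom_diff[OF u_lin] hom_add[OF B.lin] algebra_simps)
    then have "x - dB (Suc i) ?y \<in> mpow n (J (Suc i))"
      using xb u_pow[OF a'(2)] by (simp only: pow_add)
    moreover have "?y \<in> free_vecs (J (Suc (Suc i)))"
      using b a' u_maps by (intro free_add) auto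
    ultimately show ?thesis by blast
  next
    assume sur: "surj_mod i"
    obtain a where a: "a \<in> mpow (Suc n) (I i)" and z: "dB i x - u i a \<in> mpow (Suc (Suc n)) (J i)"
      by (rule surj_modD[OF sur dx])
    have "dB i x + u i (- a) \<in> mpow (Suc (Suc n)) (J i)"
      using z by (simp add: hom_neg[OF u_lin] del: ideal_power.simps)
    moreover have "dA k (- a) \<in> mpow (Suc (Suc n)) (I k)" if "i = Suc k" for k
      using dA_pow a that pow_neg by blast
    ultimately obtain b a' where b: "b \<in> free_vecs (J (Suc (Suc i)))"
      and a': "a' \<in> free_vecs (I (Suc i))"
      and xb: "x - (dB (Suc i) b + u (Suc i) a') \<in> mpow (Suc n) (J (Suc i))"
      and aa': "- a + dA i a' \<in> mpow (Suc n) (I i)"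
      by (rule cone_shiftD[OF SC x free_neg[OF vecs_free[OF a]]])
    have "dA i a' \<in> mpow (Suc n) (I i)"
      using pow_add[OF a aa'] by (simp del: ideal_power.simps)
    then obtain a'' where a'': "a'' \<in> free_vecs (I (Suc (Suc i)))"
      "a' - dA (Suc i) a'' \<in> mpow n (I (Suc i))"
      using tor_shift_zeroD[OF SA a'] by blast
    let ?y = "b + u (Suc (Suc i)) a''"
    have "x - dB (Suc i) ?y = (x - (dB (Suc i) b + u (Suc i) a')) + u (Suc i) (a' - dA (Suc i) a'')"
      using a'' by (simp add: u_chain hom_diff[OF u_lin] hom_add[OF B.lin] algebra_simps)
    then have "x - dB (Suc i) ?y \<in> mpow n (J (Suc i))"
      using pow_Suc[OF xb] u_pow[OF a''(2)] by (simp only: pow_add)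
    moreover have "?y \<in> free_vecs (J (Suc (Suc i)))"
      using b a'' u_maps by (intro free_add) auto
    ultimately show ?thesis by blast
  qed
qed

text \<open>A cycle \<open>(b, a)\<close> of the cone modulo \<open>m\<^sup>n\<^sup>+\<^sup>1\<close> is first changed by a boundary so that \<open>a\<close> becomes
  small, by the vanishing for the source; then \<open>b\<close> is a cycle modulo \<open>m\<^sup>n\<^sup>+\<^sup>1\<close> if \<open>u\<close> maps the new \<open>a\<close> to
  \<open>m\<^sup>n\<^sup>+\<^sup>1\<close>. If \<open>u\<close> vanishes modulo \<open>m\<close>, it suffices that the new \<open>a\<close> lies in \<open>m\<^sup>n\<close>. If \<open>u\<close> is injective
  modulo \<open>m\<close> one degree lower, then \<open>d a\<close> even lies in \<open>m\<^sup>n\<^sup>+\<^sup>2\<close>, and the new \<open>a\<close> in \<open>m\<^sup>n\<^sup>+\<^sup>1\<close>.\<close>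
lemma right_shift:
  assumes unit: "\<And>c. c \<notin> m \<Longrightarrow> \<exists>v. v * c - 1 \<in> m"
    and SA: "tor_shift_zero m I dA i" and SB: "tor_shift_zero m J dB (Suc i)"
    and u: "zero_mod (Suc i) \<or> inj_mod i"
  shows "tor_shift_zero m cone_basis cone_diff (Suc i)"
  unfolding tor_shift_zero_def
proof (intro allI ballI impI)
  fix n x assume x: "x \<in> free_vecs (cone_basis (Suc (Suc i)))"
    and dx: "cone_diff (Suc i) x \<in> mpow (Suc n) (cone_basis (Suc i))"
  define b where "b = x \<circ> Inl"
  define a where "a = x \<circ> Inr"
  have b: "b \<in> free_vecs (J (Suc (Suc i)))" and a: "a \<in> free_vecs (I (Suc i))"
    using x by (auto simp: cone_vecs_Suc a_def b_def)
  have db: "dB (Suc i) b + u (Suc i) a \<in> mpow (Suc n) (J (Suc i))"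
    and da: "dA i a \<in> mpow (Suc n) (I i)"
    using dx pow_neg[of "- dA i a"]
    by (auto simp: cone_vecs_Suc cone_diff_def a_def b_def simp del: ideal_power.simps)
  have "\<exists>a'\<in>free_vecs (I (Suc (Suc i))). a - dA (Suc i) a' \<in> mpow n (I (Suc i)) \<and>
      u (Suc i) (a - dA (Suc i) a') \<in> mpow (Suc n) (J (Suc i))"
    using u
  proof
    assume zero: "zero_mod (Suc i)"
    show ?thesis by (rule tor_shift_zeroD[OF SA a da]) (use zero_modD[OF zero] in blast)
  next
    assume inj: "inj_mod i"
    have "u i (dA i a) = dB i (dB (Suc i) b + u (Suc i) a)"
      using a b by (simp add: hom_add[OF B.lin] B.dd u_chain)
    then have "u i (dA i a) \<in> mpow (Suc (Suc n)) (J i)"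
      using dB_pow[OF db] by (simp only:)
    then have "dA i a \<in> mpow (Suc (Suc n)) (I i)"
      using inj_modD[OF inj unit da] by blast
    then show ?thesis
      by (rule tor_shift_zeroD[OF SA a]) (use pow_Suc u_pow in blast)
  qed
  then obtain a' where a': "a' \<in> free_vecs (I (Suc (Suc i)))"
    and z: "a - dA (Suc i) a' \<in> mpow n (I (Suc i))"
    and uz: "u (Suc i) (a - dA (Suc i) a') \<in> mpow (Suc n) (J (Suc i))" by blast
  let ?b = "b + u (Suc (Suc i)) a'"
  have "?b \<in> free_vecs (J (Suc (Suc i)))"
    using b a' u_maps by (intro free_add) auto
  moreover have "dB (Suc i) ?b = (dB (Suc i) b + u (Suc i) a) - u (Suc i) (a - dA (Suc i) a')"
    using a' by (simp add: hom_add[OF B.lin] hom_diff[OF u_lin] u_chain)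
  then have "dB (Suc i) ?b \<in> mpow (Suc n) (J (Suc i))"
    using db uz by (simp only: pow_diff)
  ultimately obtain b'' where b'': "b'' \<in> free_vecs (J (Suc (Suc (Suc i))))"
    "?b - dB (Suc (Suc i)) b'' \<in> mpow n (J (Suc (Suc i)))"
    by (rule tor_shift_zeroD[OF SB])
  have "case_sum b'' (- a') \<in> free_vecs (cone_basis (Suc (Suc (Suc i))))"
    using a' b'' by (simp add: cone_vecs_Suc free_neg)
  moreover have "x - cone_diff (Suc (Suc i)) (case_sum b'' (- a')) \<in> mpow n (cone_basis (Suc (Suc i)))"
    using b'' z by (simp add: cone_vecs_Suc cone_diff_def hom_neg[OF u_lin] hom_neg[OF A.lin]
        algebra_simps flip: a_def b_def del: ideal_power.simps)
  ultimately show "\<exists>y\<in>free_vecs (cone_basis (Suc (Suc (Suc i)))).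
      x - cone_diff (Suc (Suc i)) y \<in> mpow n (cone_basis (Suc (Suc i)))" by blast
qed

text \<open>Given \<open>a\<close> with \<open>d a\<close> in \<open>m\<^sup>n\<^sup>+\<^sup>1\<close>, the image \<open>u a\<close> is a boundary \<open>d b\<close> up to an error. If the error
  is the image of some \<open>y\<close> in \<open>m\<^sup>n\<close> up to \<open>m\<^sup>n\<^sup>+\<^sup>1\<close>, then \<open>(- b, a - y)\<close> is a cycle of the cone modulo
  \<open>m\<^sup>n\<^sup>+\<^sup>1\<close>, and the vanishing for the cone makes \<open>a - y\<close> a boundary modulo \<open>m\<^sup>n\<close>. Such a \<open>y\<close> exists by
  surjectivity; if \<open>u\<close> is zero modulo \<open>m\<close>, then \<open>d (u a)\<close> lies in \<open>m\<^sup>n\<^sup>+\<^sup>2\<close>, and \<open>y = 0\<close> will do.\<close>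
lemma left_shift:
  assumes SB: "tor_shift_zero m J dB i" and SC: "tor_shift_zero m cone_basis cone_diff (Suc i)"
    and u: "surj_mod (Suc i) \<or> zero_mod i"
  shows "tor_shift_zero m I dA i"
  unfolding tor_shift_zero_def
proof (intro allI ballI impI)
  fix n a assume a: "a \<in> free_vecs (I (Suc i))" and da: "dA i a \<in> mpow (Suc n) (I i)"
  have dua: "dB i (u (Suc i) a) = u i (dA i a)" using a by (simp add: u_chain)
  have ua: "u (Suc i) a \<in> free_vecs (J (Suc i))" using a by (rule u_maps)
  have "\<exists>b\<in>free_vecs (J (Suc (Suc i))). \<exists>y\<in>mpow n (I (Suc i)).
      u (Suc i) a - dB (Suc i) b - u (Suc i) y \<in> mpow (Suc n) (J (Suc i))"
    using u
  proof
    assume sur: "surj_mod (Suc i)"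
    have "dB i (u (Suc i) a) \<in> mpow (Suc n) (J i)"
      unfolding dua by (rule u_pow[OF da])
    then obtain b where "b \<in> free_vecs (J (Suc (Suc i)))"
      "u (Suc i) a - dB (Suc i) b \<in> mpow n (J (Suc i))"
      by (rule tor_shift_zeroD[OF SB ua])
    then show ?thesis using surj_modD[OF sur] by metis
  next
    assume zero: "zero_mod i"
    have "dB i (u (Suc i) a) \<in> mpow (Suc (Suc n)) (J i)"
      unfolding dua by (rule zero_modD[OF zero da])
    then obtain b where "b \<in> free_vecs (J (Suc (Suc i)))"
      "u (Suc i) a - dB (Suc i) b \<in> mpow (Suc n) (J (Suc i))"
      by (rule tor_shift_zeroD[OF SB ua])
    moreover have "(0 :: 'i \<Rightarrow> 'r) \<in> mpow n (I (Suc i))" by (rule vecs_zero) simp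
    ultimately show ?thesis using hom_zero[OF u_lin] by (metis diff_zero)
  qed
  then obtain b y where b: "b \<in> free_vecs (J (Suc (Suc i)))" and y: "y \<in> mpow n (I (Suc i))"
    and z: "u (Suc i) a - dB (Suc i) b - u (Suc i) y \<in> mpow (Suc n) (J (Suc i))" by blast
  have "dB (Suc i) (- b) + u (Suc i) (a - y) \<in> mpow (Suc n) (J (Suc i))"
    using z by (simp add: hom_neg[OF B.lin] hom_diff[OF u_lin] algebra_simps del: ideal_power.simps)
  moreover have "dA i (a - y) \<in> mpow (Suc n) (I i)"
    using pow_diff[OF da dA_pow[OF y]] by (simp add: hom_diff[OF A.lin] del: ideal_power.simps)
  ultimately obtain a' where a': "a' \<in> free_vecs (I (Suc (Suc i)))"
    and ay: "a - y + dA (Suc i) a' \<in> mpow n (I (Suc i))"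
    using cone_shiftD[OF SC free_neg[OF b] free_diff'[OF a vecs_free[OF y]], of n] by blast
  have "a - dA (Suc i) (- a') \<in> mpow n (I (Suc i))"
    using pow_add[OF y ay] by (simp add: hom_neg[OF A.lin] algebra_simps del: ideal_power.simps)
  then show "\<exists>y\<in>free_vecs (I (Suc (Suc i))). a - dA (Suc i) y \<in> mpow n (I (Suc i))"
    using free_neg[OF a'] by blast
qed

end

section \<open>Tensoring with a resolution of the residue field\<close>

lemma vecs_lift:
  assumes "x \<in> vecs X L" and g: "g 0 = 0" and ex: "\<And>j. j \<in> L \<Longrightarrow> \<exists>y\<in>Y. g y = x j"
  obtains y where "y \<in> vecs Y L" "g \<circ> y = x"
proof -
  obtain y where y: "\<And>j. j \<in> L \<Longrightarrow> y j \<in> Y \<and> g (y j) = x j"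
    using ex by metis
  show thesis
    by (rule that[of "\<lambda>j. if j \<in> L then y j else 0"])
      (use y assms(1) g in \<open>auto simp: vecs_def fun_eq_iff\<close>)
qed

lemma vecs_nth: "x \<in> vecs X L \<Longrightarrow> l \<in> L \<Longrightarrow> x l \<in> X"
  unfolding vecs_def by (auto split: if_splits)

lemma vecs_off: "x \<in> vecs X L \<Longrightarrow> l \<notin> L \<Longrightarrow> x l = 0"
  unfolding vecs_def by (auto split: if_splits)

lemma vecs_comp: "x \<in> vecs X L \<Longrightarrow> (\<And>v. v \<in> X \<Longrightarrow> g v \<in> Y) \<Longrightarrow> g 0 = 0 \<Longrightarrow> g \<circ> x \<in> vecs Y L"
  by (auto simp: vecs_def)

lemma tensor_diff_add:
  "module s \<Longrightarrow> tensor_diff s K p (x + y) = tensor_diff s K p x + tensor_diff s K p y"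
  by (auto simp: tensor_diff_def fun_eq_iff module.scale_right_distrib sum.distrib)

lemma tensor_diff_diff:
  "module s \<Longrightarrow> tensor_diff s K p (x - y) = tensor_diff s K p x - tensor_diff s K p y"
  by (auto simp: tensor_diff_def fun_eq_iff module.scale_right_diff_distrib sum_subtractf)

lemma tensor_diff_zero: "module s \<Longrightarrow> tensor_diff s K p 0 = 0"
  by (auto simp: tensor_diff_def fun_eq_iff module.scale_zero_right)

lemma tensor_diff_natural:
  "module_hom s t f \<Longrightarrow> f \<circ> tensor_diff s K p x = tensor_diff t K p (f \<circ> x)"
  by (auto simp: tensor_diff_def fun_eq_iff hom_zero hom_sum hom_scale)

lemma tensor_diff_linear: "linear_map (free_diff K p)"
  by (rule module_homI)
    (auto simp: vec.module_axioms fun_eq_iff tensor_diff_def distrib_left sum.distrib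
      sum_distrib_left mult.left_commute)

lemma tensor_diff_vecs:
  assumes "module s" "module.subspace s X" "x \<in> vecs X (basis K (Suc p))"
  shows "tensor_diff s K p x \<in> vecs X (basis K p)"
proof -
  have "s r (x l) \<in> X" if "l < free_rank K (Suc p)" for r l
    using assms that by (auto simp: vecs_def module.subspace_scale)
  then show ?thesis
    by (auto simp: vecs_def tensor_diff_def intro!: module.subspace_sum[OF assms(1,2)])
qed

lemma tensor_diff_coordinate:
  "tensor_diff vscale K p x j l = free_diff K p (\<lambda>j. x j l) j"
  by (simp add: tensor_diff_def sum_fun_apply)

lemma vecs_transpose: "x \<in> vecs (free_vecs I) L \<Longrightarrow> (\<lambda>j. x j l) \<in> free_vecs L"
  by (auto simp: vecs_def)

text \<open>The columns of the double complex \<open>K \<otimes> F\<close> are finite powers of \<open>K\<close>, and are lifted one coordinate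
  of \<open>F\<close> at a time.\<close>
lemma columns_assemble:
  assumes x: "x \<in> vecs (free_vecs L) N"
    and w: "\<And>l. w l \<in> free_vecs P" "\<And>l. free_diff K p (w l) = (\<lambda>j. x j l)"
  defines "y \<equiv> \<lambda>j l. if l \<in> L then w l j else 0"
  shows "y \<in> vecs (free_vecs L) P" "tensor_diff vscale K p y = x"
proof -
  show "y \<in> vecs (free_vecs L) P"
    using w(1) by (auto simp: y_def vecs_def fun_eq_iff)
  have "tensor_diff vscale K p y j l = x j l" for j l
  proof (cases "l \<in> L")
    case True
    then show ?thesis using w(2)[of l] by (simp add: tensor_diff_coordinate y_def)
  next
    case False
    then have "x j l = 0" using x by (cases "j \<in> N") (auto simp: vecs_def split: if_splits)
    with False show ?thesis by (simp add: tensor_diff_coordinate y_def) (simp add: tensor_diff_def)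
  qed
  then show "tensor_diff vscale K p y = x" by (intro ext)
qed

lemma tensor_carrier: "carrier (tensor_chain K i) = vecs UNIV (basis K i)"
  by (auto simp: tensor_chain_def additive_group_def vecs_def)

abbreviation tensor_cycles :: "('r \<Rightarrow> 'm \<Rightarrow> 'm) \<Rightarrow> 'r free_complex \<Rightarrow> nat \<Rightarrow> (nat \<Rightarrow> 'm::ab_group_add) set" where
  "tensor_cycles s K \<equiv> chain_cycles (tensor_chain K) (tensor_diff s K)"

abbreviation tensor_boundaries :: "('r \<Rightarrow> 'm \<Rightarrow> 'm) \<Rightarrow> 'r free_complex \<Rightarrow> nat \<Rightarrow> (nat \<Rightarrow> 'm::ab_group_add) set" where
  "tensor_boundaries s K \<equiv> chain_boundaries (tensor_chain K) (tensor_diff s K)"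

lemma tensor_cycles_iff:
  "z \<in> tensor_cycles s K i \<longleftrightarrow>
    z \<in> vecs UNIV (basis K i) \<and> (\<forall>p. i = Suc p \<longrightarrow> tensor_diff s K p z = 0)"
  by (cases i) (auto simp: chain_cycles_def kernel_def tensor_chain_def additive_group_def vecs_def)

lemma tensor_boundaries_iff:
  "z \<in> tensor_boundaries s K i \<longleftrightarrow>
    (\<exists>w\<in>vecs UNIV (basis K (Suc i)). tensor_diff s K i w = z)"
  by (auto simp: chain_boundaries_def tensor_carrier)

definition aug_sum :: "(nat \<Rightarrow> 'r) \<Rightarrow> nat \<Rightarrow> ('r \<Rightarrow> 'm \<Rightarrow> 'm) \<Rightarrow> (nat \<Rightarrow> 'm) \<Rightarrow> 'm::comm_monoid_add" where
  "aug_sum c k s x = (\<Sum>j<k. s (c j) (x j))"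

text \<open>A free resolution \<open>K\<close> of \<open>R/m\<close>. Its augmentation is lifted to the linear form with
  coefficients \<open>c\<close>, so that congruences modulo \<open>m\<close> replace cosets.\<close>
locale residue_field_resolution =
  fixes m :: "'r::comm_ring_1 set" and K :: "'r free_complex" and c :: "nat \<Rightarrow> 'r"
  assumes m: "is_ideal m"
    and K_dd: "\<And>p v. v \<in> fchain K (Suc (Suc p)) \<Longrightarrow>
      free_diff K p (free_diff K (Suc p) v) = 0"
    and K_exact: "\<And>p v. v \<in> fchain K (Suc p) \<Longrightarrow> free_diff K p v = 0 \<Longrightarrow>
      \<exists>w\<in>fchain K (Suc (Suc p)). free_diff K (Suc p) w = v"
    and eps_onto: "\<exists>v\<in>fchain K 0. aug_sum c (free_rank K 0) (*) v - 1 \<in> m"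
    and eps_d: "\<And>v. v \<in> fchain K (Suc 0) \<Longrightarrow>
      aug_sum c (free_rank K 0) (*) (free_diff K 0 v) \<in> m"
    and eps_exact: "\<And>v. v \<in> fchain K 0 \<Longrightarrow> aug_sum c (free_rank K 0) (*) v \<in> m \<Longrightarrow>
      \<exists>w\<in>fchain K (Suc 0). free_diff K 0 w = v"
begin

abbreviation "rk \<equiv> free_rank K"

lemma diff_mat_square:
  assumes "j < rk p" "t < rk (Suc (Suc p))"
  shows "(\<Sum>l<rk (Suc p). diff_mat K p j l * diff_mat K (Suc p) l t) = 0"
proof -
  have "free_diff K p (free_diff K (Suc p) (unit_vec t)) j = 0"
    using K_dd[OF unit_vec_free] assms(2) by simp
  then show ?thesis
    using assms by (simp add: tensor_diff_def unit_vec_def if_distrib cong: if_cong)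
qed

lemma tensor_diff_square:
  assumes "module s"
  shows "tensor_diff s K p (tensor_diff s K (Suc p) x) = 0"
proof
  fix j
  interpret module s by fact
  show "tensor_diff s K p (tensor_diff s K (Suc p) x) j = 0 j"
  proof (cases "j < rk p")
    case True
    have "tensor_diff s K p (tensor_diff s K (Suc p) x) j =
        (\<Sum>l<rk (Suc p). \<Sum>t<rk (Suc (Suc p)). s (diff_mat K p j l * diff_mat K (Suc p) l t) (x t))"
      using True by (simp add: tensor_diff_def scale_sum_right)
    also have "\<dots> = (\<Sum>t<rk (Suc (Suc p)). \<Sum>l<rk (Suc p). s (diff_mat K p j l * diff_mat K (Suc p) l t) (x t))"
      by (rule sum.swap)
    also have "\<dots> = 0"
      using diff_mat_square[OF True] by (simp flip: scale_sum_left)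
    finally show ?thesis by simp
  qed (simp add: tensor_diff_def)
qed

abbreviation eps :: "(nat \<Rightarrow> 'i \<Rightarrow> 'r) \<Rightarrow> 'i \<Rightarrow> 'r" where
  "eps \<equiv> aug_sum c (rk 0) vscale"

lemma eps_coordinate: "eps x l = aug_sum c (rk 0) (*) (\<lambda>j. x j l)"
  by (simp add: aug_sum_def sum_fun_apply)

lemma eps_vecs: "is_ideal A \<Longrightarrow> x \<in> vecs (vecs A L) {..<rk 0} \<Longrightarrow> eps x \<in> vecs A L"
  unfolding aug_sum_def by (intro vecs_sum vecs_scale) (simp_all add: vecs_nth)

lemma eps_add: "eps (x + y) = eps x + eps y"
  and eps_diff: "eps (x - y) = eps x - eps y"
  by (simp_all add: aug_sum_def vec.scale_right_distrib vec.scale_right_diff_distrib sum.distrib sum_subtractf)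

lemma eps_natural: "linear_map u \<Longrightarrow> eps (u \<circ> x) = u (eps x)"
  by (simp add: aug_sum_def hom_sum hom_scale)

lemma column_exact:
  assumes x: "x \<in> vecs (free_vecs L) {..<rk (Suc p)}" and dx: "tensor_diff vscale K p x = 0"
  obtains y where "y \<in> vecs (free_vecs L) {..<rk (Suc (Suc p))}" "tensor_diff vscale K (Suc p) y = x"
proof -
  have "\<exists>w\<in>free_vecs {..<rk (Suc (Suc p))}. free_diff K (Suc p) w = (\<lambda>j. x j l)" for l
    using dx by (intro K_exact vecs_transpose[OF x]) (auto simp: fun_eq_iff simp flip: tensor_diff_coordinate)
  then obtain w where w: "\<And>l. w l \<in> free_vecs {..<rk (Suc (Suc p))}"
    "\<And>l. free_diff K (Suc p) (w l) = (\<lambda>j. x j l)" by metis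
  show thesis
    by (rule that[OF columns_assemble[OF x w]])
qed

lemma column_aug_exact:
  assumes x: "x \<in> vecs (free_vecs L) {..<rk 0}" and ex: "eps x \<in> vecs m L"
  obtains y where "y \<in> vecs (free_vecs L) {..<rk (Suc 0)}" "tensor_diff vscale K 0 y = x"
proof -
  have "aug_sum c (rk 0) (*) (\<lambda>j. x j l) \<in> m" for l
    using ex ideal_zero[OF m] by (auto simp: vecs_def simp flip: eps_coordinate split: if_splits)
  then have "\<exists>w\<in>free_vecs {..<rk (Suc 0)}. free_diff K 0 w = (\<lambda>j. x j l)" for l
    by (intro eps_exact vecs_transpose[OF x])
  then obtain w where w: "\<And>l. w l \<in> free_vecs {..<rk (Suc 0)}"
    "\<And>l. free_diff K 0 (w l) = (\<lambda>j. x j l)" by metis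
  show thesis
    by (rule that[OF columns_assemble[OF x w]])
qed

lemma column_aug_diff:
  assumes "y \<in> vecs (free_vecs L) {..<rk (Suc 0)}"
  shows "eps (tensor_diff vscale K 0 y) \<in> vecs m L"
proof -
  have "eps (tensor_diff vscale K 0 y) l \<in> m" for l
    using eps_d[OF vecs_transpose[OF assms]] by (simp add: eps_coordinate tensor_diff_coordinate)
  moreover have "eps (tensor_diff vscale K 0 y) \<in> free_vecs L"
    by (intro eps_vecs ideal_UNIV tensor_diff_vecs[OF vec.module_axioms vecs_subspace assms])
  ultimately show ?thesis by (auto simp: vecs_def)
qed

lemma column_aug_onto:
  assumes a: "a \<in> free_vecs L"
  obtains x where "x \<in> vecs (free_vecs L) {..<rk 0}" "a - eps x \<in> vecs m L"
proof -
  obtain w where w: "w \<in> free_vecs {..<rk 0}" "aug_sum c (rk 0) (*) w - 1 \<in> m"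
    using eps_onto by blast
  let ?x = "\<lambda>j. vscale (w j) a"
  have "a - eps ?x = vscale (- (aug_sum c (rk 0) (*) w - 1)) a"
    by (simp add: aug_sum_def vec.scale_left_diff_distrib vec.scale_sum_left)
  also have "\<dots> \<in> vecs m L"
    by (intro vecs_scale_ideal m ideal_neg w a)
  finally have "a - eps ?x \<in> vecs m L" .
  moreover have "?x \<in> vecs (free_vecs L) {..<rk 0}"
    using w(1) a by (auto simp: vecs_def fun_eq_iff)
  ultimately show thesis using that by blast
qed

end

section \<open>Balancing Tor\<close>

text \<open>Both \<open>K \<otimes> M\<close> and \<open>R/m \<otimes> F\<close> compute \<open>Tor(R/m, M)\<close>, and they are compared through the
  double complex \<open>K \<otimes> F\<close>, whose rows resolve \<open>K\<^sub>p \<otimes> M\<close> and whose columns resolve \<open>R/m \<otimes> F\<^sub>q\<close>.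
  The differential of \<open>R/m \<otimes> F\<close> vanishes because \<open>F\<close> is minimal.\<close>
locale balanced_tor =
  residue_field_resolution m K c + resolution s I d e
  for m :: "'r::comm_ring_1 set" and K c and s :: "'r \<Rightarrow> 'm::ab_group_add \<Rightarrow> 'm"
    and I :: "nat \<Rightarrow> 'i set" and d e +
  assumes minimal: "\<And>i x. x \<in> free_vecs (I (Suc i)) \<Longrightarrow> d i x \<in> vecs m (I i)"
begin

abbreviation double :: "nat \<Rightarrow> nat \<Rightarrow> (nat \<Rightarrow> 'i \<Rightarrow> 'r) set" where
  "double p q \<equiv> vecs (free_vecs (I q)) {..<rk p}"

abbreviation vdiff :: "nat \<Rightarrow> (nat \<Rightarrow> 'i \<Rightarrow> 'r) \<Rightarrow> nat \<Rightarrow> 'i \<Rightarrow> 'r" where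
  "vdiff \<equiv> tensor_diff vscale K"

lemma double_diff: "x \<in> double p q \<Longrightarrow> y \<in> double p q \<Longrightarrow> x - y \<in> double p q"
  and double_zero: "0 \<in> double p q"
  by (auto simp: vecs_def[of "free_vecs (I q)"] vecs_diff vecs_zero split: if_splits)

lemma vdiff_double: "x \<in> double (Suc p) q \<Longrightarrow> vdiff p x \<in> double p q"
  by (rule tensor_diff_vecs[OF vec.module_axioms vecs_subspace]) simp_all

lemma hdiff_double: "x \<in> double p (Suc q) \<Longrightarrow> d q \<circ> x \<in> double p q"
  by (erule vecs_comp) (simp_all add: maps hom_zero[OF lin])

lemma hdiff_square: "x \<in> double p (Suc (Suc q)) \<Longrightarrow> d q \<circ> (d (Suc q) \<circ> x) = 0"
proof
  fix j assume "x \<in> double p (Suc (Suc q))"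
  then show "(d q \<circ> (d (Suc q) \<circ> x)) j = 0 j"
    by (cases "j < rk p") (simp_all add: vecs_nth vecs_off dd hom_zero[OF lin])
qed

lemma hdiff_zero: "d q \<circ> 0 = 0"
  by (auto simp: fun_eq_iff hom_zero[OF lin])

lemma hdiff_add: "d q \<circ> (x + y) = (d q \<circ> x) + (d q \<circ> y)"
  and hdiff_diff: "d q \<circ> (x - y) = (d q \<circ> x) - (d q \<circ> y)"
  and aug_diff: "e \<circ> (x - y) = (e \<circ> x) - (e \<circ> y)"
  and aug_add: "e \<circ> (x + y) = (e \<circ> x) + (e \<circ> y)"
  by (auto simp: fun_eq_iff hom_add[OF lin] hom_diff[OF lin] hom_add[OF aug] hom_diff[OF aug])

lemmas vdiff_hdiff = tensor_diff_natural[OF lin, of _ K]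
lemmas vdiff_aug = tensor_diff_natural[OF aug, of K]
lemmas vdiff_add = tensor_diff_add[OF vec.module_axioms, of K]
lemmas vdiff_diff = tensor_diff_diff[OF vec.module_axioms, of K]
lemmas vdiff_square = tensor_diff_square[OF vec.module_axioms]

lemma row_exact:
  assumes "x \<in> double p (Suc q)" "d q \<circ> x = 0"
  obtains y where "y \<in> double p (Suc (Suc q))" "d (Suc q) \<circ> y = x"
proof (rule vecs_lift[OF assms(1), of "d (Suc q)" "free_vecs (I (Suc (Suc q)))"])
  show "d (Suc q) 0 = 0" by (simp add: hom_zero[OF lin])
  show "\<exists>y\<in>free_vecs (I (Suc (Suc q))). d (Suc q) y = x j" if "j \<in> {..<rk p}" for j
    using assms that by (intro exact) (simp_all add: vecs_nth fun_eq_iff)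
qed (rule that)

lemma row_aug_exact:
  assumes "x \<in> double p 0" "e \<circ> x = 0"
  obtains y where "y \<in> double p (Suc 0)" "d 0 \<circ> y = x"
proof (rule vecs_lift[OF assms(1), of "d 0" "free_vecs (I (Suc 0))"])
  show "d 0 0 = 0" by (simp add: hom_zero[OF lin])
  show "\<exists>y\<in>free_vecs (I (Suc 0)). d 0 y = x j" if "j \<in> {..<rk p}" for j
    using assms that by (intro aug_exact) (simp_all add: vecs_nth fun_eq_iff)
qed (rule that)

lemma row_aug_onto:
  assumes "z \<in> vecs UNIV {..<rk p}"
  obtains x where "x \<in> double p 0" "e \<circ> x = z"
  by (rule vecs_lift[OF assms hom_zero[OF aug] aug_onto]) (rule that)

lemma row_aug_diff: "x \<in> double p (Suc 0) \<Longrightarrow> e \<circ> (d 0 \<circ> x) = 0"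
proof
  fix j assume "x \<in> double p (Suc 0)"
  then show "(e \<circ> (d 0 \<circ> x)) j = 0 j"
    by (cases "j < rk p") (simp_all add: vecs_nth vecs_off aug_d hom_zero[OF lin] hom_zero[OF aug])
qed

text \<open>\<open>staircase p q x a\<close> means that \<open>x \<in> K\<^sub>p \<otimes> F\<^sub>q\<close> is joined to \<open>a \<in> F\<^sub>p\<^sub>+\<^sub>q\<close> by a zigzag through the
  double complex. The two differentials commute, so zigzags carry no signs. Those from
  \<open>K\<^sub>i \<otimes> F\<^sub>0\<close> to \<open>F\<^sub>i\<close> form the graph of the isomorphism between the two homologies.\<close>
primrec staircase :: "nat \<Rightarrow> nat \<Rightarrow> (nat \<Rightarrow> 'i \<Rightarrow> 'r) \<Rightarrow> ('i \<Rightarrow> 'r) \<Rightarrow> bool" where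
  "staircase 0 q x a \<longleftrightarrow> a - eps x \<in> vecs m (I q)"
| "staircase (Suc p) q x a \<longleftrightarrow>
    (\<exists>x'\<in>double p (Suc q). vdiff p x = d q \<circ> x' \<and> staircase p (Suc q) x' a)"

lemma staircase_diff:
  "staircase p q x a \<Longrightarrow> staircase p q y b \<Longrightarrow> staircase p q (x - y) (a - b)"
proof (induction p arbitrary: q x y)
  case 0
  have "(a - b) - eps (x - y) = (a - eps x) - (b - eps y)"
    by (simp only: eps_diff diff_diff_eq2 diff_diff_eq add_diff_eq diff_add_eq add_ac)
  with 0 show ?case by (simp only: staircase.simps vecs_diff[OF m])
next
  case (Suc p)
  then obtain x' y' where "x' \<in> double p (Suc q)" "vdiff p x = d q \<circ> x'" "staircase p (Suc q) x' a"
    "y' \<in> double p (Suc q)" "vdiff p y = d q \<circ> y'" "staircase p (Suc q) y' b" by auto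
  then have "x' - y' \<in> double p (Suc q)" "vdiff p (x - y) = d q \<circ> (x' - y')"
    "staircase p (Suc q) (x' - y') (a - b)"
    by (simp_all only: double_diff vdiff_diff hdiff_diff Suc.IH)
  then show ?case unfolding staircase.simps by blast
qed

text \<open>The zigzag is built from \<open>a\<close> towards \<open>q = 0\<close>. Minimality provides the first step: the
  differential of \<open>a\<close> vanishes modulo \<open>m\<close>, so it lifts along the column of \<open>K\<close>. The second conjunct
  is the step that continues the zigzag.\<close>
lemma staircase_from_element:
  assumes "a \<in> free_vecs (I (p + q))"
  shows "\<exists>x\<in>double p q. staircase p q x a \<and>
    (\<forall>q'. q = Suc q' \<longrightarrow> (\<exists>y\<in>double (Suc p) q'. vdiff p y = d q' \<circ> x))"
  using assms
proof (induction p arbitrary: q)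
  case 0
  then obtain x where x: "x \<in> double 0 q" "a - eps x \<in> vecs m (I q)"
    using column_aug_onto by (metis add_0)
  have "\<exists>y\<in>double (Suc 0) q'. vdiff 0 y = d q' \<circ> x" if q: "q = Suc q'" for q'
  proof -
    have "eps x \<in> free_vecs (I (Suc q'))" using x(1) q by (intro eps_vecs) auto
    then have "eps (d q' \<circ> x) \<in> vecs m (I q')" by (simp add: eps_natural[OF lin] minimal)
    then show ?thesis using column_aug_exact[OF hdiff_double] x(1) q by metis
  qed
  with x show ?case unfolding staircase.simps by blast
next
  case (Suc p)
  have "a \<in> free_vecs (I (p + Suc q))" using Suc.prems by simp
  from Suc.IH[OF this] obtain x y where x: "x \<in> double p (Suc q)" "staircase p (Suc q) x a"
    and y: "y \<in> double (Suc p) q" "vdiff p y = d q \<circ> x"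
    by blast
  have "\<exists>w\<in>double (Suc (Suc p)) q'. vdiff (Suc p) w = d q' \<circ> y" if q: "q = Suc q'" for q'
  proof -
    have "vdiff p (d q' \<circ> y) = 0"
      using x(1) y(2) q by (simp add: hdiff_square flip: vdiff_hdiff)
    then show ?thesis using column_exact[OF hdiff_double] y(1) q by metis
  qed
  with x y show ?case unfolding staircase.simps by blast
qed

text \<open>In the opposite direction, towards \<open>p = 0\<close>, the exactness of the rows provides the next step of the
  zigzag.\<close>
lemma staircase_from_cycle:
  assumes "x \<in> double p q" "\<And>p'. p = Suc p' \<Longrightarrow> \<exists>x'\<in>double p' (Suc q). vdiff p' x = d q \<circ> x'"
  shows "\<exists>a\<in>free_vecs (I (p + q)). staircase p q x a"
  using assms
proof (induction p arbitrary: q x)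
  case 0
  then show ?case by (intro bexI[of _ "eps x"]) (auto intro: eps_vecs vecs_zero m)
next
  case (Suc p)
  then obtain x' where x': "x' \<in> double p (Suc q)" "vdiff p x = d q \<circ> x'" by blast
  have "\<exists>x''\<in>double p' (Suc (Suc q)). vdiff p' x' = d (Suc q) \<circ> x''" if p: "p = Suc p'" for p'
  proof -
    have "d q \<circ> vdiff p' x' = 0"
      using x'(2) p by (simp only: vdiff_hdiff vdiff_square flip: x'(2))
    then show ?thesis using row_exact[OF vdiff_double] x'(1) p by metis
  qed
  with Suc.IH[OF x'(1)] obtain a where "a \<in> free_vecs (I (p + Suc q))" "staircase p (Suc q) x' a"
    by blast
  with x' show ?case unfolding staircase.simps add_Suc_shift by blast
qed

text \<open>The decomposition \<open>x = vdiff p y + (d q \<circ> t)\<close> is carried along the zigzag: the \<open>t\<close> of one element is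
  the \<open>y\<close> of the next.\<close>
lemma staircase_of_boundary:
  assumes "staircase p q x a" "x = vdiff p y + (d q \<circ> t)" "y \<in> double (Suc p) q" "t \<in> double p (Suc q)"
  shows "a \<in> vecs m (I (p + q))"
  using assms
proof (induction p arbitrary: q x y t)
  case 0
  have "eps t \<in> free_vecs (I (Suc q))" using 0(4) by (intro eps_vecs) auto
  then have "eps x \<in> vecs m (I q)"
    unfolding 0(2) eps_add eps_natural[OF lin]
    by (intro vecs_add m minimal column_aug_diff 0(3))
  then show ?case using 0(1) vecs_add[OF m, of "a - eps x" "I q" "eps x"] by simp
next
  case (Suc p)
  obtain x' where x': "x' \<in> double p (Suc q)" "vdiff p x = d q \<circ> x'" "staircase p (Suc q) x' a"
    using Suc.prems(1) unfolding staircase.simps by blast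
  have "d q \<circ> (x' - vdiff p t) = vdiff p x - (d q \<circ> vdiff p t)"
    by (simp only: hdiff_diff x'(2))
  also have "\<dots> = 0"
    by (simp only: Suc.prems(2) vdiff_add vdiff_square vdiff_hdiff diff_self add_0)
  finally obtain t' where "t' \<in> double p (Suc (Suc q))" "d (Suc q) \<circ> t' = x' - vdiff p t"
    using row_exact double_diff[OF x'(1) vdiff_double[OF Suc.prems(4)]] by metis
  then have "x' = vdiff p t + (d (Suc q) \<circ> t')" "t' \<in> double p (Suc (Suc q))"
    by (simp_all only: add.commute[of "vdiff p t"] diff_add_cancel)
  then show ?case
    using Suc.IH[OF x'(3) _ Suc.prems(4)] unfolding add_Suc_shift by blast
qed

text \<open>The same decomposition is carried back from the end of the zigzag, where \<open>a \<in> m F\<close> makes the element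
  a boundary in its column.\<close>
lemma staircase_to_zero:
  assumes "staircase p q x a" "x \<in> double p q" "a \<in> vecs m (I (p + q))"
  shows "\<exists>y\<in>double (Suc p) q. \<exists>t\<in>double p (Suc q). x = vdiff p y + (d q \<circ> t)"
  using assms
proof (induction p arbitrary: q x)
  case 0
  then have "eps x \<in> vecs m (I q)"
    using vecs_diff[OF m, of a "I q" "a - eps x"] by simp
  then obtain y where "y \<in> double (Suc 0) q" "vdiff 0 y = x"
    using column_aug_exact[OF 0(2)] by metis
  then have "x = vdiff 0 y + (d q \<circ> 0)" "y \<in> double (Suc 0) q"
    by (simp_all only: hdiff_zero add_0_right)
  with double_zero show ?case by blast
next
  case (Suc p)
  obtain x' where x': "x' \<in> double p (Suc q)" "vdiff p x = d q \<circ> x'" "staircase p (Suc q) x' a"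
    using Suc.prems(1) unfolding staircase.simps by blast
  then obtain y t where y: "y \<in> double (Suc p) (Suc q)" and t: "t \<in> double p (Suc (Suc q))"
    and eq: "x' = vdiff p y + (d (Suc q) \<circ> t)"
    using Suc.IH[OF x'(3,1)] Suc.prems(3) unfolding add_Suc_shift by blast
  have "vdiff p (x - (d q \<circ> y)) = 0"
    by (simp only: vdiff_diff x'(2) eq hdiff_add hdiff_square[OF t] vdiff_hdiff[symmetric] diff_self
        add_0_right)
  then obtain w where "w \<in> double (Suc (Suc p)) q" "vdiff (Suc p) w = x - (d q \<circ> y)"
    using column_exact double_diff[OF Suc.prems(2) hdiff_double[OF y]] by metis
  then have "x = vdiff (Suc p) w + (d q \<circ> y)" "w \<in> double (Suc (Suc p)) q"
    by (simp_all only: diff_add_cancel)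
  with y show ?case by blast
qed

abbreviation tor_cycles :: "nat \<Rightarrow> (nat \<Rightarrow> 'm) set" where
  "tor_cycles \<equiv> tensor_cycles s K"

abbreviation tor_boundaries :: "nat \<Rightarrow> (nat \<Rightarrow> 'm) set" where
  "tor_boundaries \<equiv> tensor_boundaries s K"

definition represents :: "nat \<Rightarrow> (nat \<Rightarrow> 'm) \<Rightarrow> ('i \<Rightarrow> 'r) \<Rightarrow> bool" where
  "represents i z a \<longleftrightarrow> a \<in> free_vecs (I i) \<and> (\<exists>x\<in>double i 0. e \<circ> x = z \<and> staircase i 0 x a)"

lemma represents_diff:
  "represents i z a \<Longrightarrow> represents i z' a' \<Longrightarrow> represents i (z - z') (a - a')"
  unfolding represents_def by (metis (no_types) aug_diff double_diff staircase_diff vecs_diff ideal_UNIV)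

lemma element_represented:
  assumes "a \<in> free_vecs (I i)"
  obtains z where "z \<in> tor_cycles i" "represents i z a"
proof -
  obtain x where x: "x \<in> double i 0" "staircase i 0 x a"
    using staircase_from_element[of a i 0] assms by auto
  have "tensor_diff s K p (e \<circ> x) = 0" if "i = Suc p" for p
    using x(2) that by (auto simp: row_aug_diff simp flip: vdiff_aug)
  moreover have "e \<circ> x \<in> vecs UNIV {..<rk i}"
    using vecs_comp[OF x(1), of e UNIV] hom_zero[OF aug] by simp
  ultimately show thesis
    by (intro that[of "e \<circ> x"]) (use x assms in \<open>auto simp: tensor_cycles_iff represents_def\<close>)
qed

lemma cycle_represents:
  assumes "z \<in> tor_cycles i"
  obtains a where "represents i z a"
proof -
  have z: "z \<in> vecs UNIV {..<rk i}" "\<And>p. i = Suc p \<Longrightarrow> tensor_diff s K p z = 0"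
    using assms by (auto simp: tensor_cycles_iff)
  obtain x where x: "x \<in> double i 0" "e \<circ> x = z" using row_aug_onto[OF z(1)] by blast
  have "\<exists>x'\<in>double p (Suc 0). vdiff p x = d 0 \<circ> x'" if "i = Suc p" for p
  proof -
    have "e \<circ> vdiff p x = 0" using z(2)[OF that] x(2) by (simp add: vdiff_aug)
    then show ?thesis using row_aug_exact[OF vdiff_double] x(1) that by metis
  qed
  then obtain a where "a \<in> free_vecs (I (i + 0))" "staircase i 0 x a"
    using staircase_from_cycle[OF x(1)] by blast
  then show thesis using that[of a] x by (auto simp: represents_def)
qed

lemma represents_boundary_iff:
  assumes "represents i z a"
  shows "z \<in> tor_boundaries i \<longleftrightarrow> a \<in> vecs m (I i)"
proof
  obtain x where x: "x \<in> double i 0" "e \<circ> x = z" "staircase i 0 x a"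
    using assms by (auto simp: represents_def)
  {
    assume "z \<in> tor_boundaries i"
    then obtain w where w: "w \<in> vecs UNIV {..<rk (Suc i)}" "tensor_diff s K i w = z"
      by (auto simp: tensor_boundaries_iff)
    obtain y where y: "y \<in> double (Suc i) 0" "e \<circ> y = w" using row_aug_onto[OF w(1)] by blast
    have "e \<circ> (x - vdiff i y) = 0" using x(2) y(2) w(2) by (simp add: aug_diff vdiff_aug)
    then obtain t where "t \<in> double i (Suc 0)" "d 0 \<circ> t = x - vdiff i y"
      using row_aug_exact double_diff[OF x(1) vdiff_double[OF y(1)]] by metis
    then show "a \<in> vecs m (I i)"
      using staircase_of_boundary[OF x(3), of y t] y(1) by simp
  next
    assume "a \<in> vecs m (I i)"
    then obtain y t where y: "y \<in> double (Suc i) 0" and t: "t \<in> double i (Suc 0)"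
      and eq: "x = vdiff i y + (d 0 \<circ> t)"
      using staircase_to_zero[OF x(3,1)] by auto
    have "z = tensor_diff s K i (e \<circ> y)"
      by (simp add: eq aug_add row_aug_diff[OF t] vdiff_aug flip: x(2))
    moreover have "e \<circ> y \<in> vecs UNIV {..<rk (Suc i)}"
      using vecs_comp[OF y, of e UNIV] hom_zero[OF aug] by simp
    ultimately show "z \<in> tor_boundaries i" by (auto simp: tensor_boundaries_iff)
  }
qed

end

section \<open>Maps on Tor in terms of minimal resolutions\<close>

locale tor_comparison =
  chain_map_of_minimal sM I dA eA sP J dB eB m u + residue_field_resolution m K c
  for sM :: "'r::comm_ring_1 \<Rightarrow> 'm::ab_group_add \<Rightarrow> 'm" and I :: "nat \<Rightarrow> 'i set" and dA eA
    and sP :: "'r \<Rightarrow> 'p::ab_group_add \<Rightarrow> 'p" and J :: "nat \<Rightarrow> 'j set" and dB eB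
    and m :: "'r set" and u K c +
  fixes \<phi> :: "'m \<Rightarrow> 'p"
  assumes \<phi>: "module_hom sM sP \<phi>"
    and u_aug: "\<And>x. x \<in> free_vecs (I 0) \<Longrightarrow> eB (u 0 x) = \<phi> (eA x)"
begin

sublocale TA: balanced_tor m K c sM I dA eA
  by unfold_locales (rule minA)

sublocale TB: balanced_tor m K c sP J dB eB
  by unfold_locales (rule minB)

lemma staircase_natural:
  assumes "TA.staircase p q x a" "x \<in> TA.double p q"
  shows "TB.staircase p q (u q \<circ> x) (u (p + q) a)"
  using assms
proof (induction p arbitrary: q x)
  case 0
  then have "u q (a - eps x) \<in> vecs m (J q)"
    by (intro linear_map_vecs[OF u_lin A.fin u_maps m]) auto
  then show ?case
    unfolding TB.staircase.simps add_0 eps_natural[OF u_lin] hom_diff[OF u_lin] .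
next
  case (Suc p)
  obtain x' where x': "x' \<in> TA.double p (Suc q)" "TA.vdiff p x = dA q \<circ> x'" "TA.staircase p (Suc q) x' a"
    using Suc.prems(1) unfolding TA.staircase.simps by blast
  have "dB q (u (Suc q) (x' j)) = u q (dA q (x' j))" for j
    using x'(1) by (cases "j < rk p")
      (simp_all add: vecs_nth vecs_off u_chain hom_zero[OF u_lin] hom_zero[OF A.lin] hom_zero[OF B.lin])
  then have "dB q \<circ> (u (Suc q) \<circ> x') = u q \<circ> (dA q \<circ> x')"
    by (intro ext) (simp only: comp_apply)
  then have "TB.vdiff p (u q \<circ> x) = dB q \<circ> (u (Suc q) \<circ> x')"
    by (simp only: tensor_diff_natural[OF u_lin, symmetric] x'(2))
  moreover have "u (Suc q) \<circ> x' \<in> TB.double p (Suc q)"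
    by (rule vecs_comp[OF x'(1)]) (simp_all add: u_maps hom_zero[OF u_lin])
  ultimately show ?case
    using Suc.IH[OF x'(3,1)] unfolding TB.staircase.simps add_Suc_shift by blast
qed

lemma represents_natural:
  assumes "TA.represents i z a"
  shows "TB.represents i (\<phi> \<circ> z) (u i a)"
proof -
  obtain x where x: "x \<in> TA.double i 0" "eA \<circ> x = z" "TA.staircase i 0 x a" and a: "a \<in> free_vecs (I i)"
    using assms by (auto simp: TA.represents_def)
  have "eB (u 0 (x j)) = \<phi> (eA (x j))" for j
    using x(1) by (cases "j < rk i")
      (simp_all add: vecs_nth vecs_off u_aug hom_zero[OF u_lin] hom_zero[OF A.aug] hom_zero[OF B.aug]
        hom_zero[OF \<phi>])
  then have "eB \<circ> (u 0 \<circ> x) = \<phi> \<circ> z"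
    unfolding x(2)[symmetric] by (intro ext) (simp only: comp_apply)
  moreover have "u 0 \<circ> x \<in> TB.double i 0"
    by (rule vecs_comp[OF x(1)]) (simp_all add: u_maps hom_zero[OF u_lin])
  ultimately show ?thesis
    using staircase_natural[OF x(3,1)] u_maps[OF a] unfolding TB.represents_def add_0_right by blast
qed

lemma zero_mod_from_tor:
  assumes "\<And>z. z \<in> TA.tor_cycles i \<Longrightarrow> \<phi> \<circ> z \<in> TB.tor_boundaries i"
  shows "zero_mod i"
  unfolding zero_mod_def
proof
  fix a :: "'i \<Rightarrow> 'r" assume "a \<in> free_vecs (I i)"
  then obtain z where "z \<in> TA.tor_cycles i" "TA.represents i z a" by (rule TA.element_represented)
  then show "u i a \<in> vecs m (J i)"
    using TB.represents_boundary_iff[OF represents_natural] assms by blast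
qed

lemma inj_mod_from_tor:
  assumes "\<And>z. z \<in> TA.tor_cycles i \<Longrightarrow> \<phi> \<circ> z \<in> TB.tor_boundaries i \<Longrightarrow> z \<in> TA.tor_boundaries i"
  shows "inj_mod i"
  unfolding inj_mod_def
proof (intro ballI impI)
  fix a :: "'i \<Rightarrow> 'r" assume a: "a \<in> free_vecs (I i)" and ua: "u i a \<in> vecs m (J i)"
  obtain z where z: "z \<in> TA.tor_cycles i" "TA.represents i z a"
    using a by (rule TA.element_represented)
  then have "z \<in> TA.tor_boundaries i"
    using TB.represents_boundary_iff[OF represents_natural[OF z(2)]] ua assms by blast
  then show "a \<in> vecs m (I i)"
    using TA.represents_boundary_iff[OF z(2)] by blast
qed

lemma surj_mod_from_tor:
  assumes "\<And>z. z \<in> TB.tor_cycles i \<Longrightarrow> \<exists>w\<in>TA.tor_cycles i. z - (\<phi> \<circ> w) \<in> TB.tor_boundaries i"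
  shows "surj_mod i"
  unfolding surj_mod_def
proof
  fix b :: "'j \<Rightarrow> 'r" assume "b \<in> free_vecs (J i)"
  then obtain z where z: "z \<in> TB.tor_cycles i" "TB.represents i z b" by (rule TB.element_represented)
  then obtain w where w: "w \<in> TA.tor_cycles i" "z - (\<phi> \<circ> w) \<in> TB.tor_boundaries i"
    using assms by blast
  obtain a where a: "TA.represents i w a" using w(1) by (rule TA.cycle_represents)
  have "b - u i a \<in> vecs m (J i)"
    using TB.represents_boundary_iff[OF TB.represents_diff[OF z(2) represents_natural[OF a]]] w(2)
    by blast
  then show "\<exists>x\<in>free_vecs (I i). b - u i x \<in> vecs m (J i)"
    using a by (auto simp: TA.represents_def)
qed

end

section \<open>The vanishing conditions on Tor\<close>

lemma homology_class:
  "z \<in> chain_cycles C d i \<Longrightarrow>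
    chain_boundaries C d i #>\<^bsub>C i\<^esub> z \<in> carrier (homology C d i)"
  by (auto simp: homology_def FactGroup_def RCOSETS_def r_coset_def)

lemma homology_one: "\<one>\<^bsub>homology C d i\<^esub> = chain_boundaries C d i"
  by (simp add: homology_def FactGroup_def)

lemma zero_in_tensor_boundaries:
  assumes "module s"
  shows "0 \<in> tensor_boundaries s K i"
proof -
  have "0 \<in> vecs UNIV (basis K (Suc i))" by (simp add: vecs_def)
  with tensor_diff_zero[OF assms] show ?thesis unfolding tensor_boundaries_iff by blast
qed

lemma in_tensor_coset:
  assumes "module s"
  shows "z \<in> tensor_boundaries s K i #>\<^bsub>tensor_chain K i\<^esub> z"
  using zero_in_tensor_boundaries[OF assms]
  by (force simp: r_coset_def tensor_chain_def additive_group_def)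

text \<open>The vanishing of the maps between homology groups is brought to the level of cycles and
  boundaries of the complexes \<open>K \<otimes> M\<close>, \<open>K \<otimes> P\<close>, \<open>K \<otimes> N\<close>.\<close>
lemma tor_map_zeroD:
  assumes zero: "zero_map (Tor_k m s i) (Tor_k m t i) (Tor_k_map m t f i)"
    and "module s" "module t"
    and z: "z \<in> tensor_cycles s (residue_resolution m) i"
  shows "f \<circ> z \<in> tensor_boundaries t (residue_resolution m) i"
proof -
  let ?K = "residue_resolution m"
  let ?S = "tensor_boundaries s ?K i #>\<^bsub>tensor_chain ?K i\<^esub> z"
  let ?B = "tensor_boundaries t ?K i"
  have "Tor_k_map m t f i ?S = ?B"
    using zero homology_class[OF z] unfolding zero_map_def Tor_k_def homology_one by blast
  moreover have "0 \<otimes>\<^bsub>tensor_chain ?K i\<^esub> (f \<circ> z) \<in> Tor_k_map m t f i ?S"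
    unfolding Tor_k_map_def coset_map_def set_mult_def
    using in_tensor_coset[OF \<open>module s\<close>] zero_in_tensor_boundaries[OF \<open>module t\<close>] by blast
  moreover have "0 \<otimes>\<^bsub>tensor_chain ?K i\<^esub> (f \<circ> z) = f \<circ> z"
    by (simp add: tensor_chain_def additive_group_def)
  ultimately show ?thesis by simp
qed

text \<open>By exactness, a class of \<open>Tor\<^sub>i(k, M)\<close> that dies in \<open>Tor\<^sub>i(k, P)\<close> comes from the connecting map: if
  \<open>f \<circ> z\<close> is the boundary of \<open>y\<close>, then \<open>g \<circ> y\<close> is a cycle with the class of \<open>z\<close> as its image.\<close>
lemma tor_connecting_zeroD:
  assumes zero: "zero_map (Tor_k m sN (Suc i)) (Tor_k m sM i) (Tor_k_connecting m sM sP f g i)"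
    and se: "short_exact sM sP sN f g"
    and z: "z \<in> tensor_cycles sM (residue_resolution m) i"
    and fz: "f \<circ> z \<in> tensor_boundaries sP (residue_resolution m) i"
  shows "z \<in> tensor_boundaries sM (residue_resolution m) i"
proof -
  let ?K = "residue_resolution m"
  have g: "module_hom sP sN g" and N: "module sN" and gf: "\<And>x. g (f x) = 0"
    using se by (auto simp: short_exact_def module_hom_iff)
  obtain y where y: "y \<in> vecs UNIV (basis ?K (Suc i))" "tensor_diff sP ?K i y = f \<circ> z"
    using fz by (auto simp: tensor_boundaries_iff)
  have "tensor_diff sN ?K i (g \<circ> y) = 0"
    unfolding tensor_diff_natural[OF g, symmetric] y(2) by (auto simp: fun_eq_iff gf)
  moreover have "g \<circ> y \<in> vecs UNIV (basis ?K (Suc i))"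
    using vecs_comp[OF y(1), of g UNIV] hom_zero[OF g] by simp
  ultimately have gy: "g \<circ> y \<in> tensor_cycles sN ?K (Suc i)"
    by (auto simp: tensor_cycles_iff)
  let ?S = "tensor_boundaries sN ?K (Suc i) #>\<^bsub>tensor_chain ?K (Suc i)\<^esub> (g \<circ> y)"
  have "Tor_k_connecting m sM sP f g i ?S = tensor_boundaries sM ?K i"
    using zero homology_class[OF gy] unfolding zero_map_def Tor_k_def homology_one by blast
  moreover have "z \<in> Tor_k_connecting m sM sP f g i ?S"
    using z y in_tensor_coset[OF N]
    unfolding Tor_k_connecting_def connecting_map_def tensor_carrier by blast
  ultimately show ?thesis by simp
qed

text \<open>Exactness at \<open>Tor\<^sub>i(k, P)\<close>: the image of \<open>z\<close> in \<open>K \<otimes> N\<close> is a boundary, which lifts to a boundary of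
  \<open>K \<otimes> P\<close>, and the difference comes from \<open>K \<otimes> M\<close>.\<close>
lemma tor_map_zero_lift:
  assumes zero: "zero_map (Tor_k m sP i) (Tor_k m sN i) (Tor_k_map m sN g i)"
    and se: "short_exact sM sP sN f g"
    and K: "residue_field_resolution m (residue_resolution m) c"
    and z: "z \<in> tensor_cycles sP (residue_resolution m) i"
  shows "\<exists>w\<in>tensor_cycles sM (residue_resolution m) i.
    z - (f \<circ> w) \<in> tensor_boundaries sP (residue_resolution m) i"
proof -
  let ?K = "residue_resolution m"
  interpret residue_field_resolution m ?K c by fact
  have f: "module_hom sM sP f" and g: "module_hom sP sN g" and inj: "inj f"
    and range: "range f = {x. g x = 0}" and sur: "surj g" and M: "module sM" and P: "module sP" and N: "module sN"
    using se by (auto simp: short_exact_def module_hom_iff)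
  have zv: "z \<in> vecs UNIV {..<rk i}" and dz: "\<And>p. i = Suc p \<Longrightarrow> tensor_diff sP ?K p z = 0"
    using z by (auto simp: tensor_cycles_iff)
  obtain v where v: "v \<in> vecs UNIV {..<rk (Suc i)}" "tensor_diff sN ?K i v = g \<circ> z"
    using tor_map_zeroD[OF zero P N z] by (auto simp: tensor_boundaries_iff)
  obtain y where y: "y \<in> vecs UNIV {..<rk (Suc i)}" "g \<circ> y = v"
    using vecs_lift[where g = g and Y = UNIV, OF v(1)] hom_zero[OF g] sur by (metis UNIV_I surjD)
  let ?x = "z - tensor_diff sP ?K i y"
  have Dy: "tensor_diff sP ?K i y \<in> vecs UNIV {..<rk i}"
    by (rule tensor_diff_vecs[OF P module.subspace_UNIV[OF P] y(1)])
  have "?x \<in> vecs UNIV {..<rk i}"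
    using zv Dy by (auto simp: vecs_def)
  moreover have "g \<circ> ?x = 0"
  proof -
    have "g \<circ> ?x = (g \<circ> z) - (g \<circ> tensor_diff sP ?K i y)"
      by (auto simp: fun_eq_iff hom_diff[OF g])
    also have "\<dots> = 0" by (simp only: tensor_diff_natural[OF g] y(2) v(2) diff_self)
    finally show ?thesis .
  qed
  then have "\<exists>q\<in>UNIV. f q = ?x j" for j
    using range by (metis (mono_tags, lifting) UNIV_I comp_apply imageE mem_Collect_eq zero_fun_apply)
  ultimately obtain w where w: "w \<in> vecs UNIV {..<rk i}" "f \<circ> w = ?x"
    using vecs_lift[where g = f and x = ?x and Y = UNIV] hom_zero[OF f] by metis
  have "tensor_diff sM ?K p w = 0" if i: "i = Suc p" for p
  proof -
    have "f \<circ> tensor_diff sM ?K p w = tensor_diff sP ?K p ?x"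
      by (simp only: tensor_diff_natural[OF f] w(2))
    also have "\<dots> = 0"
      using dz[OF i] tensor_diff_square[OF P] i by (simp only: tensor_diff_diff[OF P] diff_self)
    finally have "f (tensor_diff sM ?K p w j) = f 0" for j
      using hom_zero[OF f] by (metis comp_apply zero_fun_apply)
    then show ?thesis using inj by (auto simp: fun_eq_iff dest: injD)
  qed
  then have "w \<in> tensor_cycles sM ?K i"
    using w(1) by (auto simp: tensor_cycles_iff)
  moreover have "z - (f \<circ> w) = tensor_diff sP ?K i y"
    by (simp only: w(2) diff_diff_eq2 add_diff_cancel_left')
  ultimately show ?thesis using y(1) by (auto simp: tensor_boundaries_iff intro!: bexI[of _ w])
qed

section \<open>The linear part and the vanishing of maps on Tor\<close>

lemma additive_coset: "Y #>\<^bsub>additive_group X\<^esub> x = (\<lambda>y. y + x) ` Y"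
  by (auto simp: r_coset_def additive_group_def)

lemma additive_set_mult: "A <#>\<^bsub>additive_group X\<^esub> B = {a + b |a b. a \<in> A \<and> b \<in> B}"
  by (auto simp: set_mult_def additive_group_def)

lemma translate_eq_iff:
  assumes Y: "vec.subspace Y"
  shows "(\<lambda>y. y + a) ` Y = (\<lambda>y. y + b) ` Y \<longleftrightarrow> a - b \<in> Y"
proof
  assume "(\<lambda>y. y + a) ` Y = (\<lambda>y. y + b) ` Y"
  moreover have "0 + a \<in> (\<lambda>y. y + a) ` Y" using vec.subspace_0[OF Y] by blast
  ultimately obtain y where "y \<in> Y" "0 + a = y + b" by blast
  then show "a - b \<in> Y" by (metis add_0 add_diff_cancel_right')
next
  assume ab: "a - b \<in> Y"
  have "y + a = (y + (a - b)) + b" "y + b = (y - (a - b)) + a" for y by simp_all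
  then show "(\<lambda>y. y + a) ` Y = (\<lambda>y. y + b) ` Y"
    using vec.subspace_add[OF Y _ ab] vec.subspace_diff[OF Y _ ab] by blast
qed

lemma translate_add:
  assumes Y: "vec.subspace Y"
  shows "{s + t |s t. s \<in> (\<lambda>y. y + a) ` Y \<and> t \<in> (\<lambda>y. y + b) ` Y} = (\<lambda>y. y + (a + b)) ` Y"
    (is "?L = ?R")
proof
  have "(y + a) + (z + b) = (y + z) + (a + b)" for y z by simp
  then show "?L \<subseteq> ?R" using vec.subspace_add[OF Y] by blast
  have "y + (a + b) = (y + a) + (0 + b)" for y by simp
  then show "?R \<subseteq> ?L" using vec.subspace_0[OF Y] by blast
qed

locale minimal_free_complex =
  fixes m :: "'r::comm_ring_1 set" and F :: "'r free_complex"
  assumes m: "is_ideal m"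
    and minimal: "\<And>i x. x \<in> fchain F (Suc i) \<Longrightarrow>
      free_diff F i x \<in> vecs m (basis F i)"
    and square: "\<And>i x. x \<in> fchain F (Suc (Suc i)) \<Longrightarrow>
      free_diff F i (free_diff F (Suc i) x) = 0"
begin

abbreviation filt :: "nat \<Rightarrow> nat \<Rightarrow> (nat \<Rightarrow> 'r) set" where
  "filt n i \<equiv> vecs (ideal_power m (n - i)) (basis F i)"

abbreviation chain :: "nat \<Rightarrow> (nat \<Rightarrow> 'r) set" where
  "chain i \<equiv> fchain F i"

lemma lin_filtration_eq: "lin_filtration m F n i = filt n i"
  by (simp add: lin_filtration_def carrier_free_chain ideal_smult_free)

lemma filt_subspace: "vec.subspace (filt n i)"
  by (rule vecs_subspace) simp

lemma diff_pow:
  "x \<in> vecs (ideal_power m n) (basis F (Suc i)) \<Longrightarrow>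
    free_diff F i x \<in> vecs (ideal_power m (Suc n)) (basis F i)"
  by (rule linear_map_vecs_Suc[OF tensor_diff_linear _ minimal]) auto

lemma diff_filt:
  assumes "x \<in> filt n (Suc i)" shows "free_diff F i x \<in> filt n i"
proof -
  have "n - i \<le> Suc (n - Suc i)" by simp
  from vecs_antimono_power[OF m this diff_pow[OF assms]] show ?thesis .
qed

definition coset :: "nat \<Rightarrow> nat \<Rightarrow> (nat \<Rightarrow> 'r) \<Rightarrow> (nat \<Rightarrow> 'r) set" where
  "coset n i x = (\<lambda>y. y + x) ` filt (Suc n) i"

lemma coset_eq_iff: "coset n i a = coset n i b \<longleftrightarrow> a - b \<in> filt (Suc n) i"
  unfolding coset_def by (rule translate_eq_iff[OF filt_subspace])

lemma coset_zero: "coset n i 0 = filt (Suc n) i"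
  by (simp add: coset_def)

lemma lin_chain_carrier: "carrier (lin_chain m F n i) = coset n i ` filt n i"
  by (auto simp: lin_chain_def FactGroup_def RCOSETS_def lin_filtration_eq additive_coset coset_def)
    (auto simp: additive_group_def)

lemma lin_chain_one: "\<one>\<^bsub>lin_chain m F n i\<^esub> = coset n i 0"
  by (simp add: lin_chain_def FactGroup_def lin_filtration_eq coset_zero)

lemma lin_chain_mult: "coset n i a \<otimes>\<^bsub>lin_chain m F n i\<^esub> coset n i b = coset n i (a + b)"
  unfolding lin_chain_def coset_def
  by (simp only: mult_FactGroup additive_set_mult translate_add[OF filt_subspace])

text \<open>The induced map adds the whole subgroup \<open>filt (Suc n) i\<close>, which absorbs the image under the
  differential of \<open>filt (Suc n) (Suc i)\<close>.\<close>
lemma lin_diff_coset: "lin_diff m F n i (coset n (Suc i) x) = coset n i (free_diff F i x)"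
proof -
  let ?d = "free_diff F i"
  have "{a + b |a b. a \<in> filt (Suc n) i \<and> b \<in> ?d ` coset n (Suc i) x} = coset n i (?d x)" (is "?L = ?R")
  proof
    have "a + ?d (y + x) \<in> ?R" if "a \<in> filt (Suc n) i" "y \<in> filt (Suc n) (Suc i)" for a y
    proof -
      have "a + ?d y \<in> filt (Suc n) i"
        by (rule vec.subspace_add[OF filt_subspace that(1) diff_filt[OF that(2)]])
      moreover have "a + ?d (y + x) = (a + ?d y) + ?d x"
        by (simp only: hom_add[OF tensor_diff_linear] add.assoc)
      ultimately show ?thesis unfolding coset_def by blast
    qed
    then show "?L \<subseteq> ?R" unfolding coset_def[of n "Suc i"] by blast
    have "0 + x \<in> coset n (Suc i) x"
      unfolding coset_def using vec.subspace_0[OF filt_subspace] by blast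
    then have "?d x \<in> ?d ` coset n (Suc i) x" by simp
    then show "?R \<subseteq> ?L" unfolding coset_def[of n i] by blast
  qed
  then show ?thesis
    unfolding lin_diff_def coset_map_def lin_filtration_eq additive_set_mult .
qed

lemma lin_cycles:
  "chain_cycles (lin_chain m F n) (lin_diff m F n) (Suc i) =
    coset n (Suc i) ` {x \<in> filt n (Suc i). free_diff F i x \<in> filt (Suc n) i}"
proof -
  have "{S \<in> f ` A. P S} = f ` {x \<in> A. P (f x)}" for f :: "(nat \<Rightarrow> 'r) \<Rightarrow> (nat \<Rightarrow> 'r) set" and A P
    by blast
  then show ?thesis
    unfolding chain_cycles_def kernel_def nat.case lin_chain_carrier lin_chain_one
    by (simp only: lin_diff_coset coset_eq_iff diff_zero)
qed

lemma lin_boundaries: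
  "chain_boundaries (lin_chain m F n) (lin_diff m F n) i = (\<lambda>y. coset n i (free_diff F i y)) ` filt n (Suc i)"
  by (auto simp: chain_boundaries_def lin_chain_carrier lin_diff_coset image_image)

text \<open>Exactness of the linear part at \<open>F\<^sub>i\<^sub>+\<^sub>1\<close> in filtration degree \<open>n\<close>, on representatives.\<close>
definition lin_exact :: "nat \<Rightarrow> nat \<Rightarrow> bool" where
  "lin_exact n i \<longleftrightarrow> (\<forall>x\<in>filt n (Suc i). free_diff F i x \<in> filt (Suc n) i \<longrightarrow>
    (\<exists>y\<in>filt n (Suc (Suc i)). x - free_diff F (Suc i) y \<in> filt (Suc n) (Suc i)))"

lemma lin_homology_trivial_iff:
  "carrier (lin_homology m F n (Suc i)) = {\<one>\<^bsub>lin_homology m F n (Suc i)\<^esub>} \<longleftrightarrow> lin_exact n i"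
proof -
  let ?Z = "chain_cycles (lin_chain m F n) (lin_diff m F n) (Suc i)"
  let ?B = "chain_boundaries (lin_chain m F n) (lin_diff m F n) (Suc i)"
  let ?mul = "\<lambda>S. (\<lambda>T. T \<otimes>\<^bsub>lin_chain m F n (Suc i)\<^esub> S) ` ?B"
  let ?d = "free_diff F (Suc i)"
  have hom: "carrier (lin_homology m F n (Suc i)) = ?mul ` ?Z" "\<one>\<^bsub>lin_homology m F n (Suc i)\<^esub> = ?B"
    by (auto simp: lin_homology_def homology_def FactGroup_def RCOSETS_def r_coset_def)
  have mul: "?mul (coset n (Suc i) x) = (\<lambda>y. coset n (Suc i) (?d y + x)) ` filt n (Suc (Suc i))" for x
    by (simp only: lin_boundaries image_image lin_chain_mult)
  have zero: "0 \<in> filt k l" for k l using vec.subspace_0[OF filt_subspace] .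
  have d0: "free_diff F k 0 = 0" for k by (rule hom_zero[OF tensor_diff_linear])
  show ?thesis
  proof
    assume triv: "carrier (lin_homology m F n (Suc i)) = {\<one>\<^bsub>lin_homology m F n (Suc i)\<^esub>}"
    have mulB: "?mul S = ?B" if "S \<in> ?Z" for S
      using imageI[OF that, of ?mul] triv by (simp only: hom singleton_iff)
    show "lin_exact n i"
      unfolding lin_exact_def
    proof (intro ballI impI)
      fix x assume "x \<in> filt n (Suc i)" "free_diff F i x \<in> filt (Suc n) i"
      then have "coset n (Suc i) x \<in> ?Z" unfolding lin_cycles by blast
      then have "?mul (coset n (Suc i) x) = ?B" by (rule mulB)
      moreover have "coset n (Suc i) (?d 0 + x) \<in> ?mul (coset n (Suc i) x)"
        unfolding mul using zero by blast
      ultimately have "coset n (Suc i) x \<in> ?B" by (simp only: d0 add_0)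
      then obtain y where "y \<in> filt n (Suc (Suc i))" "coset n (Suc i) x = coset n (Suc i) (?d y)"
        unfolding lin_boundaries by blast
      then show "\<exists>y\<in>filt n (Suc (Suc i)). x - ?d y \<in> filt (Suc n) (Suc i)"
        unfolding coset_eq_iff by blast
    qed
  next
    assume ex: "lin_exact n i"
    have "?mul S = ?B" if S: "S \<in> ?Z" for S
    proof -
      obtain x where x: "x \<in> filt n (Suc i)" "free_diff F i x \<in> filt (Suc n) i" "S = coset n (Suc i) x"
        using S unfolding lin_cycles by blast
      then obtain y where y: "y \<in> filt n (Suc (Suc i))" "x - ?d y \<in> filt (Suc n) (Suc i)"
        using ex unfolding lin_exact_def by blast
      have Sy: "S = coset n (Suc i) (?d y)" using y(2) unfolding x(3) coset_eq_iff .
      have "?mul S = (\<lambda>z. coset n (Suc i) (?d (z + y))) ` filt n (Suc (Suc i))"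
        unfolding Sy mul by (simp only: hom_add[OF tensor_diff_linear])
      also have "\<dots> = (\<lambda>z. coset n (Suc i) (?d z)) ` ((\<lambda>z. z + y) ` filt n (Suc (Suc i)))"
        by (simp only: image_image)
      also have "(\<lambda>z. z + y) ` filt n (Suc (Suc i)) = filt n (Suc (Suc i))"
        using translate_eq_iff[OF filt_subspace, of y n "Suc (Suc i)" 0] y(1) by simp
      finally show ?thesis unfolding lin_boundaries .
    qed
    then have "?mul ` ?Z = (\<lambda>_. ?B) ` ?Z" by (rule image_cong[OF refl])
    moreover have "0 \<in> {x \<in> filt n (Suc i). free_diff F i x \<in> filt (Suc n) i}"
      using zero by (simp only: mem_Collect_eq d0 simp_thms)
    then have "coset n (Suc i) 0 \<in> ?Z"
      unfolding lin_cycles by (rule imageI)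
    ultimately show "carrier (lin_homology m F n (Suc i)) = {\<one>\<^bsub>lin_homology m F n (Suc i)\<^esub>}"
      unfolding hom by (simp only: image_constant)
  qed
qed

text \<open>Exactness of the linear part improves an approximation of \<open>x\<close> by a boundary by one power of
  \<open>m\<close> at a time.\<close>
lemma lin_exact_imp_shift:
  assumes ex: "\<And>n. lin_exact n i"
  shows "tor_shift_zero m (basis F) (free_diff F) i"
proof -
  let ?d = "free_diff F"
  have "\<exists>y\<in>chain (Suc (Suc i)). x - ?d (Suc i) y \<in> vecs (ideal_power m n) (basis F (Suc i))"
    if "x \<in> chain (Suc i)" "?d i x \<in> vecs (ideal_power m (Suc n)) (basis F i)" for n x
    using that
  proof (induction n)
    case 0
    have "?d (Suc i) 0 = 0" by (rule hom_zero[OF tensor_diff_linear])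
    then have "x - ?d (Suc i) 0 \<in> vecs (ideal_power m 0) (basis F (Suc i))"
      using 0 by simp
    moreover have "0 \<in> chain (Suc (Suc i))" by (rule vecs_zero) simp
    ultimately show ?case by blast
  next
    case (Suc n)
    have "?d i x \<in> vecs (ideal_power m (Suc n)) (basis F i)"
      by (rule vecs_antimono_power[OF m _ Suc.prems(2)]) simp
    from Suc.IH[OF Suc.prems(1) this] obtain y where y: "y \<in> chain (Suc (Suc i))"
      and z: "x - ?d (Suc i) y \<in> vecs (ideal_power m n) (basis F (Suc i))"
      by blast
    let ?z = "x - ?d (Suc i) y"
    have "?d i ?z = ?d i x"
      by (simp add: hom_diff[OF tensor_diff_linear] square[OF y])
    then have "?d i ?z \<in> filt (Suc (n + Suc i)) i"
      using Suc.prems(2) by (simp del: ideal_power.simps)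
    moreover have "?z \<in> filt (n + Suc i) (Suc i)" using z by simp
    ultimately obtain w where w: "w \<in> filt (n + Suc i) (Suc (Suc i))"
      "?z - ?d (Suc i) w \<in> filt (Suc (n + Suc i)) (Suc i)"
      using ex[of "n + Suc i"] unfolding lin_exact_def by blast
    have "x - ?d (Suc i) (y + w) = ?z - ?d (Suc i) w"
      by (simp only: hom_add[OF tensor_diff_linear] diff_diff_eq)
    moreover have "Suc (n + Suc i) - Suc i = Suc n" by simp
    ultimately have "x - ?d (Suc i) (y + w) \<in> vecs (ideal_power m (Suc n)) (basis F (Suc i))"
      using w(2) by (simp only:)
    moreover have "y + w \<in> chain (Suc (Suc i))"
      by (intro vecs_add ideal_UNIV y vecs_free[OF w(1)])
    ultimately show ?case by blast
  qed
  then show ?thesis unfolding tor_shift_zero_def by blast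
qed

text \<open>Conversely, a boundary that approximates \<open>x\<close> has to be replaced by one coming from the right
  step of the filtration; this uses the condition in the next degree.\<close>
lemma shift_imp_lin_exact:
  assumes S: "tor_shift_zero m (basis F) (free_diff F) i"
    and S': "tor_shift_zero m (basis F) (free_diff F) (Suc i)"
  shows "lin_exact n i"
  unfolding lin_exact_def
proof (intro ballI impI)
  let ?d = "free_diff F"
  fix x assume x: "x \<in> filt n (Suc i)" and dx: "?d i x \<in> filt (Suc n) i"
  have zero: "(0 :: nat \<Rightarrow> 'r) \<in> vecs (ideal_power m k) L" for k L by (rule vecs_zero) simp
  have d0: "?d k 0 = 0" for k by (rule hom_zero[OF tensor_diff_linear])
  show "\<exists>y\<in>filt n (Suc (Suc i)). x - ?d (Suc i) y \<in> filt (Suc n) (Suc i)"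
  proof (cases "n < Suc i")
    case True
    then have "x - ?d (Suc i) 0 \<in> filt (Suc n) (Suc i)" using x d0 by simp
    then show ?thesis using zero by blast
  next
    case False
    then obtain q where n: "n = q + Suc i" by (metis add.commute le_Suc_ex linorder_not_less)
    have xq: "x \<in> vecs (ideal_power m q) (basis F (Suc i))" using x n by simp
    have "?d i x \<in> vecs (ideal_power m (Suc (Suc q))) (basis F i)"
      using dx n by (simp del: ideal_power.simps)
    then obtain y where y: "y \<in> chain (Suc (Suc i))"
      and z: "x - ?d (Suc i) y \<in> vecs (ideal_power m (Suc q)) (basis F (Suc i))"
      using S vecs_free[OF x] unfolding tor_shift_zero_def by blast
    have "\<exists>w\<in>vecs (ideal_power m (q - 1)) (basis F (Suc (Suc i))). ?d (Suc i) w = ?d (Suc i) y"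
    proof (cases q)
      case 0
      then have "y \<in> vecs (ideal_power m (q - 1)) (basis F (Suc (Suc i)))" using y by simp
      then show ?thesis by blast
    next
      case (Suc r)
      have "?d (Suc i) y = x - (x - ?d (Suc i) y)" by simp
      moreover have "x - (x - ?d (Suc i) y) \<in> vecs (ideal_power m q) (basis F (Suc i))"
        using xq z by (intro vecs_diff ideal_power_ideal vecs_antimono_power[OF m _ z]) auto
      ultimately have "?d (Suc i) y \<in> vecs (ideal_power m (Suc r)) (basis F (Suc i))"
        using Suc by (simp only:)
      then obtain t where t: "t \<in> chain (Suc (Suc (Suc i)))"
        "y - ?d (Suc (Suc i)) t \<in> vecs (ideal_power m r) (basis F (Suc (Suc i)))"
        using S' y unfolding tor_shift_zero_def by blast
      have "?d (Suc i) (y - ?d (Suc (Suc i)) t) = ?d (Suc i) y"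
        by (simp add: hom_diff[OF tensor_diff_linear] square[OF t(1)])
      moreover have "q - 1 = r" using Suc by simp
      ultimately show ?thesis using t(2) by metis
    qed
    then obtain w where "w \<in> vecs (ideal_power m (q - 1)) (basis F (Suc (Suc i)))"
      "?d (Suc i) w = ?d (Suc i) y" by blast
    moreover have "q - 1 = n - Suc (Suc i)" "Suc q = Suc n - Suc i" using n by auto
    ultimately show ?thesis using z by metis
  qed
qed

lemma shift_above_lin_sup:
  assumes "lin_sup m F \<le> enat i"
  shows "tor_shift_zero m (basis F) (free_diff F) i"
proof (rule lin_exact_imp_shift, rule ccontr)
  fix n assume "\<not> lin_exact n i"
  then have "enat (Suc i) \<le> lin_sup m F"
    unfolding lin_sup_def by (intro Sup_upper imageI CollectI exI[of _ n]) (simp only: lin_homology_trivial_iff not_False_eq_True)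
  with assms show False by (metis Suc_n_not_le_n enat_ord_simps(1) order_trans)
qed

lemma lin_sup_le:
  assumes "\<And>j. i \<le> j \<Longrightarrow> tor_shift_zero m (basis F) (free_diff F) j"
  shows "lin_sup m F \<le> enat i"
  unfolding lin_sup_def
proof (rule Sup_least, clarify)
  fix k n assume ne: "carrier (lin_homology m F n k) \<noteq> {\<one>\<^bsub>lin_homology m F n k\<^esub>}"
  show "enat k \<le> enat i"
  proof (rule ccontr)
    assume "\<not> enat k \<le> enat i"
    then obtain j where "k = Suc j" "i \<le> j" by (cases k) auto
    then show False
      using ne lin_homology_trivial_iff shift_imp_lin_exact[OF assms assms] by simp
  qed
qed

end

section \<open>Existence of free resolutions\<close>

lemma lin_comb_hom:
  fixes c :: nat
  assumes "module s"
  shows "module_hom vscale s (\<lambda>y. \<Sum>l<c. s (y l) (g l))"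
proof -
  interpret module s by fact
  show ?thesis
    by (rule module_homI)
      (auto simp: vec.module_axioms module_axioms scale_left_distrib sum.distrib scale_sum_right)
qed

lemma lin_comb_span:
  fixes c :: nat
  assumes "module s"
  shows "(\<lambda>y. \<Sum>l<c. s (y l) (g l)) ` free_vecs {..<c} = module.span s (g ` {..<c})"
proof -
  interpret module s by fact
  let ?f = "\<lambda>y. \<Sum>l<c. s (y l) (g l)"
  have "vec.span (unit_vec ` {..<c}) = (free_vecs {..<c} :: (nat \<Rightarrow> 'a) set)"
  proof
    show "vec.span (unit_vec ` {..<c}) \<subseteq> (free_vecs {..<c} :: (nat \<Rightarrow> 'a) set)"
      by (rule vec.span_minimal[OF _ vecs_subspace]) (auto simp: unit_vec_free)
    show "(free_vecs {..<c} :: (nat \<Rightarrow> 'a) set) \<subseteq> vec.span (unit_vec ` {..<c})"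
    proof
      fix x :: "nat \<Rightarrow> 'a" assume x: "x \<in> free_vecs {..<c}"
      have "(\<Sum>l<c. vscale (x l) (unit_vec l)) \<in> vec.span (unit_vec ` {..<c})"
        by (intro vec.span_sum vec.span_scale vec.span_base imageI)
      then show "x \<in> vec.span (unit_vec ` {..<c})"
        using vec_expansion[OF finite_lessThan x] by simp
    qed
  qed
  moreover have "?f (unit_vec l) = g l" if "l < c" for l
  proof -
    have "?f (unit_vec l) = (\<Sum>k<c. if k = l then g k else 0)"
      by (intro sum.cong) (auto simp: unit_vec_def)
    then show ?thesis using that by simp
  qed
  then have "?f ` unit_vec ` {..<c} = g ` {..<c}" by (auto simp: image_image)
  ultimately show ?thesis
    using module_hom.span_image[OF lin_comb_hom[OF assms, where c = c and g = g], of "unit_vec ` {..<c}"] by simp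
qed

text \<open>Induction on the rank: the last coordinates of a submodule form an ideal, and the elements with
  last coordinate zero form a submodule of smaller rank.\<close>
lemma submodule_finitely_generated:
  assumes noeth: "\<And>A :: 'r::comm_ring_1 set. is_ideal A \<Longrightarrow> \<exists>B. finite B \<and> A = module.span (*) B"
    and "vec.subspace W" "W \<subseteq> free_vecs {..<b :: nat}"
  shows "\<exists>A. finite A \<and> W = (vec.span A :: (nat \<Rightarrow> 'r) set)"
  using assms(2-)
proof (induction b arbitrary: W)
  case 0
  have "W \<subseteq> {0}"
  proof
    fix x assume "x \<in> W"
    with 0 have "x \<in> free_vecs {}" by auto
    then show "x \<in> {0}" by (auto simp: vecs_def)
  qed
  then have "W = vec.span {}" using vec.subspace_0[OF 0(1)] by auto
  then show ?case by blast
next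
  case (Suc b)
  let ?f = "\<lambda>x :: nat \<Rightarrow> 'r. x b"
  have f: "module_hom vscale (*) ?f"
    by (rule module_homI) (auto simp: module_mult vec.module_axioms)
  have "is_ideal (?f ` W)"
    unfolding is_ideal_def by (rule module_hom.subspace_image[OF f Suc.prems(1)])
  then obtain B where B: "finite B" "?f ` W = module.span (*) B"
    using noeth by blast
  then have "B \<subseteq> ?f ` W" using module.span_superset[OF module_mult] by blast
  then obtain B' where B': "B' \<subseteq> W" "finite B'" "B = ?f ` B'"
    using finite_subset_image[OF B(1)] by blast
  let ?W' = "{x \<in> W. x b = 0}"
  have W': "vec.subspace ?W'"
    by (rule vec.subspaceI)
      (use vec.subspace_0[OF Suc.prems(1)] vec.subspace_add[OF Suc.prems(1)]
        vec.subspace_scale[OF Suc.prems(1)] in simp_all)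
  moreover have "?W' \<subseteq> free_vecs {..<b}"
  proof
    fix x assume x: "x \<in> ?W'"
    then have "x \<in> free_vecs {..<Suc b}" "x b = 0" using Suc.prems(2) by auto
    then show "x \<in> free_vecs {..<b}" by (auto simp: vecs_def less_Suc_eq split: if_splits)
  qed
  ultimately obtain A where A: "finite A" "?W' = vec.span A" using Suc.IH by blast
  have "W = vec.span (A \<union> B')"
  proof
    have "A \<subseteq> W" using A(2) vec.span_superset by blast
    then show "vec.span (A \<union> B') \<subseteq> W"
      using B'(1) by (intro vec.span_minimal Suc.prems(1)) simp
    show "W \<subseteq> vec.span (A \<union> B')"
    proof
      fix x assume x: "x \<in> W"
      have "x b \<in> ?f ` vec.span B'"
        using x B(2) B'(3) module_hom.span_image[OF f, of B'] by blast
      then obtain y where y: "y \<in> vec.span B'" "x b = y b" by blast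
      have "vec.span B' \<subseteq> W" using B'(1) Suc.prems(1) by (rule vec.span_minimal)
      then have "x - y \<in> ?W'" using x y vec.subspace_diff[OF Suc.prems(1)] by auto
      then have "x - y \<in> vec.span (A \<union> B')"
        using A(2) vec.span_mono[of A "A \<union> B'"] by blast
      moreover have "y \<in> vec.span (A \<union> B')"
        using y(1) vec.span_mono[of B' "A \<union> B'"] by blast
      ultimately have "(x - y) + y \<in> vec.span (A \<union> B')" by (rule vec.span_add)
      then show "x \<in> vec.span (A \<union> B')" by simp
    qed
  qed
  then show ?case using A(1) B'(2) by blast
qed

abbreviation relations :: "('r::comm_ring_1 \<Rightarrow> 'm::ab_group_add \<Rightarrow> 'm) \<Rightarrow> nat \<Rightarrow> (nat \<Rightarrow> 'm) \<Rightarrow> (nat \<Rightarrow> 'r) set" where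
  "relations s c g \<equiv> {y \<in> free_vecs {..<c}. (\<Sum>l<c. s (y l) (g l)) = 0}"

lemma relations_subspace: "module s \<Longrightarrow> vec.subspace (relations s c g)"
  using vec.subspace_inter[OF vecs_subspace[OF ideal_UNIV] module_hom.subspace_kernel[OF lin_comb_hom]]
  unfolding Collect_conj_eq Collect_mem_eq .

abbreviation diff_kernel :: "'r::comm_ring_1 free_complex \<Rightarrow> nat \<Rightarrow> (nat \<Rightarrow> 'r) set" where
  "diff_kernel F i \<equiv> {y \<in> fchain F (Suc i). free_diff F i y = 0}"

text \<open>A resolution arises by repeatedly choosing generators \<open>g\<close> of a module of relations \<open>Z\<close>, the columns
  of the next differential. \<open>Good\<close> is an invariant of the modules of relations, and \<open>H\<close> a property of
  the choices. The function \<open>\<delta>\<close> stands for the degrees of the basis vectors in the graded situation.\<close>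
lemma resolution_by_steps:
  fixes Good :: "nat \<Rightarrow> (nat \<Rightarrow> int) \<Rightarrow> (nat \<Rightarrow> 'r::comm_ring_1) set \<Rightarrow> bool"
  assumes start: "Good b0 \<delta>0 Z0"
    and step: "\<And>b \<delta> Z. Good b \<delta> Z \<Longrightarrow> \<exists>c \<delta>' g. (\<forall>l<c. g l \<in> free_vecs {..<b}) \<and>
      vec.span (g ` {..<c}) = Z \<and> H b \<delta> c \<delta>' g \<and>
      Good c \<delta>' (relations vscale c g)"
  obtains F :: "'r free_complex" and \<delta> where
    "free_rank F 0 = b0" "\<delta> 0 = \<delta>0"
    "free_diff F 0 ` fchain F (Suc 0) = Z0"
    "\<And>i. diff_kernel F i =
      free_diff F (Suc i) ` fchain F (Suc (Suc i))"
    "\<And>i. Good (free_rank F (Suc i)) (\<delta> (Suc i)) (diff_kernel F i)"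
    "\<And>i. H (free_rank F i) (\<delta> i) (free_rank F (Suc i)) (\<delta> (Suc i)) (\<lambda>l j. diff_mat F i j l)"
proof -
  define P where "P n \<sigma> \<longleftrightarrow> (case \<sigma> of (b, \<delta>, Z) \<Rightarrow> Good b \<delta> Z \<and> (n = 0 \<longrightarrow> \<sigma> = (b0, \<delta>0, Z0)))"
    for n :: nat and \<sigma>
  define St where "St \<sigma> \<sigma>' g \<longleftrightarrow> (case \<sigma> of (b, \<delta>, Z) \<Rightarrow> case \<sigma>' of (c, \<delta>', Z') \<Rightarrow>
      (\<forall>l<c. g l \<in> free_vecs {..<b}) \<and> vec.span (g ` {..<c}) = Z \<and> H b \<delta> c \<delta>' g \<and>
      Z' = relations vscale c g)" for \<sigma> \<sigma>' g
  have "\<exists>\<sigma>'. P (Suc n) \<sigma>' \<and> (\<exists>g. St \<sigma> \<sigma>' g)" if "P n \<sigma>" for n \<sigma>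
  proof -
    obtain b \<delta> Z where \<sigma>: "\<sigma> = (b, \<delta>, Z)" by (cases \<sigma>)
    then have "Good b \<delta> Z" using that by (simp add: P_def)
    from step[OF this] obtain c \<delta>' g where "\<forall>l<c. g l \<in> free_vecs {..<b}"
      "vec.span (g ` {..<c}) = Z" "H b \<delta> c \<delta>' g"
      "Good c \<delta>' (relations vscale c g)" by blast
    then show ?thesis
      by (intro exI[of _ "(c, \<delta>', (relations vscale c g))"])
        (auto simp: P_def St_def \<sigma>)
  qed
  moreover have "\<exists>\<sigma>. P 0 \<sigma>" using start by (auto simp: P_def)
  ultimately obtain \<sigma> where \<sigma>: "\<And>n. P n (\<sigma> n)" "\<And>n. \<exists>g. St (\<sigma> n) (\<sigma> (Suc n)) g"
    using dependent_nat_choice[of P "\<lambda>_ \<sigma> \<sigma>'. \<exists>g. St \<sigma> \<sigma>' g"] by blast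
  then obtain g where g: "\<And>n. St (\<sigma> n) (\<sigma> (Suc n)) (g n)" by metis
  define b where "b n = fst (\<sigma> n)" for n
  define \<delta> where "\<delta> n = fst (snd (\<sigma> n))" for n
  define Z where "Z n = snd (snd (\<sigma> n))" for n
  have st: "\<sigma> n = (b n, \<delta> n, Z n)" for n by (simp add: b_def \<delta>_def Z_def)
  have b: "l < b (Suc n) \<Longrightarrow> g n l \<in> free_vecs {..<b n}"
    and sp: "vec.span (g n ` {..<b (Suc n)}) = Z n"
    and H: "H (b n) (\<delta> n) (b (Suc n)) (\<delta> (Suc n)) (g n)"
    and ker: "Z (Suc n) = {y \<in> free_vecs {..<b (Suc n)}. (\<Sum>l<b (Suc n). vscale (y l) (g n l)) = 0}" for n l
    using g[of n] by (auto simp: St_def st)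
  have good: "Good (b n) (\<delta> n) (Z n)" for n using \<sigma>(1)[of n] by (auto simp: P_def st)
  have s0: "\<sigma> 0 = (b0, \<delta>0, Z0)" using \<sigma>(1)[of 0] by (auto simp: P_def st)
  define F :: "'r free_complex" where "F = \<lparr>free_rank = b, diff_mat = (\<lambda>i j l. g i l j)\<rparr>"
  have rank: "free_rank F = b" and mat: "diff_mat F = (\<lambda>i j l. g i l j)" by (simp_all add: F_def)
  have diff: "free_diff F i y = (\<Sum>l<b (Suc i). vscale (y l) (g i l))" for i y
  proof
    fix j
    have "g i l j = 0" if "l < b (Suc i)" "\<not> j < b i" for l
      using vecs_off[OF b[OF that(1)]] that(2) by simp
    then show "free_diff F i y j = (\<Sum>l<b (Suc i). vscale (y l) (g i l)) j"
      by (simp add: tensor_diff_def rank mat sum_fun_apply mult.commute)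
  qed
  have Z: "free_diff F i ` fchain F (Suc i) = Z i" for i
    unfolding diff rank lin_comb_span[OF vec.module_axioms] by (rule sp)
  have kerZ: "diff_kernel F i = Z (Suc i)" for i
    unfolding diff rank ker ..
  show thesis
  proof (rule that[of F \<delta>])
    show "free_rank F 0 = b0" "\<delta> 0 = \<delta>0"
      using s0 by (simp_all add: rank b_def \<delta>_def)
    have "Z 0 = Z0" using s0 by (simp add: Z_def)
    then show "free_diff F 0 ` fchain F (Suc 0) = Z0"
      unfolding Z .
    show "diff_kernel F i =
      free_diff F (Suc i) ` fchain F (Suc (Suc i))" for i
      unfolding Z kerZ ..
    show "Good (free_rank F (Suc i)) (\<delta> (Suc i)) (diff_kernel F i)" for i
      unfolding kerZ unfolding rank by (rule good)
    show "H (free_rank F i) (\<delta> i) (free_rank F (Suc i)) (\<delta> (Suc i)) (\<lambda>l j. diff_mat F i j l)" for i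
      unfolding rank mat by (rule H)
  qed
qed

lemma carrier_additive: "carrier (additive_group UNIV) = UNIV"
  by (simp add: additive_group_def)

lemma free_resolutionI:
  assumes s: "module s" and gen: "module.span s (g ` (basis F 0)) = UNIV"
    and Z: "free_diff F 0 ` fchain F (Suc 0) =
      relations s (free_rank F 0) g"
    and exact: "\<And>i. diff_kernel F i =
      free_diff F (Suc i) ` fchain F (Suc (Suc i))"
  shows "free_resolution (additive_group UNIV) s F (\<lambda>y. \<Sum>l<free_rank F 0. s (y l) (g l))"
proof -
  let ?e = "\<lambda>y. \<Sum>l<free_rank F 0. s (y l) (g l)"
  have e: "module_hom vscale s ?e" by (rule lin_comb_hom[OF s])
  show ?thesis
    unfolding free_resolution_def vec_scale_eq carrier_free_chain carrier_additive
  proof (intro conjI allI ballI)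
    show "?e \<in> hom (free_chain F 0) (additive_group UNIV)"
      by (rule homI)
        (simp_all add: tensor_chain_def additive_group_def module.scale_left_distrib[OF s] sum.distrib)
    show "?e (vscale a v) = s a (?e v)" for a v by (rule hom_scale[OF e])
    show "?e ` fchain F 0 = UNIV" unfolding lin_comb_span[OF s] by (rule gen)
    show "kernel (free_chain F 0) (additive_group UNIV) ?e = chain_boundaries (free_chain F) (free_diff F) 0"
      unfolding kernel_def chain_boundaries_def carrier_free_chain Z by (simp add: additive_group_def)
    show "chain_cycles (free_chain F) (free_diff F) (Suc i) = chain_boundaries (free_chain F) (free_diff F) (Suc i)" for i
      unfolding chain_boundaries_def carrier_free_chain exact[symmetric] by (auto simp: tensor_cycles_iff)
  qed
qed

lemma free_resolution_exact:
  assumes "free_resolution Q act F e"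
  shows "x \<in> fchain F (Suc i) \<Longrightarrow> free_diff F i x = 0 \<Longrightarrow>
      \<exists>y\<in>fchain F (Suc (Suc i)). free_diff F (Suc i) y = x"
    and "x \<in> fchain F (Suc (Suc i)) \<Longrightarrow> free_diff F i (free_diff F (Suc i) x) = 0"
proof -
  have eq: "chain_cycles (free_chain F) (free_diff F) (Suc i) =
      chain_boundaries (free_chain F) (free_diff F) (Suc i)"
    using assms unfolding free_resolution_def by blast
  show "\<exists>y\<in>fchain F (Suc (Suc i)). free_diff F (Suc i) y = x"
    if "x \<in> fchain F (Suc i)" "free_diff F i x = 0"
  proof -
    have "x \<in> chain_cycles (free_chain F) (free_diff F) (Suc i)"
      using that by (simp add: tensor_cycles_iff)
    then show ?thesis unfolding eq tensor_boundaries_iff .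
  qed
  show "free_diff F i (free_diff F (Suc i) x) = 0"
    if "x \<in> fchain F (Suc (Suc i))"
  proof -
    have "free_diff F (Suc i) x \<in> chain_boundaries (free_chain F) (free_diff F) (Suc i)"
      using that unfolding tensor_boundaries_iff by blast
    then show ?thesis unfolding eq[symmetric] tensor_cycles_iff by blast
  qed
qed

text \<open>The augmentation of a \<open>free_resolution\<close> is only constrained on the free module, and is
  replaced by the linear map that agrees with it there.\<close>
lemma resolution_of_free_resolution:
  assumes s: "module s" and F: "free_resolution (additive_group UNIV) s F e"
  obtains e' where "resolution s (basis F) (free_diff F) e'"
proof -
  let ?V = "fchain F 0 :: (nat \<Rightarrow> 'a) set"
  have hom: "e \<in> hom (free_chain F 0) (additive_group UNIV)"
    and sc: "\<And>a v. v \<in> ?V \<Longrightarrow> e (vscale a v) = s a (e v)"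
    and onto: "e ` ?V = UNIV"
    and ker: "kernel (free_chain F 0) (additive_group UNIV) e = chain_boundaries (free_chain F) (free_diff F) 0"
    using F unfolding free_resolution_def vec_scale_eq carrier_free_chain carrier_additive by blast+
  have add: "e (x + y) = e x + e y" if "x \<in> ?V" "y \<in> ?V" for x y
    using hom_mult[OF hom] that by (simp add: carrier_free_chain) (simp add: tensor_chain_def additive_group_def)
  interpret module s by fact
  define e' where "e' y = (\<Sum>l<free_rank F 0. s (y l) (e (unit_vec l)))" for y
  have e': "module_hom vscale s e'" unfolding e'_def by (rule lin_comb_hom[OF s])
  have zero: "0 \<in> ?V" by (rule vecs_zero) simp
  have e0: "e 0 = 0" using add[OF zero zero] by simp
  have "e (\<Sum>l\<in>L. vscale (y l) (unit_vec l)) = (\<Sum>l\<in>L. s (y l) (e (unit_vec l)))"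
    if "L \<subseteq> (basis F 0)" for L y
    using finite_subset[OF that finite_lessThan] that
  proof (induction L)
    case (insert l L)
    have "vscale (y l) (unit_vec l) \<in> ?V" "(\<Sum>l\<in>L. vscale (y l) (unit_vec l)) \<in> ?V" "unit_vec l \<in> ?V"
      using insert.prems by (auto intro!: vecs_scale vecs_sum unit_vec_free)
    moreover have "e (\<Sum>l\<in>L. vscale (y l) (unit_vec l)) = (\<Sum>l\<in>L. s (y l) (e (unit_vec l)))"
      using insert by blast
    ultimately show ?case
      unfolding sum.insert[OF insert.hyps(1,2)] by (simp only: add sc)
  qed (simp add: e0)
  then have agree: "e y = e' y" if "y \<in> ?V" for y
    using vec_expansion[OF finite_lessThan that] unfolding e'_def by (metis order_refl)
  have kerD: "x \<in> ?V \<and> e x = 0 \<longleftrightarrow> (\<exists>y\<in>fchain F (Suc 0). free_diff F 0 y = x)" for x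
  proof -
    have "x \<in> kernel (free_chain F 0) (additive_group UNIV) e \<longleftrightarrow> x \<in> ?V \<and> e x = 0"
      by (auto simp: kernel_def carrier_free_chain) (auto simp: additive_group_def)
    then show ?thesis unfolding ker tensor_boundaries_iff by blast
  qed
  have "resolution s (basis F) (free_diff F) e'"
  proof (rule resolution.intro)
    show "free_diff F i x \<in> fchain F i" if "x \<in> fchain F (Suc i)" for i x
      by (rule tensor_diff_vecs[OF module_mult module.subspace_UNIV[OF module_mult] that])
    show "e' (free_diff F 0 x) = 0" if "x \<in> fchain F (Suc 0)" for x
      using kerD agree that by metis
    show "\<exists>y\<in>fchain F (Suc 0). free_diff F 0 y = x" if "x \<in> ?V" "e' x = 0" for x
      using kerD agree that by metis
    show "\<exists>x\<in>?V. e' x = q" for q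
      using onto agree by (metis UNIV_I imageE)
  qed (use free_resolution_exact[OF F] e' tensor_diff_linear in simp_all)
  then show thesis by (rule that)
qed

lemma minimal_complexD:
  assumes "minimal_complex m F" "is_ideal m" "x \<in> fchain F (Suc i)"
  shows "free_diff F i x \<in> vecs m (basis F i)"
  using assms unfolding minimal_complex_def carrier_free_chain
  by (auto simp: ideal_smult_free subset_iff tensor_boundaries_iff)

lemma minimal_complexI:
  assumes "is_ideal m" "\<And>i x. x \<in> fchain F (Suc i) \<Longrightarrow> free_diff F i x \<in> vecs m (basis F i)"
  shows "minimal_complex m F"
  unfolding minimal_complex_def carrier_free_chain ideal_smult_free[OF assms(1) finite_lessThan]
  using assms(2) by (auto simp: tensor_boundaries_iff)

section \<open>Resolutions of the residue field\<close>

definition residue :: "'r::comm_ring_1 set \<Rightarrow> 'r \<Rightarrow> 'r set" where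
  "residue m r = (\<lambda>y. y + r) ` m"

lemma residue_eq_iff:
  assumes m: "is_ideal m"
  shows "residue m a = residue m b \<longleftrightarrow> a - b \<in> m"
proof
  assume "residue m a = residue m b"
  moreover have "0 + a \<in> residue m a" unfolding residue_def using ideal_zero[OF m] by blast
  ultimately obtain y where "y \<in> m" "0 + a = y + b" unfolding residue_def by blast
  then show "a - b \<in> m" by (metis add_0 add_diff_cancel_right')
next
  assume ab: "a - b \<in> m"
  have "y + a = (y + (a - b)) + b" "y + b = (y - (a - b)) + a" for y by simp_all
  then show "residue m a = residue m b"
    using ideal_add[OF m _ ab] ideal_diff[OF m _ ab] unfolding residue_def by blast
qed

lemma residue_zero: "residue m 0 = m"
  by (simp add: residue_def)

lemma residue_carrier: "carrier (residue_group m) = range (residue m)"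
  by (auto simp: residue_group_def FactGroup_def RCOSETS_def additive_coset residue_def carrier_additive)

lemma residue_one: "\<one>\<^bsub>residue_group m\<^esub> = residue m 0"
  by (simp add: residue_group_def FactGroup_def residue_zero)

lemma residue_mult:
  assumes m: "is_ideal m"
  shows "residue m a \<otimes>\<^bsub>residue_group m\<^esub> residue m b = residue m (a + b)"
proof -
  have "{x + y |x y. x \<in> residue m a \<and> y \<in> residue m b} = residue m (a + b)" (is "?L = ?R")
  proof
    have "(y + a) + (z + b) = (y + z) + (a + b)" for y z by (simp add: algebra_simps)
    then show "?L \<subseteq> ?R" unfolding residue_def using ideal_add[OF m] by blast
    have "y + (a + b) = (y + a) + (0 + b)" for y by (simp add: algebra_simps)
    then show "?R \<subseteq> ?L" unfolding residue_def using ideal_zero[OF m] by blast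
  qed
  then show ?thesis by (simp add: residue_group_def additive_set_mult)
qed

lemma residue_act_residue:
  assumes m: "is_ideal m"
  shows "residue_act m a (residue m b) = residue m (a * b)"
proof -
  have "{x + y |x y. x \<in> m \<and> y \<in> (*) a ` residue m b} = residue m (a * b)" (is "?L = ?R")
  proof
    have "x + a * (y + b) = (x + a * y) + a * b" for x y by (simp add: algebra_simps)
    then show "?L \<subseteq> ?R" unfolding residue_def using ideal_add[OF m] ideal_mult[OF m] by blast
    have "0 + b \<in> residue m b" unfolding residue_def using ideal_zero[OF m] by blast
    then have "a * b \<in> (*) a ` residue m b" by simp
    then show "?R \<subseteq> ?L" unfolding residue_def[of m "a * b"] by blast
  qed
  then show ?thesis by (simp add: residue_act_def coset_map_def additive_set_mult)
qed

text \<open>The coefficient \<open>c l\<close> represents the residue class that is the image of the \<open>l\<close>-th basis vector.\<close>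
lemma residue_field_resolution_of_free_resolution:
  assumes m: "is_ideal m" and K: "free_resolution (residue_group m) (residue_act m) K e"
  obtains c where "residue_field_resolution m K c"
proof -
  let ?V = "fchain K 0 :: (nat \<Rightarrow> 'a) set"
  note conj = K[unfolded free_resolution_def vec_scale_eq carrier_free_chain residue_carrier]
  have hom: "e \<in> hom (free_chain K 0) (residue_group m)"
    by (rule conj[THEN conjunct1])
  have sc: "e (vscale a v) = residue_act m a (e v)" if "v \<in> ?V" for a v
    by (rule conj[THEN conjunct2, THEN conjunct1, rule_format, OF that])
  have onto: "e ` ?V = range (residue m)"
    by (rule conj[THEN conjunct2, THEN conjunct2, THEN conjunct1])
  have ker: "kernel (free_chain K 0) (residue_group m) e = chain_boundaries (free_chain K) (free_diff K) 0"
    by (rule conj[THEN conjunct2, THEN conjunct2, THEN conjunct2, THEN conjunct1])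
  have add: "e (x + y) = e x \<otimes>\<^bsub>residue_group m\<^esub> e y" if "x \<in> ?V" "y \<in> ?V" for x y
    using hom_mult[OF hom] that by (simp add: carrier_free_chain) (simp add: tensor_chain_def additive_group_def)
  have "\<forall>l. \<exists>c. l < free_rank K 0 \<longrightarrow> e (unit_vec l) = residue m c"
    using onto unit_vec_free by (metis imageE imageI lessThan_iff)
  then obtain c where c: "\<And>l. l < free_rank K 0 \<Longrightarrow> e (unit_vec l) = residue m (c l)" by metis
  have zero: "0 \<in> ?V" by (rule vecs_zero) simp
  obtain r where "e 0 = residue m r" using onto zero by (metis imageE imageI)
  then have e0: "e 0 = residue m 0"
    using sc[OF zero, of 0] by (simp add: residue_act_residue[OF m])
  have "e (\<Sum>l\<in>L. vscale (y l) (unit_vec l)) = residue m (\<Sum>l\<in>L. c l * y l)"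
    if "L \<subseteq> (basis K 0)" for L y
    using finite_subset[OF that finite_lessThan] that
  proof (induction L)
    case (insert l L)
    have "vscale (y l) (unit_vec l) \<in> ?V" "(\<Sum>l\<in>L. vscale (y l) (unit_vec l)) \<in> ?V" "unit_vec l \<in> ?V"
      using insert.prems by (auto intro!: vecs_scale vecs_sum unit_vec_free)
    moreover have "e (\<Sum>l\<in>L. vscale (y l) (unit_vec l)) = residue m (\<Sum>l\<in>L. c l * y l)"
      using insert by blast
    moreover have "l < free_rank K 0" using insert.prems by simp
    ultimately show ?case
      unfolding sum.insert[OF insert.hyps(1,2)] mult.commute[of "c l"]
      by (simp only: add sc c residue_act_residue[OF m] residue_mult[OF m])
  qed (simp add: e0)
  then have agree: "e y = residue m (aug_sum c (free_rank K 0) (*) y)" if "y \<in> ?V" for y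
    using vec_expansion[OF finite_lessThan that] unfolding aug_sum_def by (metis order_refl)
  have kerD: "x \<in> ?V \<and> aug_sum c (free_rank K 0) (*) x \<in> m \<longleftrightarrow>
      (\<exists>y\<in>fchain K (Suc 0). free_diff K 0 y = x)" for x
  proof -
    have "x \<in> kernel (free_chain K 0) (residue_group m) e \<longleftrightarrow>
        x \<in> ?V \<and> aug_sum c (free_rank K 0) (*) x \<in> m"
      unfolding kernel_def carrier_free_chain residue_one mem_Collect_eq
      using agree[of x] residue_eq_iff[OF m, of _ 0] by auto
    then show ?thesis unfolding ker tensor_boundaries_iff by blast
  qed
  have "residue_field_resolution m K c"
  proof
    obtain v where v: "v \<in> ?V" "e v = residue m 1" using onto by (metis imageE rangeI)
    then show "\<exists>v\<in>?V. aug_sum c (free_rank K 0) (*) v - 1 \<in> m"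
      using agree[OF v(1)] residue_eq_iff[OF m] by metis
  qed (use m free_resolution_exact[OF K] kerD in blast)+
  then show thesis by (rule that)
qed

text \<open>The resolution starts with \<open>R \<rightarrow> R/m\<close>, whose kernel is \<open>m\<close> viewed as a submodule of \<open>R\<^sup>1\<close>.\<close>
lemma residue_resolution_exists:
  fixes m :: "'r::comm_ring_1 set"
  assumes noeth: "\<And>A :: 'r set. is_ideal A \<Longrightarrow> \<exists>B. finite B \<and> A = module.span (*) B"
    and m: "is_ideal m"
  obtains c where "residue_field_resolution m (residue_resolution m) c"
proof -
  define Z0 :: "(nat \<Rightarrow> 'r) set" where "Z0 = vecs m {..<1}"
  define Good :: "nat \<Rightarrow> (nat \<Rightarrow> int) \<Rightarrow> (nat \<Rightarrow> 'r) set \<Rightarrow> bool" where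
    "Good b \<delta> Z \<longleftrightarrow> vec.subspace Z \<and> Z \<subseteq> free_vecs {..<b}" for b \<delta> Z
  have start: "Good 1 (\<lambda>_. 0) Z0"
    unfolding Good_def Z0_def using vecs_subspace[OF m] vecs_free by blast
  have step: "\<exists>c \<delta>' g. (\<forall>l<c. g l \<in> free_vecs {..<b}) \<and> vec.span (g ` {..<c}) = Z \<and> True \<and>
      Good c \<delta>' (relations vscale c g)"
    if good: "Good b \<delta> Z" for b \<delta> Z
  proof -
    have Z: "vec.subspace Z" "Z \<subseteq> free_vecs {..<b}" using good unfolding Good_def by auto
    obtain A where A: "finite A" "Z = vec.span A"
      using submodule_finitely_generated[OF noeth Z] by blast
    obtain g where g: "A = g ` {..<card A}"
      using ex_bij_betw_nat_finite[OF A(1)] unfolding bij_betw_def atLeast0LessThan by metis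
    have "g l \<in> free_vecs {..<b}" if l: "l < card A" for l
    proof -
      have "g l \<in> A" using g l by blast
      then have "g l \<in> Z" unfolding A(2) by (rule vec.span_base)
      then show ?thesis using Z(2) by blast
    qed
    moreover have "vec.subspace (relations vscale (card A) g)"
      by (rule relations_subspace[OF vec.module_axioms])
    ultimately show ?thesis
      using A(2) g unfolding Good_def by (intro exI[of _ "card A"] exI[of _ \<delta>] exI[of _ g]) auto
  qed
  have "\<exists>F :: 'r free_complex. free_rank F 0 = 1 \<and>
    free_diff F 0 ` fchain F (Suc 0) = Z0 \<and>
    (\<forall>i. diff_kernel F i =
      free_diff F (Suc i) ` fchain F (Suc (Suc i)))"
    by (rule resolution_by_steps[where Good = Good and H = "\<lambda>_ _ _ _ _. True", OF start step])
      (assumption | rule exI conjI allI)+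
  then obtain F :: "'r free_complex" where F: "free_rank F 0 = 1"
    "free_diff F 0 ` fchain F (Suc 0) = Z0"
    "\<And>i. diff_kernel F i =
      free_diff F (Suc i) ` fchain F (Suc (Suc i))" by (elim exE conjE) (rule that, (assumption | erule spec)+)
  let ?e = "\<lambda>v :: nat \<Rightarrow> 'r. residue m (v 0)"
  have "free_resolution (residue_group m) (residue_act m) F ?e"
    unfolding free_resolution_def
  proof (intro conjI allI ballI)
    show "?e \<in> hom (free_chain F 0) (residue_group m)"
      by (rule homI) (auto simp: residue_carrier residue_mult[OF m] tensor_chain_def additive_group_def)
    show "?e (vec_scale a v) = residue_act m a (?e v)" for a v
      by (simp add: vec_scale_eq residue_act_residue[OF m])
    show "?e ` carrier (free_chain F 0) = carrier (residue_group m)"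
    proof -
      have "residue m r \<in> ?e ` free_vecs {..<1}" for r
        by (rule image_eqI[of _ _ "\<lambda>j. if j = 0 then r else 0"]) (auto simp: vecs_def)
      then show ?thesis by (auto simp: carrier_free_chain residue_carrier F(1))
    qed
    show "kernel (free_chain F 0) (residue_group m) ?e = chain_boundaries (free_chain F) (free_diff F) 0"
      unfolding kernel_def chain_boundaries_def carrier_free_chain residue_one F(1,2)
        residue_eq_iff[OF m] Z0_def by (auto simp: vecs_def split: if_splits)
    show "chain_cycles (free_chain F) (free_diff F) (Suc i) = chain_boundaries (free_chain F) (free_diff F) (Suc i)" for i
      using F(3)[of i] by (auto simp: tensor_cycles_iff chain_boundaries_def carrier_free_chain)
  qed
  then have "\<exists>e. free_resolution (residue_group m) (residue_act m) F e" by (rule exI[of _ ?e])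
  then have "\<exists>e. free_resolution (residue_group m) (residue_act m) (residue_resolution m) e"
    unfolding residue_resolution_def
    by (rule someI[where P = "\<lambda>F. \<exists>e. free_resolution (residue_group m) (residue_act m) F e"])
  then show thesis using residue_field_resolution_of_free_resolution[OF m] that by metis
qed

section \<open>Minimal resolutions over a local ring\<close>

lemma minimal_generating_set:
  assumes "module s" and "finite A" "\<And>a. a \<in> A \<Longrightarrow> H a" "module.span s A = W"
  obtains B where "finite B" "\<And>b. b \<in> B \<Longrightarrow> H b" "module.span s B = W"
    "\<And>b. b \<in> B \<Longrightarrow> b \<notin> module.span s (B - {b})"
proof -
  interpret module s by fact
  define P where "P B \<longleftrightarrow> finite B \<and> (\<forall>b\<in>B. H b) \<and> span B = W" for B
  have "P A" using assms by (simp add: P_def)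
  then obtain B where B: "P B" and least: "\<And>C. P C \<Longrightarrow> card B \<le> card C"
    using ex_has_least_nat[of P A card] by blast
  have "b \<notin> span (B - {b})" if b: "b \<in> B" for b
  proof
    assume bs: "b \<in> span (B - {b})"
    have "B \<subseteq> span (B - {b})"
      using bs span_superset[of "B - {b}"] by blast
    then have "span B \<subseteq> span (B - {b})" by (rule span_minimal) simp
    moreover have "span (B - {b}) \<subseteq> span B" by (rule span_mono) blast
    ultimately have "P (B - {b})" using B by (auto simp: P_def)
    then have "card B \<le> card (B - {b})" by (rule least)
    moreover have "card (B - {b}) < card B"
      using B b by (intro card_Diff1_less) (simp_all add: P_def)
    ultimately show False by simp
  qed
  then show thesis using that[of B] B by (auto simp: P_def)
qed

text \<open>A relation with a unit coefficient would make one of the generators redundant.\<close>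
lemma irredundant_relation:
  fixes c :: nat
  assumes "module s" and inj: "inj_on g {..<c}"
    and irr: "\<And>b. b \<in> g ` {..<c} \<Longrightarrow> b \<notin> module.span s (g ` {..<c} - {b})"
    and rel: "(\<Sum>l<c. s (y l) (g l)) = 0" and k: "k < c" and v: "v * y k = 1"
  shows False
proof -
  interpret module s by fact
  have "0 = s v (\<Sum>l<c. s (y l) (g l))" using rel by simp
  also have "\<dots> = g k + (\<Sum>l\<in>{..<c} - {k}. s (v * y l) (g l))"
    using k v by (simp add: scale_right_distrib scale_sum_right sum.remove[of "{..<c}" k])
  finally have gk: "g k = - (\<Sum>l\<in>{..<c} - {k}. s (v * y l) (g l))"
    by (metis eq_neg_iff_add_eq_0)
  have "g l \<in> g ` {..<c} - {g k}" if "l \<in> {..<c} - {k}" for l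
    using that k inj by (auto dest: inj_onD)
  then have "- (\<Sum>l\<in>{..<c} - {k}. s (v * y l) (g l)) \<in> span (g ` {..<c} - {g k})"
    by (intro span_neg span_sum span_scale span_base)
  then have "g k \<in> span (g ` {..<c} - {g k})" unfolding gk[symmetric] .
  moreover have "g k \<in> g ` {..<c}" using k by simp
  ultimately show False using irr by blast
qed

text \<open>The image of each differential is one of the modules of relations, so minimality follows if these
  lie in \<open>m R\<^sup>b\<close>.\<close>
lemma minimal_resolution_by_steps:
  fixes Good :: "nat \<Rightarrow> (nat \<Rightarrow> int) \<Rightarrow> (nat \<Rightarrow> 'r::comm_ring_1) set \<Rightarrow> bool"
    and s :: "'r \<Rightarrow> 'm::ab_group_add \<Rightarrow> 'm"
  assumes m: "is_ideal m" and s: "module s" and g: "module.span s (g ` {..<n}) = UNIV"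
    and sub: "\<And>b \<delta> Z. Good b \<delta> Z \<Longrightarrow> Z \<subseteq> vecs m {..<b}"
    and start: "Good n \<delta>0 (relations s n g)"
    and step: "\<And>b \<delta> Z. Good b \<delta> Z \<Longrightarrow> \<exists>c \<delta>' g. (\<forall>l<c. g l \<in> free_vecs {..<b}) \<and>
      vec.span (g ` {..<c}) = Z \<and> H b \<delta> c \<delta>' g \<and> Good c \<delta>' (relations vscale c g)"
  obtains F :: "'r free_complex" and \<delta> where "free_rank F 0 = n" "\<delta> 0 = \<delta>0" "minimal_complex m F"
    "free_resolution (additive_group UNIV) s F (\<lambda>y. \<Sum>l<free_rank F 0. s (y l) (g l))"
    "\<And>i. H (free_rank F i) (\<delta> i) (free_rank F (Suc i)) (\<delta> (Suc i)) (\<lambda>l j. diff_mat F i j l)"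
proof (rule resolution_by_steps[where Good = Good and H = H, OF start step])
  fix F :: "'r free_complex" and \<delta>
  assume rank: "free_rank F 0 = n" and \<delta>: "\<delta> 0 = \<delta>0"
    and d0: "free_diff F 0 ` fchain F (Suc 0) = relations s n g"
    and ex: "\<And>i. diff_kernel F i = free_diff F (Suc i) ` fchain F (Suc (Suc i))"
    and good: "\<And>i. Good (free_rank F (Suc i)) (\<delta> (Suc i)) (diff_kernel F i)"
    and H: "\<And>i. H (free_rank F i) (\<delta> i) (free_rank F (Suc i)) (\<delta> (Suc i)) (\<lambda>l j. diff_mat F i j l)"
  have "free_diff F i ` fchain F (Suc i) \<subseteq> vecs m (basis F i)" for i
  proof (cases i)
    case 0
    show ?thesis using sub[OF start] unfolding 0 d0 rank .
  next
    case (Suc j)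
    show ?thesis using sub[OF good] unfolding Suc ex .
  qed
  then have "minimal_complex m F" by (intro minimal_complexI[OF m]) blast
  moreover have "free_resolution (additive_group UNIV) s F (\<lambda>y. \<Sum>l<free_rank F 0. s (y l) (g l))"
    by (rule free_resolutionI[OF s]) (unfold rank, rule g, rule d0, rule ex)
  ultimately show thesis using that[of F \<delta>] rank \<delta> H by blast
qed

lemma minimal_resolution_local:
  fixes m :: "'r::comm_ring_1 set" and s :: "'r \<Rightarrow> 'm::ab_group_add \<Rightarrow> 'm"
  assumes noeth: "\<And>A :: 'r set. is_ideal A \<Longrightarrow> \<exists>B. finite B \<and> A = module.span (*) B"
    and m: "is_ideal m" and unit: "\<And>a. a \<notin> m \<Longrightarrow> \<exists>v. v * a = 1"
    and s: "module s" and fg: "finitely_generated s"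
  shows "\<exists>F. minimal_complex m F \<and> (\<exists>e. free_resolution (additive_group UNIV) s F e)"
proof -
  define Good :: "nat \<Rightarrow> (nat \<Rightarrow> int) \<Rightarrow> (nat \<Rightarrow> 'r) set \<Rightarrow> bool" where
    "Good b \<delta> Z \<longleftrightarrow> vec.subspace Z \<and> Z \<subseteq> vecs m {..<b}" for b \<delta> Z
  have gens: "\<exists>c g. t_span (g ` {..<c}) = W \<and> Good c (\<lambda>_. 0) (relations t c g)"
    if t: "module t" and A: "finite A" "module.span t A = W" and sp: "t_span = module.span t"
    for t :: "'r \<Rightarrow> 'x::ab_group_add \<Rightarrow> 'x" and t_span A W
  proof -
    obtain B where B: "finite B" "module.span t B = W"
      "\<And>b. b \<in> B \<Longrightarrow> b \<notin> module.span t (B - {b})"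
      using minimal_generating_set[OF t A(1) _ A(2), of "\<lambda>_. True"] by blast
    obtain g where g: "inj_on g {..<card B}" "B = g ` {..<card B}"
      using ex_bij_betw_nat_finite[OF B(1)] unfolding bij_betw_def atLeast0LessThan by metis
    let ?Z = "relations t (card B) g"
    have "vec.subspace ?Z" by (rule relations_subspace[OF t])
    moreover have "?Z \<subseteq> vecs m {..<card B}"
    proof
      fix y assume y: "y \<in> ?Z"
      have "y k \<in> m" if "k < card B" for k
      proof (rule ccontr)
        assume "y k \<notin> m"
        then obtain v where "v * y k = 1" using unit by blast
        moreover have "(\<Sum>l<card B. t (y l) (g l)) = 0" using y by blast
        ultimately show False
          using irredundant_relation[OF t g(1) _ _ that] B(3) unfolding g(2)[symmetric] by blast
      qed
      then show "y \<in> vecs m {..<card B}" using y by (auto simp: vecs_def)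
    qed
    ultimately have "Good (card B) (\<lambda>_. 0) ?Z" unfolding Good_def by blast
    moreover have "t_span (g ` {..<card B}) = W" unfolding sp g(2)[symmetric] by (rule B(2))
    ultimately show ?thesis by blast
  qed
  obtain A where "finite A" "module.span s A = UNIV" using fg unfolding finitely_generated_def by blast
  then obtain c g where g: "module.span s (g ` {..<c}) = UNIV"
    and start: "Good c (\<lambda>_. 0) (relations s c g)"
    using gens[OF s _ _ refl, of A UNIV] by blast
  have step: "\<exists>c \<delta>' g. (\<forall>l<c. g l \<in> free_vecs {..<b}) \<and> vec.span (g ` {..<c}) = Z \<and> True \<and>
      Good c \<delta>' (relations vscale c g)"
    if good: "Good b \<delta> Z" for b \<delta> Z
  proof -
    have Z: "vec.subspace Z" "Z \<subseteq> free_vecs {..<b}" using good vecs_free unfolding Good_def by blast+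
    obtain A where A: "finite A" "vec.span A = Z"
      using submodule_finitely_generated[OF noeth Z] by blast
    obtain c g where g: "vec.span (g ` {..<c}) = Z"
      "Good c (\<lambda>_. 0) (relations vscale c g)"
      using gens[OF vec.module_axioms A refl] by blast
    have "g l \<in> free_vecs {..<b}" if l: "l < c" for l
    proof -
      have "g l \<in> vec.span (g ` {..<c})" using l by (intro vec.span_base imageI) simp
      then show ?thesis using g(1) Z(2) by blast
    qed
    then show ?thesis
      by (intro exI[of _ c] exI[of _ "\<lambda>_. 0"] exI[of _ g] conjI allI impI g TrueI)
  qed
  have sub: "Z \<subseteq> vecs m {..<b}" if "Good b \<delta> Z" for b \<delta> Z using that unfolding Good_def by blast
  show ?thesis
    by (rule minimal_resolution_by_steps[where Good = Good and H = "\<lambda>_ _ _ _ _. True", OF m s g sub start step])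
      blast+
qed

text \<open>An element that is not a unit generates a proper ideal, which lies in a maximal one by Zorn's
  lemma; the only maximal ideal is \<open>m\<close>.\<close>
lemma local_unit:
  fixes m :: "'r::comm_ring_1 set"
  assumes loc: "noetherian_local m" and a: "a \<notin> m"
  shows "\<exists>v. v * a = 1"
proof (rule ccontr)
  assume no: "\<nexists>v. v * a = 1"
  let ?I = "range (\<lambda>r. r * a)"
  define \<A> where "\<A> = {J. is_ideal J \<and> ?I \<subseteq> J \<and> 1 \<notin> J}"
  have "is_ideal ?I"
  proof (rule is_idealI)
    show "0 \<in> ?I" by (rule range_eqI[of _ _ 0]) simp
    show "x + y \<in> ?I" if "x \<in> ?I" "y \<in> ?I" for x y
      using that by (auto simp flip: distrib_right)
    show "r * x \<in> ?I" if "x \<in> ?I" for r x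
      using that by (auto simp flip: mult.assoc)
  qed
  moreover have "1 \<notin> ?I" using no by (metis imageE)
  ultimately have "\<A> \<noteq> {}" unfolding \<A>_def by blast
  moreover have "\<Union>C \<in> \<A>" if C: "C \<noteq> {}" "subset.chain \<A> C" for C
  proof -
    have CA: "J \<in> C \<Longrightarrow> is_ideal J \<and> ?I \<subseteq> J \<and> 1 \<notin> J" for J
      using C(2) unfolding subset.chain_def \<A>_def by blast
    have "is_ideal (\<Union>C)"
    proof (rule is_idealI)
      show "0 \<in> \<Union>C" using C(1) CA ideal_zero by blast
      show "x + y \<in> \<Union>C" if xy: "x \<in> \<Union>C" "y \<in> \<Union>C" for x y
      proof -
        obtain X Y where XY: "X \<in> C" "x \<in> X" "Y \<in> C" "y \<in> Y" using xy by blast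
        then have "X \<subseteq> Y \<or> Y \<subseteq> X" using C(2) unfolding subset_chain_def by blast
        then show ?thesis using XY CA ideal_add by blast
      qed
      show "r * x \<in> \<Union>C" if "x \<in> \<Union>C" for r x using that CA ideal_mult by blast
    qed
    then show ?thesis using C(1) CA unfolding \<A>_def by blast
  qed
  ultimately obtain J where J: "J \<in> \<A>" "\<And>X. X \<in> \<A> \<Longrightarrow> J \<subseteq> X \<Longrightarrow> X = J"
    using subset_Zorn_nonempty[of \<A>] by blast
  have "is_maximal_ideal J"
    unfolding is_maximal_ideal_def
  proof (intro conjI allI impI)
    show "is_ideal J" "J \<noteq> UNIV" using J(1) unfolding \<A>_def by auto
    fix X assume X: "is_ideal X" "J \<subseteq> X"
    show "X = J \<or> X = UNIV"
    proof (cases "1 \<in> X")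
      case True
      then have "r \<in> X" for r using ideal_mult[OF X(1), of 1 r] by simp
      then show ?thesis by blast
    next
      case False
      then show ?thesis using X J unfolding \<A>_def by blast
    qed
  qed
  then have "J = m" using loc unfolding noetherian_local_def by blast
  moreover have "1 * a \<in> ?I" by blast
  ultimately show False using a J(1) unfolding \<A>_def by auto
qed

section \<open>Finitely generated algebras over a field are noetherian\<close>

text \<open>Subrings are sets, so that generators can be adjoined one after the other by induction. The
  combinations of elements of \<open>G\<close> with coefficients in a subring \<open>A\<close> form \<open>lin_span A G\<close>.\<close>

inductive_set lin_span :: "'r::comm_ring_1 set \<Rightarrow> 'r set \<Rightarrow> 'r set" for A G where
  zero: "0 \<in> lin_span A G"
| step: "a \<in> A \<Longrightarrow> g \<in> G \<Longrightarrow> x \<in> lin_span A G \<Longrightarrow> a * g + x \<in> lin_span A G"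

definition subring :: "'r::comm_ring_1 set \<Rightarrow> bool" where
  "subring A \<longleftrightarrow> 0 \<in> A \<and> 1 \<in> A \<and> (\<forall>x\<in>A. - x \<in> A) \<and> (\<forall>x\<in>A. \<forall>y\<in>A. x + y \<in> A \<and> x * y \<in> A)"

definition ideal_in :: "'r::comm_ring_1 set \<Rightarrow> 'r set \<Rightarrow> bool" where
  "ideal_in A I \<longleftrightarrow> I \<subseteq> A \<and> 0 \<in> I \<and> (\<forall>x\<in>I. \<forall>y\<in>I. x + y \<in> I) \<and> (\<forall>a\<in>A. \<forall>x\<in>I. a * x \<in> I)"

definition noetherian_subring :: "'r::comm_ring_1 set \<Rightarrow> bool" where
  "noetherian_subring A \<longleftrightarrow> subring A \<and>
    (\<forall>I. ideal_in A I \<longrightarrow> (\<exists>G. finite G \<and> G \<subseteq> I \<and> I \<subseteq> lin_span A G))"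

lemma subringD:
  assumes "subring A"
  shows "0 \<in> A" "1 \<in> A" "x \<in> A \<Longrightarrow> - x \<in> A" "x \<in> A \<Longrightarrow> y \<in> A \<Longrightarrow> x + y \<in> A"
    "x \<in> A \<Longrightarrow> y \<in> A \<Longrightarrow> x * y \<in> A" "x \<in> A \<Longrightarrow> y \<in> A \<Longrightarrow> x - y \<in> A"
  using assms unfolding subring_def by (auto simp: diff_conv_add_uminus simp del: add_uminus_conv_diff)

lemma lin_span_add: "x \<in> lin_span A G \<Longrightarrow> y \<in> lin_span A G \<Longrightarrow> x + y \<in> lin_span A G"
  by (induction rule: lin_span.induct) (auto simp: add.assoc intro: lin_span.intros)

lemma lin_span_scale:
  assumes "subring A" "b \<in> A" "x \<in> lin_span A G"
  shows "b * x \<in> lin_span A G"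
  using assms(3)
proof induction
  case (step a g x)
  have "b * (a * g + x) = (b * a) * g + b * x" by (simp add: algebra_simps)
  moreover have "b * a \<in> A" using assms step by (simp add: subringD)
  ultimately show ?case using lin_span.step[OF _ step(2,4)] by simp
qed (simp add: lin_span.zero)

lemma lin_span_base: "subring A \<Longrightarrow> g \<in> G \<Longrightarrow> g \<in> lin_span A G"
  using lin_span.step[of 1 A g G 0] by (simp add: subringD lin_span.zero)

definition adjoin :: "'r::comm_ring_1 set \<Rightarrow> 'r \<Rightarrow> 'r set" where
  "adjoin A t = {poly p t | p. \<forall>i. coeff p i \<in> A}"

lemma adjoin_subring:
  assumes A: "subring A"
  shows "subring (adjoin A t)"
proof -
  have mult: "coeff (p * q) i \<in> A" if "\<And>i. coeff p i \<in> A" "\<And>i. coeff q i \<in> A" for p q i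
  proof -
    have "(\<Sum>k\<in>S. coeff p k * coeff q (i - k)) \<in> A" for S
      using that by (induction S rule: infinite_finite_induct) (auto simp: subringD[OF A])
    then show ?thesis by (simp add: coeff_mult)
  qed
  show ?thesis
    unfolding subring_def
  proof (intro conjI ballI)
    have "poly 0 t \<in> adjoin A t" unfolding adjoin_def by (auto simp: subringD[OF A] intro!: exI[of _ 0])
    then show "0 \<in> adjoin A t" by simp
    have "poly 1 t \<in> adjoin A t"
      unfolding adjoin_def by (auto simp: subringD[OF A] intro!: exI[of _ 1])
    then show "1 \<in> adjoin A t" by simp
    fix x assume "x \<in> adjoin A t"
    then obtain p where p: "x = poly p t" "\<And>i. coeff p i \<in> A" unfolding adjoin_def by blast
    show "- x \<in> adjoin A t"
      unfolding adjoin_def using p by (auto simp: subringD[OF A] intro!: exI[of _ "- p"])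
    fix y assume "y \<in> adjoin A t"
    then obtain q where q: "y = poly q t" "\<And>i. coeff q i \<in> A" unfolding adjoin_def by blast
    show "x + y \<in> adjoin A t"
      unfolding adjoin_def using p q by (auto simp: subringD[OF A] intro!: exI[of _ "p + q"])
    show "x * y \<in> adjoin A t"
      unfolding adjoin_def using p q mult by (auto intro!: exI[of _ "p * q"])
  qed
qed

lemma adjoin_contains:
  assumes "subring A" shows "A \<subseteq> adjoin A t" "t \<in> adjoin A t"
proof -
  have "a \<in> adjoin A t" if "a \<in> A" for a
    unfolding adjoin_def using that assms
    by (auto simp: coeff_pCons subringD split: nat.split intro!: exI[of _ "[:a:]"])
  then show "A \<subseteq> adjoin A t" by blast
  show "t \<in> adjoin A t"
    unfolding adjoin_def using assms
    by (auto simp: coeff_pCons subringD split: nat.split intro!: exI[of _ "[:0, 1:]"])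
qed

text \<open>Hilbert's basis theorem. Ideals of \<open>A[t]\<close> are controlled by the ideals \<open>L n\<close> of leading
  coefficients of the polynomials of degree at most \<open>n\<close> that represent their elements (\<open>t\<close> may be
  algebraic over \<open>A\<close>). The \<open>L n\<close> are stationary from some \<open>N\<close> on, and generators of \<open>L 0, \<dots>, L N\<close>
  lift to generators of the ideal: they allow the degree of any polynomial to be lowered.\<close>
theorem noetherian_adjoin:
  assumes noeth: "noetherian_subring A"
  shows "noetherian_subring (adjoin A t)"
proof -
  have A: "subring A" using noeth by (simp add: noetherian_subring_def)
  note B = adjoin_subring[OF A, of t]
  have "\<exists>G. finite G \<and> G \<subseteq> I \<and> I \<subseteq> lin_span (adjoin A t) G" if I: "ideal_in (adjoin A t) I" for I
  proof -
    define J where "J = {p. (\<forall>i. coeff p i \<in> A) \<and> poly p t \<in> I}"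
    have I0: "0 \<in> I" and Iadd: "\<And>x y. x \<in> I \<Longrightarrow> y \<in> I \<Longrightarrow> x + y \<in> I"
      and Imult: "\<And>a x. a \<in> adjoin A t \<Longrightarrow> x \<in> I \<Longrightarrow> a * x \<in> I"
      using I by (auto simp: ideal_in_def)
    have J0: "0 \<in> J" using I0 by (simp add: J_def subringD[OF A])
    have Jadd: "p + q \<in> J" if "p \<in> J" "q \<in> J" for p q
      using that Iadd by (auto simp: J_def subringD[OF A])
    have Jsmult: "smult a p \<in> J" if "a \<in> A" "p \<in> J" for a p
      using that Imult adjoin_contains(1)[OF A, of t] by (auto simp: J_def subringD[OF A])
    have tn: "t ^ n \<in> adjoin A t" for n
      by (induction n) (auto simp: subringD[OF B] adjoin_contains[OF A])
    have Jshift: "monom 1 n * p \<in> J" if "p \<in> J" for n p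
      using that Imult[OF tn] by (auto simp: J_def coeff_monom_mult subringD[OF A] poly_monom)
    have Jdiff: "p - q \<in> J" if "p \<in> J" "q \<in> J" for p q
      using Jadd[OF that(1) Jsmult[OF _ that(2), of "- 1"]] by (simp add: subringD[OF A])
    define L where "L n = {coeff p n | p. p \<in> J \<and> degree p \<le> n}" for n
    have L_ideal: "ideal_in A (L n)" for n
      unfolding ideal_in_def
    proof (intro conjI ballI)
      show "L n \<subseteq> A" by (auto simp: L_def J_def)
      show "0 \<in> L n" unfolding L_def using J0 by (auto intro!: exI[of _ 0])
      show "x + y \<in> L n" if xy: "x \<in> L n" "y \<in> L n" for x y
      proof -
        obtain p q where "p \<in> J" "degree p \<le> n" "x = coeff p n" "q \<in> J" "degree q \<le> n" "y = coeff q n"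
          using xy unfolding L_def by blast
        then show ?thesis
          unfolding L_def using Jadd by (auto intro!: exI[of _ "p + q"] degree_add_le)
      qed
      show "a * x \<in> L n" if ax: "a \<in> A" "x \<in> L n" for a x
      proof -
        obtain p where "p \<in> J" "degree p \<le> n" "x = coeff p n" using ax unfolding L_def by blast
        then show ?thesis
          unfolding L_def using Jsmult[OF ax(1)] degree_smult_le[of a p]
          by (auto intro!: exI[of _ "smult a p"] intro: order_trans)
      qed
    qed
    have L_Suc: "L n \<subseteq> L (Suc n)" for n
    proof
      fix a assume "a \<in> L n"
      then obtain p where p: "p \<in> J" "degree p \<le> n" "a = coeff p n" unfolding L_def by blast
      have "degree (monom 1 1 * p) \<le> Suc n"
        using degree_mult_le[of "monom 1 1" p] degree_monom_le[of "1 :: 'a" 1] p(2) by simp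
      moreover have "coeff (monom 1 1 * p) (Suc n) = a" using p(3) by (simp add: coeff_monom_mult)
      ultimately show "a \<in> L (Suc n)" unfolding L_def using Jshift[OF p(1)] by blast
    qed
    then have L_mono: "L i \<subseteq> L j" if "i \<le> j" for i j
      using that by (rule lift_Suc_mono_le)
    have "ideal_in A (\<Union>n. L n)"
      unfolding ideal_in_def
    proof (intro conjI ballI)
      show "(\<Union>n. L n) \<subseteq> A" "0 \<in> (\<Union>n. L n)" using L_ideal unfolding ideal_in_def by blast+
      show "x + y \<in> (\<Union>n. L n)" if xy: "x \<in> (\<Union>n. L n)" "y \<in> (\<Union>n. L n)" for x y
      proof -
        obtain i j where "x \<in> L i" "y \<in> L j" using xy by blast
        then have "x \<in> L (max i j)" "y \<in> L (max i j)"
          using L_mono[of i "max i j"] L_mono[of j "max i j"] by auto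
        then show ?thesis using L_ideal unfolding ideal_in_def by blast
      qed
      show "a * x \<in> (\<Union>n. L n)" if "a \<in> A" "x \<in> (\<Union>n. L n)" for a x
        using that L_ideal unfolding ideal_in_def by blast
    qed
    then obtain G where G: "finite G" "G \<subseteq> (\<Union>n. L n)" "(\<Union>n. L n) \<subseteq> lin_span A G"
      using noeth unfolding noetherian_subring_def by blast
    have "\<forall>g\<in>G. \<exists>n. g \<in> L n" using G(2) by blast
    then obtain f where f: "\<And>g. g \<in> G \<Longrightarrow> g \<in> L (f g)" by metis
    define N where "N = Max (insert 0 (f ` G))"
    have GN: "G \<subseteq> L N"
    proof
      fix g assume g: "g \<in> G"
      then have "f g \<le> N" unfolding N_def using G(1) by (intro Max_ge) auto
      then show "g \<in> L N" using f[OF g] L_mono by blast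
    qed
    have "\<forall>n. \<exists>Gn. finite Gn \<and> Gn \<subseteq> L n \<and> L n \<subseteq> lin_span A Gn"
      using noeth L_ideal unfolding noetherian_subring_def by blast
    then obtain Gs where Gs: "\<And>n. finite (Gs n)" "\<And>n. Gs n \<subseteq> L n" "\<And>n. L n \<subseteq> lin_span A (Gs n)"
      by metis
    have "\<forall>n g. \<exists>p. g \<in> Gs n \<longrightarrow> p \<in> J \<and> degree p \<le> n \<and> coeff p n = g"
      using Gs(2) unfolding L_def by blast
    then obtain P where P: "\<And>n g. g \<in> Gs n \<Longrightarrow> P n g \<in> J \<and> degree (P n g) \<le> n \<and> coeff (P n g) n = g"
      by metis
    define H where "H = (\<Union>n\<in>{..N}. (\<lambda>g. poly (P n g) t) ` Gs n)"
    \<comment> \<open>Every element of \<open>L n\<close> with \<open>n \<le> N\<close> is a leading coefficient within the span of \<open>H\<close>.\<close>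
    have lead: "\<exists>q\<in>J. degree q \<le> n \<and> coeff q n = a \<and> poly q t \<in> lin_span (adjoin A t) H"
      if "a \<in> lin_span A (Gs n)" "n \<le> N" for a n
      using that(1)
    proof induction
      case zero
      then show ?case using J0 by (intro bexI[of _ 0]) (auto intro: lin_span.zero)
    next
      case (step a g x)
      then obtain q where q: "q \<in> J" "degree q \<le> n" "coeff q n = x" "poly q t \<in> lin_span (adjoin A t) H"
        by blast
      have "poly (P n g) t \<in> lin_span (adjoin A t) H"
        using step(2) that(2) by (intro lin_span_base[OF B]) (auto simp: H_def)
      then have "a * poly (P n g) t \<in> lin_span (adjoin A t) H"
        using step(1) adjoin_contains(1)[OF A] by (intro lin_span_scale[OF B]) auto
      then have "poly (smult a (P n g) + q) t \<in> lin_span (adjoin A t) H"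
        using q(4) by (simp add: lin_span_add)
      moreover have "degree (smult a (P n g) + q) \<le> n"
        using P[OF step(2)] q(2) degree_smult_le[of a "P n g"] by (intro degree_add_le) auto
      moreover have "smult a (P n g) + q \<in> J"
        using P[OF step(2)] q(1) step(1) by (intro Jadd Jsmult) auto
      ultimately show ?case using P[OF step(2)] q(3) by (intro bexI[of _ "smult a (P n g) + q"]) auto
    qed
    have main: "poly p t \<in> lin_span (adjoin A t) H" if "p \<in> J" "degree p < n" for p n
      using that
    proof (induction n arbitrary: p)
      case (Suc n)
      have "coeff p n \<in> L n" unfolding L_def using Suc.prems by auto
      have "\<exists>q\<in>J. degree q \<le> n \<and> coeff q n = coeff p n \<and> poly q t \<in> lin_span (adjoin A t) H"
      proof (cases "n \<le> N")
        case True
        then show ?thesis using lead[OF _ True] Gs(3)[of n] \<open>coeff p n \<in> L n\<close> by blast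
      next
        case False
        have "coeff p n \<in> lin_span A G" using \<open>coeff p n \<in> L n\<close> G(3) by blast
        then have "coeff p n \<in> L N"
          by induction (use GN L_ideal[of N] in \<open>auto simp: ideal_in_def\<close>)
        then obtain q where q: "q \<in> J" "degree q \<le> N" "coeff q N = coeff p n"
          "poly q t \<in> lin_span (adjoin A t) H"
          using lead[OF _ order_refl] Gs(3)[of N] by blast
        let ?q = "monom 1 (n - N) * q"
        have "degree ?q \<le> n"
          using degree_mult_le[of "monom 1 (n - N)" q] degree_monom_le[of "1 :: 'a" "n - N"] q(2) False
          by simp
        moreover have "coeff ?q n = coeff p n" using q(3) False by (simp add: coeff_monom_mult)
        moreover have "poly ?q t \<in> lin_span (adjoin A t) H"
          using lin_span_scale[OF B tn q(4)] by (simp add: poly_monom)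
        ultimately show ?thesis using Jshift[OF q(1)] by blast
      qed
      then obtain q where q: "q \<in> J" "degree q \<le> n" "coeff q n = coeff p n"
        "poly q t \<in> lin_span (adjoin A t) H" by blast
      have rest: "poly (p - q) t \<in> lin_span (adjoin A t) H"
      proof (cases "p - q = 0")
        case True
        then show ?thesis by (simp add: lin_span.zero)
      next
        case False
        have "degree (p - q) \<le> n" using Suc.prems(2) q(2) by (intro degree_diff_le) auto
        moreover have "degree (p - q) \<noteq> n"
          using False q(3) leading_coeff_neq_0[of "p - q"] by auto
        ultimately show ?thesis using Jdiff[OF Suc.prems(1) q(1)] by (intro Suc.IH) auto
      qed
      have "poly (p - q) t + poly q t \<in> lin_span (adjoin A t) H"
        by (rule lin_span_add[OF rest q(4)])
      then show ?case by simp
    qed simp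
    have "finite H" unfolding H_def using Gs(1) by blast
    moreover have "H \<subseteq> I" unfolding H_def using P by (auto simp: J_def)
    moreover have "I \<subseteq> lin_span (adjoin A t) H"
    proof
      fix x assume x: "x \<in> I"
      then obtain p where "x = poly p t" "\<forall>i. coeff p i \<in> A"
        using I unfolding ideal_in_def adjoin_def by blast
      then show "x \<in> lin_span (adjoin A t) H" using main[of p "Suc (degree p)"] x by (simp add: J_def)
    qed
    ultimately show ?thesis by blast
  qed
  then show ?thesis unfolding noetherian_subring_def using B by blast
qed

lemma noetherian_field:
  assumes A: "subring A" and inv: "\<And>x. x \<in> A \<Longrightarrow> x \<noteq> 0 \<Longrightarrow> \<exists>y\<in>A. x * y = 1"
  shows "noetherian_subring A"
  unfolding noetherian_subring_def
proof (intro conjI allI impI A)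
  fix I assume I: "ideal_in A I"
  show "\<exists>G. finite G \<and> G \<subseteq> I \<and> I \<subseteq> lin_span A G"
  proof (cases "I = {0}")
    case True
    then show ?thesis by (intro exI[of _ "{}"]) (auto intro: lin_span.zero)
  next
    case False
    then obtain x where x: "x \<in> I" "x \<noteq> 0" using I unfolding ideal_in_def by blast
    have "x \<in> A" using x(1) I unfolding ideal_in_def by blast
    from inv[OF this x(2)] obtain y where y: "y \<in> A" "x * y = 1" by blast
    have "z \<in> lin_span A {x}" if "z \<in> I" for z
    proof -
      have "z \<in> A" using that I unfolding ideal_in_def by blast
      then have "(z * y) * x + 0 \<in> lin_span A {x}"
        using y(1) by (intro lin_span.step lin_span.zero) (auto simp: subringD[OF A])
      moreover have "(z * y) * x = z" using y(2) by (metis mult.assoc mult.commute mult.right_neutral)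
      ultimately show ?thesis by simp
    qed
    then show ?thesis using x(1) by (intro exI[of _ "{x}"]) auto
  qed
qed

lemma noetherian_adjoin_finite:
  assumes "finite X" "noetherian_subring A"
  obtains B where "noetherian_subring B" "A \<union> X \<subseteq> B"
proof -
  have "\<exists>B. noetherian_subring B \<and> A \<union> X \<subseteq> B"
    using assms
  proof (induction X)
    case (insert t X)
    then obtain B where B: "noetherian_subring B" "A \<union> X \<subseteq> B" by blast
    have "subring B" using B(1) by (simp add: noetherian_subring_def)
    then show ?case using noetherian_adjoin[OF B(1), of t] adjoin_contains[of B t] B(2) by blast
  qed auto
  then show thesis using that by blast
qed

lemma noetherian_UNIV:
  assumes "noetherian_subring (UNIV :: 'r::comm_ring_1 set)" "is_ideal (I :: 'r set)"
  shows "\<exists>B. finite B \<and> I = module.span (*) B"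
proof -
  have "ideal_in UNIV I"
    using assms(2) by (auto simp: ideal_in_def ideal_zero ideal_add ideal_mult)
  then obtain G where G: "finite G" "G \<subseteq> I" "I \<subseteq> lin_span UNIV G"
    using assms(1) unfolding noetherian_subring_def by blast
  have "x \<in> module.span (*) G" if "x \<in> lin_span UNIV G" for x
    using that
    by induction (auto intro: module.span_add[OF module_mult] module.span_scale[OF module_mult]
        module.span_base[OF module_mult] simp: module.span_zero[OF module_mult])
  moreover have "module.span (*) G \<subseteq> I"
    using G(2) assms(2) unfolding is_ideal_def by (rule module.span_minimal[OF module_mult])
  ultimately show ?thesis using G by blast
qed

section \<open>Minimal graded resolutions over a standard graded algebra\<close>

definition component :: "('i \<Rightarrow> 'a::ab_group_add set) \<Rightarrow> 'a \<Rightarrow> 'i \<Rightarrow> 'a" where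
  "component A x = (THE f. (\<forall>i. f i \<in> A i) \<and> finite {i. f i \<noteq> 0} \<and> x = (\<Sum>i\<in>{i. f i \<noteq> 0}. f i))"

context
  fixes A :: "'i \<Rightarrow> 'a::ab_group_add set"
  assumes A: "internal_direct_sum A"
begin

lemma piece_zero: "0 \<in> A i"
  and piece_add: "x \<in> A i \<Longrightarrow> y \<in> A i \<Longrightarrow> x + y \<in> A i"
  and piece_neg: "x \<in> A i \<Longrightarrow> - x \<in> A i"
  using A by (auto simp: internal_direct_sum_def)

lemma piece_sum: "(\<And>l. l \<in> L \<Longrightarrow> f l \<in> A i) \<Longrightarrow> sum f L \<in> A i"
  by (induction L rule: infinite_finite_induct) (auto intro: piece_zero piece_add)

lemma component_props:
  "component A x i \<in> A i" "finite {i. component A x i \<noteq> 0}"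
  "x = (\<Sum>i\<in>{i. component A x i \<noteq> 0}. component A x i)"
proof -
  have "\<exists>!f. (\<forall>i. f i \<in> A i) \<and> finite {i. f i \<noteq> 0} \<and> x = (\<Sum>i\<in>{i. f i \<noteq> 0}. f i)"
    using A by (auto simp: internal_direct_sum_def)
  from theI'[OF this, folded component_def]
  show "component A x i \<in> A i" "finite {i. component A x i \<noteq> 0}"
    "x = (\<Sum>i\<in>{i. component A x i \<noteq> 0}. component A x i)" by blast+
qed

lemma component_unique:
  assumes "\<And>i. f i \<in> A i" "finite S" "\<And>i. i \<notin> S \<Longrightarrow> f i = 0" "x = (\<Sum>i\<in>S. f i)"
  shows "component A x = f"
proof -
  have "{i. f i \<noteq> 0} \<subseteq> S" using assms(3) by blast
  then have "finite {i. f i \<noteq> 0}" "x = (\<Sum>i\<in>{i. f i \<noteq> 0}. f i)"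
    using assms(2,4) by (auto simp: finite_subset intro: sum.mono_neutral_right)
  moreover have "\<exists>!f. (\<forall>i. f i \<in> A i) \<and> finite {i. f i \<noteq> 0} \<and> x = (\<Sum>i\<in>{i. f i \<noteq> 0}. f i)"
    using A by (auto simp: internal_direct_sum_def)
  ultimately show ?thesis
    using component_props[of x] assms(1) by blast
qed

lemma component_sum:
  assumes "finite S" "{i. component A x i \<noteq> 0} \<subseteq> S"
  shows "(\<Sum>i\<in>S. component A x i) = x"
  using assms component_props(3)[of x] by (metis (mono_tags, lifting) DiffD2 mem_Collect_eq sum.mono_neutral_right)

lemma component_add: "component A (x + y) i = component A x i + component A y i"
proof -
  let ?S = "{i. component A x i \<noteq> 0} \<union> {i. component A y i \<noteq> 0}"
  have S: "finite ?S" using component_props(2) by blast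
  have "x + y = (\<Sum>i\<in>?S. component A x i) + (\<Sum>i\<in>?S. component A y i)"
    by (subst (1 2) component_sum) (use S in auto)
  then have "x + y = (\<Sum>i\<in>?S. component A x i + component A y i)"
    by (simp only: sum.distrib)
  then have "component A (x + y) = (\<lambda>i. component A x i + component A y i)"
    by (intro component_unique[OF _ S]) (auto intro: piece_add component_props(1))
  then show ?thesis by simp
qed

lemma component_piece: "x \<in> A j \<Longrightarrow> component A x i = (if i = j then x else 0)"
  using component_unique[of "\<lambda>i. if i = j then x else 0" "{j}" x] by (auto simp: piece_zero)

end

text \<open>The projections onto the homogeneous components of a graded module, in the form in which
  they are used both for a module given by \<open>graded_module\<close> and for a free module \<open>R\<^sup>b\<close> with shifted
  degrees; the latter is only the part \<open>V\<close> of its type.\<close>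
locale graded_projections =
  fixes Rg :: "int \<Rightarrow> 'r::comm_ring_1 set" and s :: "'r \<Rightarrow> 'v::ab_group_add \<Rightarrow> 'v"
    and V :: "'v set" and c :: "int \<Rightarrow> 'v \<Rightarrow> 'v"
  assumes Rg: "internal_direct_sum Rg" and s: "module s"
    and c_add: "\<And>t x y. c t (x + y) = c t x + c t y"
    and c_scale: "\<And>t k a x. a \<in> Rg k \<Longrightarrow> c t (s a x) = s a (c (t - k) x)"
    and c_c: "\<And>t u x. c t (c u x) = (if t = u then c u x else 0)"
    and c_sum: "\<And>x. x \<in> V \<Longrightarrow> \<exists>T. finite T \<and> x = (\<Sum>t\<in>T. c t x)"
begin

lemma c_zero: "c t 0 = 0"
  using c_add[of t 0 0] by simp

lemma c_sum_distrib: "c t (\<Sum>l\<in>L. f l) = (\<Sum>l\<in>L. c t (f l))"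
  by (induction L rule: infinite_finite_induct) (auto simp: c_zero c_add)

text \<open>For homogeneous \<open>x\<close> of degree \<open>u\<close>, only the component of \<open>a\<close> of degree \<open>t - u\<close> contributes to
  degree \<open>t\<close>.\<close>
lemma c_homogeneous:
  assumes "c u x = x"
  shows "c t (s a x) = s (component Rg a (t - u)) x"
proof -
  interpret module s by (rule s)
  let ?S = "insert (t - u) {i. component Rg a i \<noteq> 0}"
  have S: "finite ?S" using component_props(2)[OF Rg] by simp
  have "s a x = (\<Sum>k\<in>?S. s (component Rg a k) x)"
    using component_sum[OF Rg S, of a] by (metis scale_sum_left subset_insertI)
  then have "c t (s a x) = (\<Sum>k\<in>?S. s (component Rg a k) (c (t - k) x))"
    by (simp only: c_sum_distrib c_scale[OF component_props(1)[OF Rg]])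
  also have "\<dots> = (\<Sum>k\<in>?S. if k = t - u then s (component Rg a k) x else 0)"
  proof (rule sum.cong[OF refl])
    fix k
    have "c (t - k) x = (if k = t - u then x else 0)"
      using c_c[of "t - k" u x] assms by auto
    then show "s (component Rg a k) (c (t - k) x) = (if k = t - u then s (component Rg a k) x else 0)"
      by simp
  qed
  also have "\<dots> = s (component Rg a (t - u)) x" using S by simp
  finally show ?thesis .
qed

lemma c_lin_comb:
  fixes n :: nat
  assumes "\<And>l. l < n \<Longrightarrow> c (\<delta> l) (g l) = g l"
  shows "c t (\<Sum>l<n. s (y l) (g l)) = (\<Sum>l<n. s (component Rg (y l) (t - \<delta> l)) (g l))"
  unfolding c_sum_distrib using assms by (intro sum.cong) (auto simp: c_homogeneous)

text \<open>A set of homogeneous generators without redundant elements has its relations in \<open>m\<close>, because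
  the homogeneous components of a relation are relations.\<close>
lemma minimal_homogeneous_generators:
  assumes inv: "\<And>x. x \<in> Rg 0 \<Longrightarrow> x \<noteq> 0 \<Longrightarrow> \<exists>y\<in>Rg 0. x * y = 1"
    and W: "finite A" "module.span s A = W" "W \<subseteq> V" "\<And>x t. x \<in> W \<Longrightarrow> c t x \<in> W"
  obtains n :: nat and g \<delta> where "\<And>l. l < n \<Longrightarrow> c (\<delta> l) (g l) = g l"
    "module.span s (g ` {..<n}) = W"
    "\<And>y l. (\<Sum>l<n. s (y l) (g l)) = 0 \<Longrightarrow> l < n \<Longrightarrow> component Rg (y l) 0 = 0"
proof -
  interpret module s by (rule s)
  have AW: "A \<subseteq> W" using W(2) span_superset by blast
  then have "\<forall>a\<in>A. \<exists>T. finite T \<and> a = (\<Sum>t\<in>T. c t a)" using c_sum W(3) by blast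
  then obtain T where T: "\<And>a. a \<in> A \<Longrightarrow> finite (T a)" "\<And>a. a \<in> A \<Longrightarrow> a = (\<Sum>t\<in>T a. c t a)"
    by metis
  define A' where "A' = (\<Union>a\<in>A. (\<lambda>t. c t a) ` T a)"
  have A': "finite A'" unfolding A'_def using W(1) T(1) by blast
  have "A' \<subseteq> W" unfolding A'_def using AW W(4) by blast
  then have "span A' \<subseteq> W" using W(2) span_minimal[of A' W] subspace_span[of A] by blast
  moreover have "A \<subseteq> span A'"
  proof
    fix a assume a: "a \<in> A"
    have "(\<Sum>t\<in>T a. c t a) \<in> span A'"
      by (intro span_sum span_base) (use a in \<open>auto simp: A'_def\<close>)
    then show "a \<in> span A'" using T(2)[OF a] by simp
  qed
  then have "W \<subseteq> span A'" using W(2) span_minimal[of A "span A'"] by blast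
  ultimately have sp: "span A' = W" by blast
  have hom: "\<exists>t. c t a = a" if "a \<in> A'" for a
    using that c_c unfolding A'_def by auto
  obtain B where B: "finite B" "\<And>b. b \<in> B \<Longrightarrow> \<exists>t. c t b = b" "span B = W"
    "\<And>b. b \<in> B \<Longrightarrow> b \<notin> span (B - {b})"
    using minimal_generating_set[where H = "\<lambda>a. \<exists>t. c t a = a", OF s A' hom sp] by blast
  obtain g where g: "inj_on g {..<card B}" "B = g ` {..<card B}"
    using ex_bij_betw_nat_finite[OF B(1)] unfolding bij_betw_def atLeast0LessThan by metis
  have "\<forall>l. \<exists>t. l < card B \<longrightarrow> c t (g l) = g l"
  proof
    fix l show "\<exists>t. l < card B \<longrightarrow> c t (g l) = g l"
    proof (cases "l < card B")
      case True
      then have "g l \<in> B" using imageI[of l "{..<card B}" g] unfolding g(2)[symmetric] by simp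
      then show ?thesis using B(2) by blast
    qed blast
  qed
  then obtain \<delta> where \<delta>: "\<And>l. l < card B \<Longrightarrow> c (\<delta> l) (g l) = g l" by metis
  have "component Rg (y k) 0 = 0"
    if rel: "(\<Sum>l<card B. s (y l) (g l)) = 0" and k: "k < card B" for y k
  proof (rule ccontr)
    \<comment> \<open>The component of the relation in the degree of \<open>g k\<close> has a unit as coefficient of \<open>g k\<close>.\<close>
    assume "component Rg (y k) 0 \<noteq> 0"
    then obtain v where v: "component Rg (y k) 0 * v = 1"
      using inv[OF component_props(1)[OF Rg]] by blast
    let ?y = "\<lambda>l. component Rg (y l) (\<delta> k - \<delta> l)"
    have "(\<Sum>l<card B. s (?y l) (g l)) = c (\<delta> k) (\<Sum>l<card B. s (y l) (g l))"
      by (rule c_lin_comb[OF \<delta>, symmetric])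
    then have "(\<Sum>l<card B. s (?y l) (g l)) = 0" by (simp only: rel c_zero)
    moreover have "v * ?y k = 1" using v by (simp add: mult.commute)
    moreover have "b \<notin> span (g ` {..<card B} - {b})" if "b \<in> g ` {..<card B}" for b
      using B(4) that unfolding g(2)[symmetric] .
    ultimately show False using irredundant_relation[OF s g(1), of ?y k v] k by blast
  qed
  moreover have "span (g ` {..<card B}) = W" unfolding g(2)[symmetric] by (rule B(3))
  ultimately show thesis using that[of "card B" \<delta> g] \<delta> by blast
qed

end

locale standard_graded_ring =
  fixes Rg :: "int \<Rightarrow> 'r::comm_ring_1 set"
  assumes std: "standard_graded Rg"
begin

abbreviation "mm \<equiv> graded_maximal_ideal Rg"

lemmas std_conj = std[unfolded standard_graded_def]

lemma Rg: "internal_direct_sum Rg"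
  by (rule std_conj[THEN conjunct1])

lemma Rg_neg: "n < 0 \<Longrightarrow> Rg n = {0}"
  by (rule std_conj[THEN conjunct2, THEN conjunct1, rule_format])

lemma Rg_one: "1 \<in> Rg 0"
  by (rule std_conj[THEN conjunct2, THEN conjunct2, THEN conjunct1])

lemma Rg_mult: "x \<in> Rg a \<Longrightarrow> y \<in> Rg b \<Longrightarrow> x * y \<in> Rg (a + b)"
  by (rule std_conj[THEN conjunct2, THEN conjunct2, THEN conjunct2, THEN conjunct1, rule_format])

lemma Rg_inverse: "x \<in> Rg 0 \<Longrightarrow> x \<noteq> 0 \<Longrightarrow> \<exists>y\<in>Rg 0. x * y = 1"
  by (rule std_conj[THEN conjunct2, THEN conjunct2, THEN conjunct2, THEN conjunct2, THEN conjunct1,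
      rule_format])

lemma Rg_generators: "\<exists>X. finite X \<and> X \<subseteq> Rg 1 \<and>
    (\<forall>S. Rg 0 \<union> X \<subseteq> S \<longrightarrow> (\<forall>x\<in>S. \<forall>y\<in>S. x + y \<in> S \<and> x * y \<in> S) \<longrightarrow> S = UNIV)"
  by (rule std_conj[THEN conjunct2, THEN conjunct2, THEN conjunct2, THEN conjunct2, THEN conjunct2])

text \<open>The algebra generated by the field \<open>R\<^sub>0\<close> and finitely many elements of degree one is the whole ring.\<close>
lemma noetherian: "is_ideal (J :: 'r set) \<Longrightarrow> \<exists>B. finite B \<and> J = module.span (*) B"
proof -
  have "subring (Rg 0)"
    unfolding subring_def
    using piece_zero[OF Rg] piece_add[OF Rg] piece_neg[OF Rg] Rg_one Rg_mult[of _ 0 _ 0] by auto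
  then have R0: "noetherian_subring (Rg 0)" by (rule noetherian_field[OF _ Rg_inverse])
  obtain X where X: "finite X" "\<forall>S. Rg 0 \<union> X \<subseteq> S \<longrightarrow>
      (\<forall>x\<in>S. \<forall>y\<in>S. x + y \<in> S \<and> x * y \<in> S) \<longrightarrow> S = UNIV"
    using Rg_generators by (elim exE conjE)
  obtain B where B: "noetherian_subring B" "Rg 0 \<union> X \<subseteq> B"
    using noetherian_adjoin_finite[OF X(1) R0] by blast
  have "\<forall>x\<in>B. \<forall>y\<in>B. x + y \<in> B \<and> x * y \<in> B"
    using B(1) by (simp add: noetherian_subring_def subring_def)
  then have "B = UNIV" by (rule X(2)[THEN spec, THEN mp, THEN mp, OF B(2)])
  then show "is_ideal J \<Longrightarrow> \<exists>B. finite B \<and> J = module.span (*) B"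
    using noetherian_UNIV B(1) by blast
qed

lemma mm_ideal: "is_ideal mm"
  unfolding graded_maximal_ideal_def is_ideal_def by (rule module.subspace_span[OF module_mult])

lemma mm_component:
  assumes "component Rg x 0 = 0" shows "x \<in> mm"
proof -
  have "component Rg x i \<in> mm" for i
  proof (cases "i \<ge> 1")
    case True
    then show ?thesis
      unfolding graded_maximal_ideal_def
      by (intro module.span_base[OF module_mult]) (use component_props(1)[OF Rg] in auto)
  next
    case False
    then have "component Rg x i = 0"
      using assms Rg_neg[of i] component_props(1)[OF Rg, of x i] by (cases "i = 0") auto
    then show ?thesis using ideal_zero[OF mm_ideal] by simp
  qed
  then have "(\<Sum>i\<in>{i. component Rg x i \<noteq> 0}. component Rg x i) \<in> mm"
    by (intro ideal_sum[OF mm_ideal])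
  then show ?thesis using component_props(3)[OF Rg, of x] by simp
qed

text \<open>An inverse of the component of degree zero is an inverse modulo the graded maximal ideal.\<close>
lemma mm_unit:
  assumes "a \<notin> mm" shows "\<exists>v. v * a - 1 \<in> mm"
proof -
  let ?a = "component Rg a 0"
  have "?a \<noteq> 0" using assms mm_component by blast
  then obtain v where v: "?a * v = 1" using Rg_inverse component_props(1)[OF Rg] by blast
  have "component Rg (a - ?a) 0 + component Rg ?a 0 = ?a"
    using component_add[OF Rg, of "a - ?a" ?a 0] by simp
  then have "component Rg (a - ?a) 0 = 0"
    using component_piece[OF Rg component_props(1)[OF Rg, of a 0], of 0] by simp
  then have "v * (a - ?a) \<in> mm" by (intro ideal_mult[OF mm_ideal] mm_component)
  moreover have "v * (a - ?a) = v * a - 1" using v by (simp add: algebra_simps)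
  ultimately show ?thesis by metis
qed

lemma component_scale:
  assumes M: "graded_module Rg s Mg" and a: "a \<in> Rg k"
  shows "component Mg (s a x) t = s a (component Mg x (t - k))"
proof -
  have Mg: "internal_direct_sum Mg" and s: "module s"
    and mult: "\<And>a b x y. x \<in> Rg a \<Longrightarrow> y \<in> Mg b \<Longrightarrow> s x y \<in> Mg (a + b)"
    using M unfolding graded_module_def by blast+
  interpret module s by (rule s)
  let ?S = "{i. component Mg x i \<noteq> 0}" and ?f = "\<lambda>t. s a (component Mg x (t - k))"
  have "component Mg (s a x) = ?f"
  proof (rule component_unique[OF Mg])
    show "?f t \<in> Mg t" for t
      using mult[OF a component_props(1)[OF Mg, of x "t - k"]] by simp
    show "finite ((\<lambda>i. i + k) ` ?S)" using component_props(2)[OF Mg] by blast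
    show "?f t = 0" if "t \<notin> (\<lambda>i. i + k) ` ?S" for t
    proof -
      have "t = (t - k) + k" by simp
      then have "t - k \<notin> ?S" using that by blast
      then show ?thesis by simp
    qed
    have "s a x = s a (\<Sum>i\<in>?S. component Mg x i)"
      using component_props(3)[OF Mg, of x] by simp
    then show "s a x = (\<Sum>i\<in>(\<lambda>i. i + k) ` ?S. ?f i)"
      by (simp add: sum.reindex scale_sum_right)
  qed
  then show ?thesis by simp
qed

lemma ring_graded: "graded_module Rg (*) Rg"
  unfolding graded_module_def using module_mult Rg Rg_mult by blast

lemma module_projections:
  assumes M: "graded_module Rg s Mg"
  shows "graded_projections Rg s UNIV (\<lambda>t x. component Mg x t)"
proof -
  have Mg: "internal_direct_sum Mg" and s: "module s"
    using M unfolding graded_module_def by blast+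
  show ?thesis
  proof (rule graded_projections.intro[OF Rg s])
    show "component Mg (x + y) t = component Mg x t + component Mg y t" for t x y
      by (rule component_add[OF Mg])
    show "component Mg (s a x) t = s a (component Mg x (t - k))" if "a \<in> Rg k" for t k a x
      by (rule component_scale[OF M that])
    show "component Mg (component Mg x u) t = (if t = u then component Mg x u else 0)" for t u x
      by (rule component_piece[OF Mg component_props(1)[OF Mg]])
    show "\<exists>T. finite T \<and> x = (\<Sum>t\<in>T. component Mg x t)" for x
      using component_props(2,3)[OF Mg] by blast
  qed
qed

text \<open>The component of degree \<open>t\<close> of an element of \<open>R\<^sup>b\<close> whose \<open>j\<close>-th basis vector has degree \<open>\<delta> j\<close>.\<close>
definition vec_component :: "nat \<Rightarrow> (nat \<Rightarrow> int) \<Rightarrow> int \<Rightarrow> (nat \<Rightarrow> 'r) \<Rightarrow> nat \<Rightarrow> 'r" where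
  "vec_component b \<delta> t x = (\<lambda>j. if j < b then component Rg (x j) (t - \<delta> j) else 0)"

lemma vec_projections: "graded_projections Rg vscale (free_vecs {..<b}) (vec_component b \<delta>)"
proof (rule graded_projections.intro[OF Rg vec.module_axioms])
  show "vec_component b \<delta> t (x + y) = vec_component b \<delta> t x + vec_component b \<delta> t y" for t x y
    by (auto simp: vec_component_def fun_eq_iff component_add[OF Rg])
  show "vec_component b \<delta> t (vscale a x) = vscale a (vec_component b \<delta> (t - k) x)" if "a \<in> Rg k" for t k a x
    by (auto simp: vec_component_def fun_eq_iff component_scale[OF ring_graded that] algebra_simps)
  show "vec_component b \<delta> t (vec_component b \<delta> u x) = (if t = u then vec_component b \<delta> u x else 0)" for t u x
    by (auto simp: vec_component_def fun_eq_iff component_piece[OF Rg component_props(1)[OF Rg]])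
  show "\<exists>T. finite T \<and> x = (\<Sum>t\<in>T. vec_component b \<delta> t x)" if x: "x \<in> free_vecs {..<b}" for x
  proof -
    let ?S = "\<lambda>j. {i. component Rg (x j) i \<noteq> 0}"
    let ?T = "\<Union>j<b. (\<lambda>i. i + \<delta> j) ` ?S j"
    have T: "finite ?T" using component_props(2)[OF Rg] by blast
    have eq: "x j = (\<Sum>t\<in>?T. vec_component b \<delta> t x j)" for j
    proof (cases "j < b")
      case True
      have "(\<Sum>t\<in>?T. vec_component b \<delta> t x j) = (\<Sum>i\<in>(\<lambda>t. t - \<delta> j) ` ?T. component Rg (x j) i)"
        using True by (subst sum.reindex) (auto simp: vec_component_def inj_on_def)
      also have "\<dots> = x j"
      proof (rule component_sum[OF Rg])
        show "?S j \<subseteq> (\<lambda>t. t - \<delta> j) ` ?T"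
        proof
          fix i assume "i \<in> ?S j"
          then have "i + \<delta> j \<in> ?T" using True by blast
          then have "(i + \<delta> j) - \<delta> j \<in> (\<lambda>t. t - \<delta> j) ` ?T" by (rule imageI)
          then show "i \<in> (\<lambda>t. t - \<delta> j) ` ?T" by simp
        qed
      qed (use T in blast)
      finally show ?thesis by simp
    next
      case False
      then show ?thesis using vecs_off[OF x] by (simp add: vec_component_def)
    qed
    have "x = (\<Sum>t\<in>?T. vec_component b \<delta> t x)"
      by (rule ext, subst sum_fun_apply, rule eq)
    with T show ?thesis by blast
  qed
qed

lemma kernel_graded:
  fixes n :: nat
  assumes "graded_projections Rg s V c" "\<And>l. l < n \<Longrightarrow> c (\<delta> l) (g l) = g l"
    and y: "y \<in> relations s n g"
  shows "vec_component n \<delta> t y \<in> relations s n g"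
proof -
  interpret graded_projections Rg s V c by fact
  have "(\<Sum>l<n. s (vec_component n \<delta> t y l) (g l)) = (\<Sum>l<n. s (component Rg (y l) (t - \<delta> l)) (g l))"
    by (intro sum.cong) (auto simp: vec_component_def)
  also have "\<dots> = c t (\<Sum>l<n. s (y l) (g l))" by (rule c_lin_comb[OF assms(2), symmetric])
  also have "\<dots> = 0" using y c_zero by simp
  finally show ?thesis by (auto simp: vecs_def vec_component_def)
qed

lemma minimal_resolution_graded:
  assumes M: "graded_module Rg s Mg" and fg: "finitely_generated s"
  shows "\<exists>F. minimal_complex mm F \<and> graded_resolution Rg s Mg F"
proof -
  have Mg: "internal_direct_sum Mg" and s: "module s"
    and smult: "\<And>a b x y. x \<in> Rg a \<Longrightarrow> y \<in> Mg b \<Longrightarrow> s x y \<in> Mg (a + b)"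
    using M unfolding graded_module_def by blast+
  define Good :: "nat \<Rightarrow> (nat \<Rightarrow> int) \<Rightarrow> (nat \<Rightarrow> 'r) set \<Rightarrow> bool" where
    "Good b \<delta> Z \<longleftrightarrow> (vec.subspace Z \<and> (\<forall>x\<in>Z. \<forall>t. vec_component b \<delta> t x \<in> Z)) \<and> Z \<subseteq> vecs mm {..<b}" for b \<delta> Z
  define Hom :: "nat \<Rightarrow> (nat \<Rightarrow> int) \<Rightarrow> nat \<Rightarrow> (nat \<Rightarrow> int) \<Rightarrow> (nat \<Rightarrow> nat \<Rightarrow> 'r) \<Rightarrow> bool" where
    "Hom b \<delta> c \<delta>' g \<longleftrightarrow> (\<forall>l<c. \<forall>j<b. g l j \<in> Rg (\<delta>' l - \<delta> j))" for b \<delta> c \<delta>' g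
  have gens: "\<exists>n g \<delta>. module.span t (g ` {..<n}) = W \<and> (\<forall>l<n. c (\<delta> l) (g l) = g l) \<and>
      Good n \<delta> (relations t n g)"
    if proj: "graded_projections Rg t V c" and W: "finite A" "module.span t A = W" "W \<subseteq> V"
      "\<And>x k. x \<in> W \<Longrightarrow> c k x \<in> W"
    for t :: "'r \<Rightarrow> 'x::ab_group_add \<Rightarrow> 'x" and V c A W
  proof -
    obtain n :: nat and g \<delta> where g: "\<And>l. l < n \<Longrightarrow> c (\<delta> l) (g l) = g l"
      "module.span t (g ` {..<n}) = W"
      "\<And>y l. (\<Sum>l<n. t (y l) (g l)) = 0 \<Longrightarrow> l < n \<Longrightarrow> component Rg (y l) 0 = 0"
      using graded_projections.minimal_homogeneous_generators[OF proj Rg_inverse W] by blast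
    let ?Z = "relations t n g"
    have t: "module t" using proj by (rule graded_projections.s)
    have "vec.subspace ?Z" by (rule relations_subspace[OF t])
    moreover have "?Z \<subseteq> vecs mm {..<n}"
    proof
      fix y assume y: "y \<in> ?Z"
      then have "y l \<in> mm" if "l < n" for l
        using g(3)[OF _ that] mm_component by blast
      then show "y \<in> vecs mm {..<n}" using y by (auto simp: vecs_def)
    qed
    moreover have "vec_component n \<delta> k y \<in> ?Z" if "y \<in> ?Z" for y k
      by (rule kernel_graded[where c = c and g = g and \<delta> = \<delta>, OF proj g(1) that])
    ultimately have "Good n \<delta> ?Z"
      unfolding Good_def by (intro conjI ballI allI)
    with g show ?thesis by blast
  qed
  obtain A where A: "finite A" "module.span s A = UNIV" using fg unfolding finitely_generated_def by blast
  obtain n g \<delta>0 where g: "module.span s (g ` {..<n}) = UNIV"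
    and g_hom: "\<forall>l<n. component Mg (g l) (\<delta>0 l) = g l"
    and start: "Good n \<delta>0 (relations s n g)"
    using gens[OF module_projections[OF M] A] by auto
  have step: "\<exists>c \<delta>' g. (\<forall>l<c. g l \<in> free_vecs {..<b}) \<and> vec.span (g ` {..<c}) = Z \<and> Hom b \<delta> c \<delta>' g \<and>
      Good c \<delta>' (relations vscale c g)"
    if good: "Good b \<delta> Z" for b \<delta> Z
  proof -
    have Z: "vec.subspace Z" "Z \<subseteq> free_vecs {..<b}" "\<And>x k. x \<in> Z \<Longrightarrow> vec_component b \<delta> k x \<in> Z"
      using good vecs_free unfolding Good_def by blast+
    obtain A where A: "finite A" "vec.span A = Z"
      using submodule_finitely_generated[OF noetherian Z(1,2)] by blast
    obtain c g \<delta>' where g: "vec.span (g ` {..<c}) = Z"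
      "\<forall>l<c. vec_component b \<delta> (\<delta>' l) (g l) = g l"
      "Good c \<delta>' (relations vscale c g)"
      using gens[OF vec_projections A Z(2,3)] by blast
    have "g l \<in> free_vecs {..<b}" if l: "l < c" for l
    proof -
      have "g l \<in> vec.span (g ` {..<c})" using l by (intro vec.span_base imageI) simp
      then show ?thesis using g(1) Z(2) by blast
    qed
    moreover have "g l j \<in> Rg (\<delta>' l - \<delta> j)" if "l < c" "j < b" for l j
    proof -
      have "g l j = component Rg (g l j) (\<delta>' l - \<delta> j)"
        using g(2) that by (metis (no_types) vec_component_def)
      then show ?thesis using component_props(1)[OF Rg] by metis
    qed
    ultimately show ?thesis
      by (intro exI[of _ c] exI[of _ \<delta>'] exI[of _ g] conjI allI impI g) (auto simp: Hom_def)
  qed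
  have sub: "Z \<subseteq> vecs mm {..<b}" if "Good b \<delta> Z" for b \<delta> Z using that unfolding Good_def by blast
  obtain F :: "'r free_complex" and \<delta> where rank: "free_rank F 0 = n" and \<delta>0: "\<delta> 0 = \<delta>0"
    and min: "minimal_complex mm F"
    and res: "free_resolution (additive_group UNIV) s F (\<lambda>y. \<Sum>l<free_rank F 0. s (y l) (g l))"
    and hom: "\<And>i. Hom (free_rank F i) (\<delta> i) (free_rank F (Suc i)) (\<delta> (Suc i)) (\<lambda>l j. diff_mat F i j l)"
    by (rule minimal_resolution_by_steps[where Good = Good and H = Hom, OF mm_ideal s g sub start step])
      (assumption+, rule that)
  have "graded_resolution Rg s Mg F"
    unfolding graded_resolution_def
  proof (intro exI conjI allI)
    show "free_resolution (additive_group UNIV) s F (\<lambda>y. \<Sum>l<free_rank F 0. s (y l) (g l))"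
      by (rule res)
    show "(\<lambda>y. \<Sum>l<free_rank F 0. s (y l) (g l)) ` graded_free_piece Rg F \<delta> 0 t \<subseteq> Mg t" for t
    proof -
      have "s (y l) (g l) \<in> Mg t" if "y \<in> graded_free_piece Rg F \<delta> 0 t" "l < n" for y l
      proof -
        have "y l \<in> Rg (t - \<delta>0 l)" using that by (auto simp: graded_free_piece_def rank \<delta>0)
        moreover have "g l \<in> Mg (\<delta>0 l)" using g_hom that(2) component_props(1)[OF Mg] by metis
        ultimately have "s (y l) (g l) \<in> Mg ((t - \<delta>0 l) + \<delta>0 l)" by (rule smult)
        then show ?thesis by simp
      qed
      then show ?thesis by (auto simp: rank intro!: piece_sum[OF Mg])
    qed
    show "free_diff F i ` graded_free_piece Rg F \<delta> (Suc i) t \<subseteq> graded_free_piece Rg F \<delta> i t" for i t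
    proof -
      have "diff_mat F i j l * y l \<in> Rg (t - \<delta> i j)"
        if "y \<in> graded_free_piece Rg F \<delta> (Suc i) t" "l < free_rank F (Suc i)" "j < free_rank F i" for y j l
      proof -
        have "y l \<in> Rg (t - \<delta> (Suc i) l)" using that by (auto simp: graded_free_piece_def)
        moreover have "diff_mat F i j l \<in> Rg (\<delta> (Suc i) l - \<delta> i j)"
          using hom that(2,3) unfolding Hom_def by blast
        ultimately have "diff_mat F i j l * y l \<in> Rg ((\<delta> (Suc i) l - \<delta> i j) + (t - \<delta> (Suc i) l))"
          by (intro Rg_mult)
        then show ?thesis by simp
      qed
      then show ?thesis
        by (auto simp: graded_free_piece_def carrier_free_chain tensor_diff_def vecs_def
            intro!: piece_sum[OF Rg])
    qed
  qed
  with min show ?thesis by blast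
qed

end

section \<open>The estimates for the linearity defect\<close>

lemma inf_fromD:
  assumes "inf_from Z \<le> enat i" shows "Z i"
proof -
  let ?S = "enat ` {n. \<forall>i\<ge>n. Z i}"
  have "?S \<noteq> {}"
    using assms unfolding inf_from_def by (auto simp: Inf_enat_def split: if_splits)
  then have "Inf ?S \<in> ?S"
    unfolding Inf_enat_def using LeastI_ex[of "\<lambda>x. x \<in> ?S"] by (simp only: if_False) blast
  then obtain n where "Inf ?S = enat n" "\<forall>i\<ge>n. Z i" by blast
  then show ?thesis using assms unfolding inf_from_def by simp
qed

lemma tor_shift_above_defect:
  assumes "minimal_complex m F" "is_ideal m" "free_resolution Q act F e" "lin_sup m F \<le> enat i"
  shows "tor_shift_zero m (basis F) (free_diff F) i"
proof -
  interpret minimal_free_complex m F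
    by unfold_locales (use assms minimal_complexD free_resolution_exact(2) in blast)+
  show ?thesis by (rule shift_above_lin_sup[OF assms(4)])
qed

lemma defect_le:
  assumes "minimal_complex m F" "is_ideal m" "free_resolution Q act F e"
    and "\<And>j. i \<le> j \<Longrightarrow> tor_shift_zero m (basis F) (free_diff F) j"
  shows "lin_sup m F \<le> enat i"
proof -
  interpret minimal_free_complex m F
    by unfold_locales (use assms minimal_complexD free_resolution_exact(2) in blast)+
  show ?thesis by (rule lin_sup_le[OF assms(4)])
qed

text \<open>The vanishing conditions for \<open>N\<close> are moved between its minimal resolution, which computes the defect,
  and the cone, to which the estimates apply.\<close>
lemma lin_sup_estimates:
  fixes m :: "'r::comm_ring_1 set"
    and sM :: "'r \<Rightarrow> 'm::ab_group_add \<Rightarrow> 'm" and sP :: "'r \<Rightarrow> 'p::ab_group_add \<Rightarrow> 'p"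
    and sN :: "'r \<Rightarrow> 'n::ab_group_add \<Rightarrow> 'n" and i :: nat
  assumes m: "is_ideal m" and unit: "\<And>c. c \<notin> m \<Longrightarrow> \<exists>v. v * c - 1 \<in> m"
    and K: "residue_field_resolution m (residue_resolution m) c"
    and se: "short_exact sM sP sN \<phi> lam"
    and FM: "minimal_complex m FM" "free_resolution (additive_group UNIV) sM FM eM"
    and FP: "minimal_complex m FP" "free_resolution (additive_group UNIV) sP FP eP"
    and FN: "minimal_complex m FN" "free_resolution (additive_group UNIV) sN FN eN"
  defines "dM \<equiv> inf_from (\<lambda>i.
      zero_map (Tor_k m sN (Suc i)) (Tor_k m sM i) (Tor_k_connecting m sM sP \<phi> lam i))"
    and "dP \<equiv> inf_from (\<lambda>i. zero_map (Tor_k m sM i) (Tor_k m sP i) (Tor_k_map m sP \<phi> i))"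
    and "dN \<equiv> inf_from (\<lambda>i. zero_map (Tor_k m sP i) (Tor_k m sN i) (Tor_k_map m sN lam i))"
  shows "dP \<le> enat i \<or> dM + 1 \<le> enat i \<Longrightarrow> lin_sup m FP \<le> enat i \<Longrightarrow> lin_sup m FM + 1 \<le> enat i \<Longrightarrow>
      lin_sup m FN \<le> enat i"
    and "dM \<le> enat i \<or> dN \<le> enat i \<Longrightarrow> lin_sup m FM \<le> enat i \<Longrightarrow> lin_sup m FN \<le> enat i \<Longrightarrow>
      lin_sup m FP \<le> enat i"
    and "dN \<le> enat (Suc i) \<or> dP \<le> enat i \<Longrightarrow> lin_sup m FN \<le> enat (Suc i) \<Longrightarrow> lin_sup m FP \<le> enat i \<Longrightarrow>
      lin_sup m FM \<le> enat i"
proof -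
  have mod: "module sM" "module sP" "module sN" and \<phi>: "module_hom sM sP \<phi>"
    using se by (auto simp: short_exact_def module_hom_iff)
  obtain e\<^sub>M where RM: "resolution sM (basis FM) (free_diff FM) e\<^sub>M"
    using resolution_of_free_resolution[OF mod(1) FM(2)] .
  obtain e\<^sub>P where RP: "resolution sP (basis FP) (free_diff FP) e\<^sub>P"
    using resolution_of_free_resolution[OF mod(2) FP(2)] .
  obtain e\<^sub>N where RN: "resolution sN (basis FN) (free_diff FN) e\<^sub>N"
    using resolution_of_free_resolution[OF mod(3) FN(2)] .
  obtain u where u: "\<And>i. linear_map (u i)"
    "\<And>i x. x \<in> fchain FM i \<Longrightarrow> u i x \<in> fchain FP i"
    "\<And>x. x \<in> fchain FM 0 \<Longrightarrow> e\<^sub>P (u 0 x) = \<phi> (e\<^sub>M x)"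
    "\<And>i x. x \<in> fchain FM (Suc i) \<Longrightarrow> free_diff FP i (u (Suc i) x) = u i (free_diff FM i x)"
    using comparison_map[OF RM RP \<phi>] by blast
  interpret R: residue_field_resolution m "residue_resolution m" c by (rule K)
  interpret A: resolution sM "basis FM" "free_diff FM" e\<^sub>M by (rule RM)
  interpret B: resolution sP "basis FP" "free_diff FP" e\<^sub>P by (rule RP)
  interpret C: tor_comparison sM "basis FM" "free_diff FM" e\<^sub>M
    sP "basis FP" "free_diff FP" e\<^sub>P m u "residue_resolution m" c \<phi>
    by (intro tor_comparison.intro chain_map_of_minimal.intro RM RP K
        chain_map_of_minimal_axioms.intro tor_comparison_axioms.intro m \<phi> u)
      (simp_all add: minimal_complexD[OF FM(1) m] minimal_complexD[OF FP(1) m])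
  note cone = cone_resolution[OF C.chain_map_of_minimal_axioms se u(3)]
  have shift_cone_iff: "tor_shift_zero m (basis FN) (free_diff FN) j \<longleftrightarrow>
      tor_shift_zero m C.cone_basis C.cone_diff j" for j
    using tor_shift_zero_independent[OF RN cone m] tor_shift_zero_independent[OF cone RN m] by blast
  have inj: "C.inj_mod j" if "dM \<le> enat j" for j
    by (rule C.inj_mod_from_tor, rule tor_connecting_zeroD[OF inf_fromD[OF that[unfolded dM_def]] se])
  have zero: "C.zero_mod j" if "dP \<le> enat j" for j
    by (rule C.zero_mod_from_tor, rule tor_map_zeroD[OF inf_fromD[OF that[unfolded dP_def]] mod(1,2)])
  have sur: "C.surj_mod j" if "dN \<le> enat j" for j
    by (rule C.surj_mod_from_tor, rule tor_map_zero_lift[OF inf_fromD[OF that[unfolded dN_def]] se K])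
  note SM = tor_shift_above_defect[OF FM(1) m FM(2)]
  note SP = tor_shift_above_defect[OF FP(1) m FP(2)]
  note SN = tor_shift_above_defect[OF FN(1) m FN(2)]
  have up: "x \<le> enat a \<Longrightarrow> a \<le> b \<Longrightarrow> x \<le> enat b" for x a b
    by (metis enat_ord_simps(1) order_trans)
  have down: "x + 1 \<le> enat (Suc b) \<Longrightarrow> x \<le> enat b" for x b
    by (cases x) (auto simp: one_enat_def)
  show "lin_sup m FN \<le> enat i"
    if d: "dP \<le> enat i \<or> dM + 1 \<le> enat i" and P: "lin_sup m FP \<le> enat i" and M: "lin_sup m FM + 1 \<le> enat i"
  proof (rule defect_le[OF FN(1) m FN(2)])
    fix j assume j: "i \<le> j"
    have "i \<noteq> 0" using M by (cases "lin_sup m FM") (auto simp: one_enat_def)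
    then obtain k where k: "j = Suc k" using j by (cases j) auto
    have "lin_sup m FM \<le> enat k" using down up[OF M j] k by blast
    moreover have "C.zero_mod (Suc k) \<or> C.inj_mod k"
      using d zero inj up[OF _ j] down unfolding k by blast
    ultimately show "tor_shift_zero m (basis FN) (free_diff FN) j"
      unfolding shift_cone_iff unfolding k
      using up[OF P j] unfolding k by (intro C.right_shift[OF unit] SM SP)
  qed
  show "lin_sup m FP \<le> enat i"
    if d: "dM \<le> enat i \<or> dN \<le> enat i" and M: "lin_sup m FM \<le> enat i" and N: "lin_sup m FN \<le> enat i"
  proof (rule defect_le[OF FP(1) m FP(2)])
    fix j assume j: "i \<le> j"
    have "C.inj_mod j \<or> C.surj_mod j" using d inj sur up[OF _ j] by blast
    then show "tor_shift_zero m (basis FP) (free_diff FP) j"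
      using SM[OF up[OF M j]] SN[OF up[OF N j]] unfolding shift_cone_iff
      by (intro C.middle_shift[OF unit])
  qed
  show "lin_sup m FM \<le> enat i"
    if d: "dN \<le> enat (Suc i) \<or> dP \<le> enat i" and N: "lin_sup m FN \<le> enat (Suc i)" and P: "lin_sup m FP \<le> enat i"
  proof (rule defect_le[OF FM(1) m FM(2)])
    fix j assume j: "i \<le> j"
    then have j': "Suc i \<le> Suc j" by simp
    have "C.surj_mod (Suc j) \<or> C.zero_mod j" using d zero sur up[OF _ j] up[OF _ j'] by blast
    then show "tor_shift_zero m (basis FM) (free_diff FM) j"
      using SP[OF up[OF P j]] SN[OF up[OF N j']] unfolding shift_cone_iff
      by (intro C.left_shift)
  qed
qed

lemma ereal_of_enat_max: "ereal_of_enat (max a b) = max (ereal_of_enat a) (ereal_of_enat b)"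
  and ereal_of_enat_min: "ereal_of_enat (min a b) = min (ereal_of_enat a) (ereal_of_enat b)"
  by (simp_all add: max_def min_def)

lemma enat_bounded_by_nats:
  fixes x r :: enat
  assumes "\<And>i. r \<le> enat i \<Longrightarrow> x \<le> enat i"
  shows "x \<le> r"
  using assms by (cases r) auto

text \<open>The passage to extended reals. The differences \<open>dN - 1\<close> and \<open>ldN - 1\<close> may be negative there and are
  truncated in \<open>enat\<close>, but the maximum is the same, because \<open>ldP\<close> is nonnegative.\<close>
lemma ereal_estimates:
  fixes dM dP dN ldM ldP ldN :: enat
  assumes 1: "\<And>i. dP \<le> enat i \<or> dM + 1 \<le> enat i \<Longrightarrow> ldP \<le> enat i \<Longrightarrow> ldM + 1 \<le> enat i \<Longrightarrow> ldN \<le> enat i"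
    and 2: "\<And>i. dM \<le> enat i \<or> dN \<le> enat i \<Longrightarrow> ldM \<le> enat i \<Longrightarrow> ldN \<le> enat i \<Longrightarrow> ldP \<le> enat i"
    and 3: "\<And>i. dN \<le> enat (Suc i) \<or> dP \<le> enat i \<Longrightarrow> ldN \<le> enat (Suc i) \<Longrightarrow> ldP \<le> enat i \<Longrightarrow> ldM \<le> enat i"
  shows "ereal_of_enat ldN \<le> Max {min (ereal_of_enat dP) (ereal_of_enat dM + 1), ereal_of_enat ldP, ereal_of_enat ldM + 1}"
    and "ereal_of_enat ldP \<le> Max {min (ereal_of_enat dM) (ereal_of_enat dN), ereal_of_enat ldM, ereal_of_enat ldN}"
    and "ereal_of_enat ldM \<le> Max {min (ereal_of_enat dN - 1) (ereal_of_enat dP), ereal_of_enat ldN - 1, ereal_of_enat ldP}"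
proof -
  have plus: "ereal_of_enat x + 1 = ereal_of_enat (x + 1)" for x
    by (cases x) (auto simp: one_enat_def one_ereal_def)
  have "ldN \<le> max (min dP (dM + 1)) (max ldP (ldM + 1))"
    by (rule enat_bounded_by_nats) (auto simp: min_le_iff_disj intro: 1)
  then have "ereal_of_enat ldN \<le> ereal_of_enat (max (min dP (dM + 1)) (max ldP (ldM + 1)))"
    by simp
  then show "ereal_of_enat ldN \<le> Max {min (ereal_of_enat dP) (ereal_of_enat dM + 1), ereal_of_enat ldP, ereal_of_enat ldM + 1}"
    by (simp add: plus ereal_of_enat_max ereal_of_enat_min)
  have "ldP \<le> max (min dM dN) (max ldM ldN)"
    by (rule enat_bounded_by_nats) (auto simp: min_le_iff_disj intro: 2)
  then have "ereal_of_enat ldP \<le> ereal_of_enat (max (min dM dN) (max ldM ldN))"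
    by simp
  then show "ereal_of_enat ldP \<le> Max {min (ereal_of_enat dM) (ereal_of_enat dN), ereal_of_enat ldM, ereal_of_enat ldN}"
    by (simp add: ereal_of_enat_max ereal_of_enat_min)
  have minus: "x - 1 \<le> enat i \<longleftrightarrow> x \<le> enat (Suc i)" for x i
    by (cases x) (auto simp: one_enat_def)
  have "ldM \<le> max (min (dN - 1) dP) (max (ldN - 1) ldP)"
    by (rule enat_bounded_by_nats) (auto simp: min_le_iff_disj minus intro: 3)
  then have "ereal_of_enat ldM \<le> ereal_of_enat (max (min (dN - 1) dP) (max (ldN - 1) ldP))"
    by simp
  also have "\<dots> \<le> max (min (ereal_of_enat dN - 1) (ereal_of_enat dP)) (max (ereal_of_enat ldN - 1) (ereal_of_enat ldP))"
  proof -
    have trunc: "ereal_of_enat (x - 1) = max 0 (ereal_of_enat x - 1)" for x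
      by (cases x) (auto simp: one_enat_def one_ereal_def zero_ereal_def max_def)
    have nonneg: "0 \<le> ereal_of_enat dP" "0 \<le> ereal_of_enat ldP" by simp_all
    have "max (min (max 0 a) b) (max (max 0 c) d) \<le> max (min a b) (max c d)"
      if "0 \<le> b" "0 \<le> d" for a b c d :: ereal
      using that by (auto simp: max_def min_def)
    from this[OF nonneg] show ?thesis by (simp only: ereal_of_enat_max ereal_of_enat_min trunc)
  qed
  finally show "ereal_of_enat ldM \<le> Max {min (ereal_of_enat dN - 1) (ereal_of_enat dP), ereal_of_enat ldN - 1, ereal_of_enat ldP}"
    by simp
qed

theorem proposition2p5:
  fixes m :: "'r::comm_ring_1 set"
    and sM :: "'r \<Rightarrow> 'm::ab_group_add \<Rightarrow> 'm"
    and sP :: "'r \<Rightarrow> 'p::ab_group_add \<Rightarrow> 'p"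
    and sN :: "'r \<Rightarrow> 'n::ab_group_add \<Rightarrow> 'n"
    and \<phi> :: "'m \<Rightarrow> 'p" and lam :: "'p \<Rightarrow> 'n"
    and Rg :: "int \<Rightarrow> 'r set"
    and Mg :: "int \<Rightarrow> 'm set" and Pg :: "int \<Rightarrow> 'p set" and Ng :: "int \<Rightarrow> 'n set"
    and dM dP dN :: ereal
  assumes exact: "short_exact sM sP sN \<phi> lam"
    and fg: "finitely_generated sM" "finitely_generated sP" "finitely_generated sN"
    and nonzero: "(UNIV :: 'm set) \<noteq> {0}" "(UNIV :: 'p set) \<noteq> {0}" "(UNIV :: 'n set) \<noteq> {0}"
    and dM: "dM = ereal_of_enat (inf_from (\<lambda>i.
      zero_map (Tor_k m sN (Suc i)) (Tor_k m sM i) (Tor_k_connecting m sM sP \<phi> lam i)))"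
    and dP: "dP = ereal_of_enat (inf_from (\<lambda>i.
      zero_map (Tor_k m sM i) (Tor_k m sP i) (Tor_k_map m sP \<phi> i)))"
    and dN: "dN = ereal_of_enat (inf_from (\<lambda>i.
      zero_map (Tor_k m sP i) (Tor_k m sN i) (Tor_k_map m sN lam i)))"
  shows "(noetherian_local m \<longrightarrow>
    (let ldM = ereal_of_enat (linearity_defect m sM);
         ldP = ereal_of_enat (linearity_defect m sP);
         ldN = ereal_of_enat (linearity_defect m sN)
     in ldN \<le> Max {min dP (dM + 1), ldP, ldM + 1} \<and>
        ldP \<le> Max {min dM dN, ldM, ldN} \<and>
        ldM \<le> Max {min (dN - 1) dP, ldN - 1, ldP})) \<and>
   (standard_graded Rg \<and> m = graded_maximal_ideal Rg \<and>
    graded_module Rg sM Mg \<and> graded_module Rg sP Pg \<and> graded_module Rg sN Ng \<and>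
    (\<forall>t. \<phi> ` Mg t \<subseteq> Pg t) \<and> (\<forall>t. lam ` Pg t \<subseteq> Ng t) \<longrightarrow>
    (let ldM = ereal_of_enat (graded_linearity_defect Rg sM Mg);
         ldP = ereal_of_enat (graded_linearity_defect Rg sP Pg);
         ldN = ereal_of_enat (graded_linearity_defect Rg sN Ng)
     in ldN \<le> Max {min dP (dM + 1), ldP, ldM + 1} \<and>
        ldP \<le> Max {min dM dN, ldM, ldN} \<and>
        ldM \<le> Max {min (dN - 1) dP, ldN - 1, ldP}))"
proof -
  have mod: "module sM" "module sP" "module sN"
    using exact by (auto simp: short_exact_def module_hom_iff)
  have estimates: "ereal_of_enat (lin_sup m FN) \<le> Max {min dP (dM + 1), ereal_of_enat (lin_sup m FP), ereal_of_enat (lin_sup m FM) + 1} \<and>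
      ereal_of_enat (lin_sup m FP) \<le> Max {min dM dN, ereal_of_enat (lin_sup m FM), ereal_of_enat (lin_sup m FN)} \<and>
      ereal_of_enat (lin_sup m FM) \<le> Max {min (dN - 1) dP, ereal_of_enat (lin_sup m FN) - 1, ereal_of_enat (lin_sup m FP)}"
    if noeth: "\<And>A :: 'r set. is_ideal A \<Longrightarrow> \<exists>B. finite B \<and> A = module.span (*) B"
      and m: "is_ideal m" and unit: "\<And>c. c \<notin> m \<Longrightarrow> \<exists>v. v * c - 1 \<in> m"
      and FM: "minimal_complex m FM \<and> (\<exists>e. free_resolution (additive_group UNIV) sM FM e)"
      and FP: "minimal_complex m FP \<and> (\<exists>e. free_resolution (additive_group UNIV) sP FP e)"
      and FN: "minimal_complex m FN \<and> (\<exists>e. free_resolution (additive_group UNIV) sN FN e)"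
    for FM FP FN
  proof -
    obtain c where K: "residue_field_resolution m (residue_resolution m) c"
      by (rule residue_resolution_exists[OF noeth m])
    obtain eM eP eN where res: "free_resolution (additive_group UNIV) sM FM eM"
      "free_resolution (additive_group UNIV) sP FP eP" "free_resolution (additive_group UNIV) sN FN eN"
      using FM FP FN by blast
    note est = lin_sup_estimates[OF m unit K exact conjunct1[OF FM] res(1) conjunct1[OF FP] res(2)
        conjunct1[OF FN] res(3)]
    show ?thesis unfolding dM dP dN
      by (rule conjI[OF _ conjI]; rule ereal_estimates[OF est(1) est(2) est(3)]; assumption)
  qed
  show ?thesis
  proof (intro conjI impI)
    assume loc: "noetherian_local m"
    note conj = loc[unfolded noetherian_local_def is_maximal_ideal_def]
    have m: "is_ideal m"
      by (rule conj[THEN conjunct2, THEN conjunct1, THEN conjunct1])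
    have noeth: "\<exists>B. finite B \<and> A = module.span (*) B" if "is_ideal A" for A :: "'r set"
      by (rule conj[THEN conjunct1, THEN spec, THEN mp, OF that])
    have unit: "\<exists>v. v * c - 1 \<in> m" if "c \<notin> m" for c
      using local_unit[OF loc that] ideal_zero[OF m] by (metis diff_self)
    note exists = minimal_resolution_local[OF noeth m local_unit[OF loc]]
    show "let ldM = ereal_of_enat (linearity_defect m sM);
         ldP = ereal_of_enat (linearity_defect m sP);
         ldN = ereal_of_enat (linearity_defect m sN)
     in ldN \<le> Max {min dP (dM + 1), ldP, ldM + 1} \<and>
        ldP \<le> Max {min dM dN, ldM, ldN} \<and>
        ldM \<le> Max {min (dN - 1) dP, ldN - 1, ldP}"
      unfolding Let_def linearity_defect_def
      by (rule estimates[OF noeth m unit someI_ex someI_ex someI_ex])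
        (auto intro: exists mod fg)
  next
    assume gr: "standard_graded Rg \<and> m = graded_maximal_ideal Rg \<and>
      graded_module Rg sM Mg \<and> graded_module Rg sP Pg \<and> graded_module Rg sN Ng \<and>
      (\<forall>t. \<phi> ` Mg t \<subseteq> Pg t) \<and> (\<forall>t. lam ` Pg t \<subseteq> Ng t)"
    then interpret standard_graded_ring Rg by unfold_locales blast
    have m: "m = graded_maximal_ideal Rg" using gr by blast
    have F: "minimal_complex m (SOME F. minimal_complex m F \<and> graded_resolution Rg s Xg F) \<and>
        (\<exists>e. free_resolution (additive_group UNIV) s (SOME F. minimal_complex m F \<and> graded_resolution Rg s Xg F) e)"
      if "graded_module Rg s Xg" "finitely_generated s" for s :: "'r \<Rightarrow> 'x::ab_group_add \<Rightarrow> 'x" and Xg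
      using someI_ex[OF minimal_resolution_graded[OF that]] unfolding m graded_resolution_def by blast
    show "let ldM = ereal_of_enat (graded_linearity_defect Rg sM Mg);
         ldP = ereal_of_enat (graded_linearity_defect Rg sP Pg);
         ldN = ereal_of_enat (graded_linearity_defect Rg sN Ng)
     in ldN \<le> Max {min dP (dM + 1), ldP, ldM + 1} \<and>
        ldP \<le> Max {min dM dN, ldM, ldN} \<and>
        ldM \<le> Max {min (dN - 1) dP, ldN - 1, ldP}"
      unfolding Let_def graded_linearity_defect_def m[symmetric]
      using gr fg mm_ideal mm_unit unfolding m[symmetric]
      by (intro estimates[OF noetherian] F) blast+
  qed
qed

end
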